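(* For every $\mathbf n\in S^{d-1}$, $\beta\ge0$ and $\tau>\tau^{\min}(\mathbf n)$, the limit $$I_{\mathbf n}(\tau)=\lim_{N\to\infty}-\frac1{N^{d-1}}\log\mathbb P\Big(\tau^J_{\mathcal R_{0,N,\delta N}(\mathcal S,\mathbf n)}\le\tau\Big)$$ exists in $[0,+\infty)$ and does not depend on $\delta>0$, nor on $\mathcal S\in\mathbb S_{\mathbf n}$. The function $I_{\mathbf n}$ is continuous, convex and non-increasing (on $(\tau^{\min}(\mathbf n),+\infty)$), and $I_{\mathbf n}(\tau)=0$ for $\tau\ge\tau^q(\mathbf n)$ (with $\tau>\tau^{\min}(\mathbf n)$).
   Context: Fix $d\ge 2$, $q\ge 1$, $\beta\ge 0$. For $x,y\in\mathbb Z^d$ write $x\sim y$ if $\|x-y\|_2=1$; for $\Lambda\subset\mathbb Z^d$ let $E(\Lambda)=\{\{x,y\}:x,y\in\Lambda,\ x\sim y\}$. The couplings $J=(J_e)_{e\in E(\mathbb Z^d)}$ are i.i.d. with values in $[0,1]$ under the product measure $\mathbb P$. $J^{\min}=\inf\{\lambda\ge0:\mathbb P(J_e<\lambda)>0\}$. Random cluster model: for finite $E\subset E(\mathbb Z^d)$, boundary condition $\pi\in\{0,1\}^{E^c}$ and $\omega\in\{0,1\}^E$, $\Phi^{J,\pi,q}_{E,\beta}(\{\omega\})=\frac1Z\prod_{e\in E}p_e^{\omega_e}(1-p_e)^{1-\omega_e}\,q^{C^\pi_E(\omega)}$ with $p_e=1-e^{-\beta J_e}$, where $C^\pi_E(\omega)$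 is the number of clusters of the set of vertices touched by $E$ when connections use the open edges of $\omega$ in $E$ and of $\pi$ outside $E$, and $Z$ is the normalizing constant. The boundary condition $w$ (wired) is $\pi\equiv1$. Geometry: $S^{d-1}$ is the Euclidean unit sphere. For $\mathbf n\in S^{d-1}$, $\mathbb S_{\mathbf n}$ is the set of the $(d-1)$-dimensional unit cubes $\{\sum_{k=1}^{d-1}t_k\mathbf u_k: t_k\in[-\frac12,\frac12]\}$ with $(\mathbf u_1,\dots,\mathbf u_{d-1},\mathbf n)$ an orthonormal basis of $\mathbb R^d$. $\mathcal R_{x,L,H}(\mathcal S,\mathbf n)=x+L\mathcal S+[-H,H]\mathbf n$. For such $\mathcal R$, $\hat{\mathcal R}$ is the set of points of $\mathbb Z^d$ in the interior of $\mathcal R$; $\partial\hat{\mathcal R}=\{y\in\hat{\mathcal R}:\exists z\in\mathbb Z^d\setminus\hat{\mathcal R},\ z\sim y\}$; $\partial^+\hat{\mathcal R}=\{y\in\partial\hat{\mathcal R}:(y-x)\cdot\mathbf n\ge0\}$, $\partial^-\hat{\mathcal R}=\{y\in\partial\hat{\mathcal R}:(y-x)\cdot\mathbf n<0\}$. $\Phi^{J,w}_{\mathcal R}$ is $\Phi^{J,w,q}_{E(\hat{\mathcal R}),\beta}$. Surface tension: $\mathcal D_{\mathcal R}$ is the event that no $\omega$-open path in $E(\hat{\mathcal R})$ joins $\partial^+\hat{\mathcal R}$ to $\partial^-\hat{\mathcal R}$, and $\tau^J_{\mathcal R}=-\frac1{L^{d-1}}\log\Phi^{J,w}_{\mathcal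 R}(\mathcal D_{\mathcal R})$. The quenched surface tension $\tau^q(\mathbf n)=\tau^q_\beta(\mathbf n)$ is the limit in $\mathbb P$-probability of $\tau^J_{\mathcal R_{0,N,\delta N}(\mathcal S,\mathbf n)}$ as $N\to\infty$, which exists and does not depend on $\delta>0$ nor on $\mathcal S\in\mathbb S_{\mathbf n}$; $\tau^{\min}(\mathbf n)$ is the same limit for the constant couplings $J\equiv J^{\min}$. *)

theory Defs
  imports "HOL-Probability.Probability"
begin

section \<open>The lattice\<close>

definition lat :: "int ^ 'd \<Rightarrow> real ^ 'd" where
  "lat x = (\<chi> i. real_of_int (x $ i))"

definition adj :: "int ^ 'd \<Rightarrow> int ^ 'd \<Rightarrow> bool" where
  "adj x y \<longleftrightarrow> norm (lat x - lat y) = 1"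

definition edges :: "(int ^ 'd) set \<Rightarrow> (int ^ 'd) set set" where
  "edges \<Lambda> = {{x, y} | x y. x \<in> \<Lambda> \<and> y \<in> \<Lambda> \<and> adj x y}"


section \<open>The couplings\<close>

text \<open>The single-coupling law \<open>\<mu>\<close> is a probability measure on the unit interval
  (see the theorem), so that the couplings take values in \<open>[0,1]\<close> everywhere.\<close>

definition coupling_measure :: "real measure \<Rightarrow> ((int ^ 'd) set \<Rightarrow> real) measure" where
  "coupling_measure \<mu> = PiM (edges UNIV) (\<lambda>_. \<mu>)"

definition J_min :: "real measure \<Rightarrow> real" where
  "J_min \<mu> = Inf {l. 0 \<le> l \<and> measure \<mu> {x \<in> space \<mu>. x < l} > 0}"


section \<open>The random cluster model\<close>

text \<open>Elements of \<open>{0,1}\<^sup>E\<close> and of \<open>{0,1}\<close> to the complement of \<open>E\<close> are identified with their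
  sets of open edges: a configuration is \<open>\<omega> \<subseteq> E\<close>, a boundary condition is
  \<open>\<pi> \<subseteq> edges UNIV - E\<close>.\<close>

definition connected_by :: "(int ^ 'd) set set \<Rightarrow> ((int ^ 'd) \<times> (int ^ 'd)) set" where
  "connected_by F = {(x, y). {x, y} \<in> F}\<^sup>*"

text \<open>The vertices touched by \<open>E\<close> form the set \<open>\<Union>E\<close>; the connections between them may
  leave \<open>\<Union>E\<close> through edges of \<open>\<pi>\<close>.\<close>

definition num_clusters ::
    "(int ^ 'd) set set \<Rightarrow> (int ^ 'd) set set \<Rightarrow> (int ^ 'd) set set \<Rightarrow> nat" where
  "num_clusters E \<pi> \<omega> = card ((\<Union>E) // connected_by (\<omega> \<union> \<pi>))"

definition edge_prob :: "real \<Rightarrow> ((int ^ 'd) set \<Rightarrow> real) \<Rightarrow> (int ^ 'd) set \<Rightarrow> real" where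
  "edge_prob \<beta> J e = 1 - exp (- \<beta> * J e)"

definition rc_weight ::
    "real \<Rightarrow> real \<Rightarrow> ((int ^ 'd) set \<Rightarrow> real) \<Rightarrow> (int ^ 'd) set set \<Rightarrow> (int ^ 'd) set set
      \<Rightarrow> (int ^ 'd) set set \<Rightarrow> real" where
  "rc_weight q \<beta> J E \<pi> \<omega> =
     (\<Prod>e\<in>E. if e \<in> \<omega> then edge_prob \<beta> J e else 1 - edge_prob \<beta> J e)
       * q ^ num_clusters E \<pi> \<omega>"

definition rc_measure ::
    "real \<Rightarrow> real \<Rightarrow> ((int ^ 'd) set \<Rightarrow> real) \<Rightarrow> (int ^ 'd) set set \<Rightarrow> (int ^ 'd) set set
      \<Rightarrow> (int ^ 'd) set set measure" where
  "rc_measure q \<beta> J E \<pi> =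
     point_measure (Pow E)
       (\<lambda>\<omega>. ennreal (rc_weight q \<beta> J E \<pi> \<omega> / (\<Sum>\<omega>'\<in>Pow E. rc_weight q \<beta> J E \<pi> \<omega>')))"

definition wired :: "(int ^ 'd) set set \<Rightarrow> (int ^ 'd) set set" where
  "wired E = edges UNIV - E"


section \<open>Geometry\<close>

definition orthonormal_basis :: "(nat \<Rightarrow> real ^ 'd) \<Rightarrow> bool" where
  "orthonormal_basis v \<longleftrightarrow>
     (\<forall>i\<in>{1..CARD('d)}. \<forall>j\<in>{1..CARD('d)}. v i \<bullet> v j = (if i = j then 1 else 0))
       \<and> span (v ` {1..CARD('d)}) = UNIV"

text \<open>The last vector of the basis \<open>u\<close> is the normal \<open>n\<close>.\<close>

definition unit_cubes :: "real ^ 'd \<Rightarrow> (real ^ 'd) set set" where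
  "unit_cubes n =
     {{\<Sum>k\<in>{1..CARD('d) - 1}. t k *\<^sub>R u k | t. \<forall>k\<in>{1..CARD('d) - 1}. t k \<in> {- (1/2)..1/2}}
        | u. orthonormal_basis u \<and> u CARD('d) = n}"

definition box_R ::
    "real ^ 'd \<Rightarrow> real \<Rightarrow> real \<Rightarrow> (real ^ 'd) set \<Rightarrow> real ^ 'd \<Rightarrow> (real ^ 'd) set" where
  "box_R x L H S n = {x + L *\<^sub>R s + h *\<^sub>R n | s h. s \<in> S \<and> h \<in> {- H..H}}"

definition discretize :: "(real ^ 'd) set \<Rightarrow> (int ^ 'd) set" where
  "discretize R = {y. lat y \<in> interior R}"

definition inner_boundary :: "(int ^ 'd) set \<Rightarrow> (int ^ 'd) set" where
  "inner_boundary \<Lambda> = {y \<in> \<Lambda>. \<exists>z. z \<notin> \<Lambda> \<and> adj z y}"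

definition upper_boundary :: "real ^ 'd \<Rightarrow> real ^ 'd \<Rightarrow> (int ^ 'd) set \<Rightarrow> (int ^ 'd) set" where
  "upper_boundary x n \<Lambda> = {y \<in> inner_boundary \<Lambda>. (lat y - x) \<bullet> n \<ge> 0}"

definition lower_boundary :: "real ^ 'd \<Rightarrow> real ^ 'd \<Rightarrow> (int ^ 'd) set \<Rightarrow> (int ^ 'd) set" where
  "lower_boundary x n \<Lambda> = {y \<in> inner_boundary \<Lambda>. (lat y - x) \<bullet> n < 0}"


section \<open>Surface tension\<close>

definition disconnection ::
    "real ^ 'd \<Rightarrow> real ^ 'd \<Rightarrow> (int ^ 'd) set \<Rightarrow> (int ^ 'd) set set set" where
  "disconnection x n \<Lambda> =
     {\<omega>. \<omega> \<subseteq> edges \<Lambda> \<and>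
         \<not> (\<exists>a\<in>upper_boundary x n \<Lambda>. \<exists>b\<in>lower_boundary x n \<Lambda>. (a, b) \<in> connected_by \<omega>)}"

text \<open>For couplings in \<open>[0,1]\<close> the logarithm below has a positive argument, since the event
  contains the configuration without open edges, which has positive probability.\<close>

definition tau_J ::
    "real \<Rightarrow> real \<Rightarrow> ((int ^ 'd) set \<Rightarrow> real)
      \<Rightarrow> real ^ 'd \<Rightarrow> real \<Rightarrow> real \<Rightarrow> (real ^ 'd) set \<Rightarrow> real ^ 'd \<Rightarrow> real" where
  "tau_J q \<beta> J x L H S n =
     (let \<Lambda> = discretize (box_R x L H S n); E = edges \<Lambda>
      in - (1 / L ^ (CARD('d) - 1))
           * ln (measure (rc_measure q \<beta> J E (wired E)) (disconnection x n \<Lambda>)))"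

definition tends_in_prob ::
    "'a measure \<Rightarrow> (nat \<Rightarrow> 'a \<Rightarrow> real) \<Rightarrow> real \<Rightarrow> bool" where
  "tends_in_prob M X t \<longleftrightarrow>
     (\<forall>\<epsilon>>0. (\<lambda>N. measure M {\<omega> \<in> space M. \<bar>X N \<omega> - t\<bar> > \<epsilon>}) \<longlonglongrightarrow> 0)"

definition tau_quenched :: "real measure \<Rightarrow> real \<Rightarrow> real \<Rightarrow> real ^ 'd \<Rightarrow> real" where
  "tau_quenched \<mu> q \<beta> n =
     (THE t. \<forall>\<delta>>0. \<forall>S\<in>unit_cubes n.
        tends_in_prob (coupling_measure \<mu>)
          (\<lambda>N J. tau_J q \<beta> J 0 (real N) (\<delta> * real N) S n) t)"

definition tau_min :: "real measure \<Rightarrow> real \<Rightarrow> real \<Rightarrow> real ^ 'd \<Rightarrow> real" where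
  "tau_min \<mu> q \<beta> n =
     (THE t. \<forall>\<delta>>0. \<forall>S\<in>unit_cubes n.
        (\<lambda>N. tau_J q \<beta> (\<lambda>_. J_min \<mu>) 0 (real N) (\<delta> * real N) S n) \<longlonglongrightarrow> t)"

text \<open>The real logarithm has \<open>ln 0 = 0\<close>, so the convention \<open>- log 0 = \<infinity>\<close> has to be made explicit
  for probabilities that may vanish.\<close>

definition neg_log :: "real \<Rightarrow> ereal" where
  "neg_log p = (if p = 0 then \<infinity> else ereal (- ln p))"

definition lower_dev_rate ::
    "real measure \<Rightarrow> real \<Rightarrow> real \<Rightarrow> real ^ 'd \<Rightarrow> real \<Rightarrow> (real ^ 'd) set \<Rightarrow> real \<Rightarrow> nat \<Rightarrow> ereal" where
  "lower_dev_rate \<mu> q \<beta> n \<delta> S \<tau> N =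
     ereal (1 / real N ^ (CARD('d) - 1)) *
     neg_log (measure (coupling_measure \<mu>)
       {J \<in> space (coupling_measure \<mu>). tau_J q \<beta> J 0 (real N) (\<delta> * real N) S n \<le> \<tau>})"

end

theory Submission
  imports Defs "HOL-Real_Asymp.Real_Asymp"
begin

text \<open>Everything follows from one approximate subadditivity property of the surface tension, which
holds for every realisation of the couplings. Fix the normal \<open>n\<close>, and pack the middle hyperplane of
a large box of side \<open>N\<close> with disjoint translates, by lattice vectors \<open>z\<close>, of a box of fixed side
\<open>L\<close>. Then, up to an error that is arbitrarily small once \<open>L\<close> is large and \<open>N\<close> is large depending
on \<open>L\<close>, the surface tension of the large box is at most the average of the surface tensions of the
tiles. The shapes (height and orientation) of the box and of its tiles may differ: this is what
makes all limits independent of the shape.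

The subadditivity has a probabilistic and a geometric half. If each tile is disconnected and all
edges near the hyperplane that belong to no tile are closed, then the large box is disconnected
(\<open>disconnection_of_tiles\<close>). The wired measure of the large box gives to this decreasing event at
least the probability that it has when the tiles are independent and wired and the other edges are
independent with parameters \<open>p\<^sub>e\<close>; this is a Holley-type comparison, \<open>rc_prob_tiles\<close>, obtained from
the four functions inequality of Ahlswede and Daykin and from the fact that an added edge merges
fewer clusters when more edges are open. Closing an edge has probability at least \<open>exp (- \<beta>)\<close>, so
the error is proportional to the number of lattice edges near the part of the hyperplane that the
tiles leave uncovered. This number is bounded by comparing volumes (\<open>tiling\<close>), for which volumes
have to be invariant under rotations. The result is \<open>tau_tiling\<close>.

The surface tensions of disjoint tiles are independent and identically distributed. What remains is
a statement about abstract processes, the locale \<open>tiled_process\<close>. The means converge because they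
are approximately subadditive; by the law of large numbers the process exceeds the limit of the
means with vanishing probability, and since the means converge to the same limit it does not fall
below it either. This shows that the quenched surface tension exists. For lower deviations, asking
each tile to have a tension at most \<open>\<tau>\<close> shows that the rate at scale \<open>N\<close> and level slightly above
\<open>\<tau>\<close> is at most the rate at scale \<open>L\<close> and level \<open>\<tau>\<close>. Asking tension at most \<open>\<tau>1\<close> of a fraction
\<open>\<alpha>\<close> of the tiles and at most \<open>\<tau>2\<close> of the others shows convexity as well (\<open>dev_rate_tiles\<close>). The set
of asymptotic upper bounds for the rates is therefore the epigraph of a convex, non-increasing
function, which is continuous where it is finite, and continuity removes the loss in the levels
(\<open>rate_function\<close>). Finiteness above \<open>tau_min\<close> holds because, for a fixed box, all couplings are close
to their minimum with positive probability.\<close>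

section \<open>The four functions inequality\<close>

lemma sum_Pow_insert:
  fixes f :: "'a set \<Rightarrow> real"
  assumes "finite E" "e \<notin> E"
  shows "(\<Sum>A\<in>Pow (insert e E). f A) = (\<Sum>A\<in>Pow E. f A + f (insert e A))"
proof -
  have "inj_on (insert e) (Pow E)"
    using assms(2) by (intro inj_onI) (metis Diff_insert_absorb PowD subsetD)
  moreover have "Pow E \<inter> insert e ` Pow E = {}" using assms(2) by auto
  ultimately show ?thesis
    using assms(1) by (simp add: Pow_insert sum.union_disjoint sum.reindex sum.distrib)
qed

text \<open>The inequality on a two-point lattice. Writing \<open>x\<close>, \<open>y\<close> and \<open>z\<close> for \<open>a0 * b1\<close>, \<open>a1 * b0\<close> and
\<open>c1 * d0\<close>, both \<open>x\<close> and \<open>y\<close> are at most \<open>z\<close>, so that \<open>(z - x) * (z - y) \<ge> 0\<close>, while \<open>x * y\<close> is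
at most \<open>z * (c0 * d1)\<close>.\<close>

lemma four_functions_point:
  fixes a0 a1 b0 b1 c0 c1 d0 d1 :: real
  assumes nn: "0 \<le> a0" "0 \<le> a1" "0 \<le> b0" "0 \<le> b1" "0 \<le> c0" "0 \<le> c1" "0 \<le> d0" "0 \<le> d1"
    and h: "a0 * b0 \<le> c0 * d0" "a0 * b1 \<le> c1 * d0" "a1 * b0 \<le> c1 * d0" "a1 * b1 \<le> c1 * d1"
  shows "(a0 + a1) * (b0 + b1) \<le> (c0 + c1) * (d0 + d1)"
proof (cases "c1 * d0 = 0")
  case True
  then have "a0 * b1 = 0" "a1 * b0 = 0" using h nn by (metis antisym mult_nonneg_nonneg)+
  moreover have "0 \<le> c0 * d1" "0 \<le> c1 * d0" using nn by auto
  ultimately show ?thesis using h by (simp only: distrib_left distrib_right)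
next
  case False
  then have p: "c1 * d0 > 0" using nn by (simp add: less_le)
  define x y z where "x = a0 * b1" and "y = a1 * b0" and "z = c1 * d0"
  have "(z - x) * (z - y) \<ge> 0" using h by (simp add: x_def y_def z_def)
  moreover have "x * y = (a0 * b0) * (a1 * b1)" by (simp add: x_def y_def)
  moreover have "(a0 * b0) * (a1 * b1) \<le> (c0 * d0) * (c1 * d1)"
    by (intro mult_mono h) (use nn in auto)
  moreover have "(c0 * d0) * (c1 * d1) = z * (c0 * d1)" by (simp add: z_def)
  moreover have "(z - x) * (z - y) = z * z - z * (x + y) + x * y" by (simp add: algebra_simps)
  ultimately have "z * (x + y) \<le> z * z + z * (c0 * d1)" by linarith
  then have "z * (x + y) \<le> z * (z + c0 * d1)" by (simp only: distrib_left)
  moreover have "z > 0" using p by (simp add: z_def)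
  ultimately have "x + y \<le> z + c0 * d1" by simp
  then have "a0 * b1 + a1 * b0 \<le> c1 * d0 + c0 * d1" unfolding x_def y_def z_def .
  then show ?thesis using h(1,4) unfolding distrib_left distrib_right by linarith
qed

text \<open>The inequality of Ahlswede and Daykin on the lattice of subsets of a finite set. Summing out one
element turns the hypothesis for \<open>insert e E\<close> into the hypothesis for \<open>E\<close>, by the two-point case.\<close>

lemma four_functions:
  fixes \<alpha> \<beta> \<gamma> \<delta> :: "'a set \<Rightarrow> real"
  assumes "finite E"
    and "\<And>A. A \<subseteq> E \<Longrightarrow> 0 \<le> \<alpha> A" "\<And>A. A \<subseteq> E \<Longrightarrow> 0 \<le> \<beta> A"
    and "\<And>A. A \<subseteq> E \<Longrightarrow> 0 \<le> \<gamma> A" "\<And>A. A \<subseteq> E \<Longrightarrow> 0 \<le> \<delta> A"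
    and "\<And>A B. A \<subseteq> E \<Longrightarrow> B \<subseteq> E \<Longrightarrow> \<alpha> A * \<beta> B \<le> \<gamma> (A \<union> B) * \<delta> (A \<inter> B)"
  shows "sum \<alpha> (Pow E) * sum \<beta> (Pow E) \<le> sum \<gamma> (Pow E) * sum \<delta> (Pow E)"
  using assms
proof (induction E arbitrary: \<alpha> \<beta> \<gamma> \<delta> rule: finite_induct)
  case empty
  then show ?case by simp
next
  case (insert e E)
  let ?m = "\<lambda>f A. f A + f (insert e A) :: real"
  have "sum (?m \<alpha>) (Pow E) * sum (?m \<beta>) (Pow E) \<le> sum (?m \<gamma>) (Pow E) * sum (?m \<delta>) (Pow E)"
  proof (rule insert.IH)
    fix A B assume A: "A \<subseteq> E" and B: "B \<subseteq> E"
    have e: "e \<notin> A" "e \<notin> B" using A B insert.hyps by auto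
    have s: "A \<subseteq> insert e E" "B \<subseteq> insert e E" "insert e A \<subseteq> insert e E" "insert e B \<subseteq> insert e E"
      "A \<union> B \<subseteq> insert e E" "insert e (A \<union> B) \<subseteq> insert e E"
      "A \<inter> B \<subseteq> insert e E" "insert e (A \<inter> B) \<subseteq> insert e E"
      using A B by auto
    have "A \<inter> insert e B = A \<inter> B" "insert e A \<inter> B = A \<inter> B" using e by auto
    then show "?m \<alpha> A * ?m \<beta> B \<le> ?m \<gamma> (A \<union> B) * ?m \<delta> (A \<inter> B)"
      using s insert.prems(5)[OF s(1) s(2)] insert.prems(5)[OF s(1) s(4)]
        insert.prems(5)[OF s(3) s(2)] insert.prems(5)[OF s(3) s(4)]
      by (intro four_functions_point insert.prems(1-4)) auto
  qed (auto intro!: add_nonneg_nonneg insert.prems(1-4))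
  then show ?case using insert.hyps by (simp add: sum_Pow_insert)
qed

text \<open>A two-function version of supermodularity: the lattice condition follows by adding the elements
of \<open>A - B\<close> one at a time, to \<open>A \<inter> B\<close> under \<open>f\<close> and to \<open>B\<close> under \<open>g\<close>.\<close>

lemma increments_imp_lattice_condition:
  fixes f g :: "'a set \<Rightarrow> real"
  assumes "finite E"
    and inc: "\<And>A B e. A \<subseteq> B \<Longrightarrow> B \<subseteq> E \<Longrightarrow> e \<in> E - B \<Longrightarrow>
      f (insert e A) + g B \<le> f A + g (insert e B)"
    and "A \<subseteq> E" "B \<subseteq> E"
  shows "f A + g B \<le> f (A \<inter> B) + g (A \<union> B)"
proof -
  have "f ((A \<inter> B) \<union> C) + g B \<le> f (A \<inter> B) + g (B \<union> C)" if "finite C" "C \<subseteq> A - B" for C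
    using that
  proof (induction C rule: finite_induct)
    case empty
    then show ?case by simp
  next
    case (insert e C)
    have "f (insert e (A \<inter> B \<union> C)) + g (B \<union> C) \<le> f (A \<inter> B \<union> C) + g (insert e (B \<union> C))"
      by (rule inc) (use insert assms(3,4) in auto)
    then show ?case using insert by simp
  qed
  moreover have "finite (A - B)" using assms(1,3) finite_subset by blast
  ultimately have "f ((A \<inter> B) \<union> (A - B)) + g B \<le> f (A \<inter> B) + g (B \<union> (A - B))"
    by blast
  moreover have "(A \<inter> B) \<union> (A - B) = A" "B \<union> (A - B) = A \<union> B" by auto
  ultimately show ?thesis by simp
qed

section \<open>Clusters and added edges\<close>

lemma equiv_connected_by: "equiv UNIV (connected_by F)"
proof -
  have "sym {(x, y). {x, y} \<in> F}" by (auto simp: sym_def insert_commute)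
  then show ?thesis
    unfolding connected_by_def by (intro equivI refl_rtrancl sym_rtrancl trans_rtrancl) simp
qed

lemma connected_by_mono: "F \<subseteq> G \<Longrightarrow> connected_by F \<subseteq> connected_by G"
  unfolding connected_by_def by (rule rtrancl_mono) auto

lemma connected_by_sym: "(x, y) \<in> connected_by F \<Longrightarrow> (y, x) \<in> connected_by F"
  using equiv_connected_by[of F] unfolding equiv_def sym_def by blast

lemma connected_by_trans:
  "(x, y) \<in> connected_by F \<Longrightarrow> (y, z) \<in> connected_by F \<Longrightarrow> (x, z) \<in> connected_by F"
  unfolding connected_by_def by (rule rtrancl_trans)

lemma connected_by_insert:
  "(a, b) \<in> connected_by (insert {x, y} F) \<longleftrightarrow>
    (a, b) \<in> connected_by F \<or>
    (a, x) \<in> connected_by F \<and> (y, b) \<in> connected_by F \<or>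
    (a, y) \<in> connected_by F \<and> (x, b) \<in> connected_by F"
  (is "?l \<longleftrightarrow> ?r")
proof
  have refl: "(c, c) \<in> connected_by F" for c unfolding connected_by_def by simp
  assume ?l
  then show ?r
    unfolding connected_by_def[of "insert _ _"]
  proof (induction rule: rtrancl_induct)
    case base
    then show ?case using refl by auto
  next
    case (step b c)
    then consider "{b, c} \<in> F" | "b = x" "c = y" | "b = y" "c = x" by (auto simp: doubleton_eq_iff)
    then show ?case
    proof cases
      case 1
      then have "(b, c) \<in> connected_by F" unfolding connected_by_def by auto
      then show ?thesis using step.IH connected_by_trans[of _ b F c] by blast
    next
      case 2
      then show ?thesis using step.IH refl[of y] unfolding 2 by blast
    next
      case 3
      then show ?thesis using step.IH refl[of x] unfolding 3 by blast
    qed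
  qed
next
  let ?G = "connected_by (insert {x, y} F)"
  have m: "connected_by F \<subseteq> ?G" by (rule connected_by_mono) auto
  have xy: "(x, y) \<in> ?G" "(y, x) \<in> ?G" unfolding connected_by_def by (auto simp: insert_commute)
  assume ?r
  then consider "(a, b) \<in> ?G" | "(a, x) \<in> ?G" "(y, b) \<in> ?G" | "(a, y) \<in> ?G" "(x, b) \<in> ?G"
    using m by blast
  then show ?l
  proof cases
    case 2
    then show ?thesis
      using connected_by_trans[OF connected_by_trans[OF 2(1) xy(1)] 2(2)] by simp
  next
    case 3
    then show ?thesis
      using connected_by_trans[OF connected_by_trans[OF 3(1) xy(2)] 3(2)] by simp
  qed
qed

lemma connected_by_class_eq:
  "connected_by F `` {a} = connected_by F `` {b} \<longleftrightarrow> (a, b) \<in> connected_by F"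
  using eq_equiv_class_iff[OF equiv_connected_by] by auto

text \<open>An edge whose endpoints are not yet connected merges exactly the two classes of its endpoints; any
other edge changes nothing.\<close>

lemma card_quotient_insert_edge:
  assumes "finite V" "x \<in> V" "y \<in> V"
  shows "card (V // connected_by F) =
    card (V // connected_by (insert {x, y} F)) + (if (x, y) \<in> connected_by F then 0 else 1)"
proof -
  let ?r = "connected_by F" and ?s = "connected_by (insert {x, y} F)"
  define X Y where "X = ?r `` {x}" and "Y = ?r `` {y}"
  have rr: "(a, a) \<in> ?r" for a unfolding connected_by_def by simp
  have in_X: "a \<in> X \<longleftrightarrow> (x, a) \<in> ?r" and in_Y: "a \<in> Y \<longleftrightarrow> (y, a) \<in> ?r" for a
    by (auto simp: X_def Y_def)
  have cX: "?r `` {a} = X" if "a \<in> X" for a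
    using that connected_by_class_eq[of F x a] by (simp add: X_def)
  have cY: "?r `` {a} = Y" if "a \<in> Y" for a
    using that connected_by_class_eq[of F y a] by (simp add: Y_def)
  have sym: "(a, x) \<in> ?r \<longleftrightarrow> a \<in> X" "(a, y) \<in> ?r \<longleftrightarrow> a \<in> Y" for a
    unfolding in_X in_Y by (blast intro: connected_by_sym)+
  have s_class: "?s `` {a} = ?r `` {a} \<union> (if a \<in> X then Y else {}) \<union> (if a \<in> Y then X else {})" for a
    by (rule set_eqI) (simp add: connected_by_insert sym in_X[symmetric] in_Y[symmetric])
  show ?thesis
  proof (cases "(x, y) \<in> ?r")
    case True
    then have "X = Y" using connected_by_class_eq[of F x y] by (simp add: X_def Y_def)
    then have "?s `` {a} = ?r `` {a}" for a using s_class[of a] cX[of a] by auto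
    then have "V // ?s = V // ?r" by (simp add: quotient_def)
    then show ?thesis using True by simp
  next
    case False
    then have XY: "X \<noteq> Y" using connected_by_class_eq[of F x y] by (simp add: X_def Y_def)
    have disj: "X \<inter> Y = {}" using cX cY XY by blast
    let ?D = "V // ?r - {X, Y}"
    have X: "X \<in> V // ?r" and Y: "Y \<in> V // ?r"
      using assms by (auto simp: X_def Y_def intro: quotientI)
    have fin: "finite (V // ?r)" using assms(1) by (simp add: quotient_def)
    have new: "X \<union> Y \<notin> ?D"
    proof
      assume "X \<union> Y \<in> ?D"
      then obtain a where a: "X \<union> Y = ?r `` {a}" by (auto simp: quotient_def)
      have "x \<in> ?r `` {a}" "y \<in> ?r `` {a}" using rr a in_X in_Y by blast+
      then have "(x, a) \<in> ?r" "(a, y) \<in> ?r" by (auto intro: connected_by_sym)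
      then show False using False connected_by_trans by blast
    qed
    have merged: "?s `` {a} = (if a \<in> X \<union> Y then X \<union> Y else ?r `` {a})" for a
      using s_class[of a] cX[of a] cY[of a] disj by auto
    have "V // ?s = insert (X \<union> Y) ?D"
    proof (intro equalityI subsetI)
      fix Z assume "Z \<in> V // ?s"
      then obtain a where a: "a \<in> V" "Z = ?s `` {a}" by (auto simp: quotient_def)
      show "Z \<in> insert (X \<union> Y) ?D"
      proof (cases "a \<in> X \<union> Y")
        case True
        then show ?thesis using a merged by simp
      next
        case ns: False
        then have "?r `` {a} \<noteq> X" "?r `` {a} \<noteq> Y" using rr by auto
        then show ?thesis using a merged[of a] ns by (auto intro: quotientI)
      qed
    next
      fix Z assume "Z \<in> insert (X \<union> Y) ?D"
      then consider "Z = X \<union> Y" | "Z \<in> ?D" by blast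
      then show "Z \<in> V // ?s"
      proof cases
        case 1
        then have "Z = ?s `` {x}" using merged[of x] rr[of x] in_X[of x] by simp
        then show ?thesis using assms(2) by (simp add: quotientI)
      next
        case 2
        then obtain a where a: "a \<in> V" "Z = ?r `` {a}" by (auto simp: quotient_def)
        then have "a \<notin> X \<union> Y" using 2 cX[of a] cY[of a] by auto
        then have "Z = ?s `` {a}" using a merged[of a] by simp
        then show ?thesis using a by (simp add: quotientI)
      qed
    qed
    then have "card (V // ?s) = Suc (card ?D)" using new fin by simp
    moreover have "card (V // ?r) = card ?D + 2"
    proof -
      have "V // ?r = insert X (insert Y ?D)" using X Y by auto
      then have "card (V // ?r) = card (insert X (insert Y ?D))" by simp
      also have "\<dots> = card ?D + 2" using XY fin by simp
      finally show ?thesis .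
    qed
    ultimately show ?thesis using False by simp
  qed
qed

section \<open>Comparison of the wired measure with independent tiles\<close>

definition bern :: "real \<Rightarrow> ((int ^ 'd) set \<Rightarrow> real) \<Rightarrow> (int ^ 'd) set set \<Rightarrow> (int ^ 'd) set set \<Rightarrow> real" where
  "bern \<beta> J E \<omega> = (\<Prod>e\<in>E. if e \<in> \<omega> then edge_prob \<beta> J e else 1 - edge_prob \<beta> J e)"

lemma rc_weight_bern: "rc_weight q \<beta> J E \<pi> \<omega> = bern \<beta> J E \<omega> * q ^ num_clusters E \<pi> \<omega>"
  by (simp add: rc_weight_def bern_def)

lemma bern_nonneg:
  assumes "\<beta> \<ge> 0" "\<And>e. e \<in> E \<Longrightarrow> J e \<ge> 0"
  shows "bern \<beta> J E \<omega> \<ge> 0"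
  unfolding bern_def edge_prob_def using assms by (intro prod_nonneg) auto

lemma bern_Un_Int: "bern \<beta> J E (A \<union> B) * bern \<beta> J E (A \<inter> B) = bern \<beta> J E A * bern \<beta> J E B"
  unfolding bern_def prod.distrib[symmetric] by (intro prod.cong) auto

lemma bern_Int: "bern \<beta> J E (\<omega> \<inter> E) = bern \<beta> J E \<omega>"
  unfolding bern_def by (intro prod.cong) auto

text \<open>The probability that the edges of \<open>F\<close> are closed under independent percolation.\<close>

lemma sum_bern_closed:
  fixes E :: "(int ^ 'd) set set"
  assumes "finite E" "F \<subseteq> E"
  shows "(\<Sum>\<omega>\<in>Pow E. if \<omega> \<inter> F = {} then bern \<beta> J E \<omega> else 0) = (\<Prod>e\<in>F. 1 - edge_prob \<beta> J e)"
proof -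
  let ?p = "\<lambda>e. if e \<in> F then 0 else edge_prob \<beta> J e"
  let ?c = "\<lambda>e. 1 - edge_prob \<beta> J e"
  have "(if \<omega> \<inter> F = {} then bern \<beta> J E \<omega> else 0) = (\<Prod>e\<in>\<omega>. ?p e) * (\<Prod>e\<in>E - \<omega>. ?c e)"
    if "\<omega> \<in> Pow E" for \<omega>
  proof (cases "\<omega> \<inter> F = {}")
    case True
    have "bern \<beta> J E \<omega> = (\<Prod>e\<in>\<omega> \<union> (E - \<omega>). if e \<in> \<omega> then edge_prob \<beta> J e else ?c e)"
      unfolding bern_def using that by (intro prod.cong) auto
    also have "\<dots> = (\<Prod>e\<in>\<omega>. if e \<in> \<omega> then edge_prob \<beta> J e else ?c e) *
        (\<Prod>e\<in>E - \<omega>. if e \<in> \<omega> then edge_prob \<beta> J e else ?c e)"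
      by (rule prod.union_disjoint) (use that assms finite_subset in auto)
    also have "\<dots> = (\<Prod>e\<in>\<omega>. ?p e) * (\<Prod>e\<in>E - \<omega>. ?c e)"
      using True by (intro arg_cong2[where f = "(*)"] prod.cong) auto
    finally show ?thesis using True by simp
  next
    case False
    then have "(\<Prod>e\<in>\<omega>. ?p e) = 0"
      using that assms finite_subset by (intro prod_zero) auto
    then show ?thesis using False by simp
  qed
  then have "(\<Sum>\<omega>\<in>Pow E. if \<omega> \<inter> F = {} then bern \<beta> J E \<omega> else 0) =
      (\<Sum>\<omega>\<in>Pow E. (\<Prod>e\<in>\<omega>. ?p e) * (\<Prod>e\<in>E - \<omega>. ?c e))"
    by (intro sum.cong) auto
  also have "\<dots> = (\<Prod>e\<in>E. ?p e + ?c e)" using assms(1) by (rule prod_add[symmetric])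
  also have "\<dots> = (\<Prod>e\<in>E. if e \<in> F then ?c e else 1)" by (intro prod.cong) auto
  also have "\<dots> = (\<Prod>e\<in>F. ?c e)"
    using assms by (simp add: prod.If_cases Int_absorb1)
  finally show ?thesis .
qed

lemma sum_Pow_Un_product:
  fixes f g :: "'a set \<Rightarrow> real"
  assumes "A \<inter> B = {}"
  shows "(\<Sum>\<omega>\<in>Pow (A \<union> B). f (\<omega> \<inter> A) * g (\<omega> \<inter> B)) = sum f (Pow A) * sum g (Pow B)"
proof -
  have "(\<Sum>\<omega>\<in>Pow (A \<union> B). f (\<omega> \<inter> A) * g (\<omega> \<inter> B)) = (\<Sum>(x, y)\<in>Pow A \<times> Pow B. f x * g y)"
    by (rule sum.reindex_bij_witness[where i = "\<lambda>(x, y). x \<union> y" and j = "\<lambda>\<omega>. (\<omega> \<inter> A, \<omega> \<inter> B)"])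
      (use assms in \<open>fastforce+\<close>)
  then show ?thesis by (simp add: sum_product sum.cartesian_product)
qed

text \<open>Sums over configurations of products of functions of disjoint blocks factorize; \<open>G\<close> is the block
of the edges outside the tiles.\<close>

lemma sum_Pow_UN_product:
  fixes f :: "'i \<Rightarrow> 'a set \<Rightarrow> real" and h :: "'a set \<Rightarrow> real"
  assumes "finite I" "disjoint_family_on Es I" "G \<inter> (\<Union>i\<in>I. Es i) = {}"
  shows "(\<Sum>\<omega>\<in>Pow (G \<union> (\<Union>i\<in>I. Es i)). (\<Prod>i\<in>I. f i (\<omega> \<inter> Es i)) * h (\<omega> \<inter> G)) =
    (\<Prod>i\<in>I. sum (f i) (Pow (Es i))) * sum h (Pow G)"
  using assms
proof (induction I rule: finite_induct)
  case empty
  have "(\<Sum>\<omega>\<in>Pow G. h (\<omega> \<inter> G)) = sum h (Pow G)" by (intro sum.cong) (auto simp: Int_absorb2)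
  then show ?case by simp
next
  case (insert i I)
  let ?U = "G \<union> (\<Union>j\<in>I. Es j)"
  have d: "Es i \<inter> Es j = {}" if "j \<in> I" for j
    using insert.prems(1) insert.hyps that unfolding disjoint_family_on_def by fastforce
  have disj: "Es i \<inter> ?U = {}" using d insert.prems(2) by auto
  have IH: "(\<Sum>\<omega>\<in>Pow ?U. (\<Prod>i\<in>I. f i (\<omega> \<inter> Es i)) * h (\<omega> \<inter> G)) =
    (\<Prod>i\<in>I. sum (f i) (Pow (Es i))) * sum h (Pow G)"
    using insert.prems by (intro insert.IH) (auto simp: disjoint_family_on_def)
  have eq: "G \<union> (\<Union>j\<in>insert i I. Es j) = Es i \<union> ?U" by auto
  have "(\<Prod>j\<in>insert i I. f j (\<omega> \<inter> Es j)) * h (\<omega> \<inter> G) =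
      f i (\<omega> \<inter> Es i) * ((\<Prod>j\<in>I. f j ((\<omega> \<inter> ?U) \<inter> Es j)) * h ((\<omega> \<inter> ?U) \<inter> G))" for \<omega>
  proof -
    have "(\<omega> \<inter> ?U) \<inter> Es j = \<omega> \<inter> Es j" if "j \<in> I" for j using that by auto
    then have "(\<Prod>j\<in>I. f j ((\<omega> \<inter> ?U) \<inter> Es j)) = (\<Prod>j\<in>I. f j (\<omega> \<inter> Es j))"
      by (intro prod.cong) auto
    moreover have "(\<omega> \<inter> ?U) \<inter> G = \<omega> \<inter> G" by auto
    ultimately show ?thesis using insert.hyps by (simp add: mult.assoc)
  qed
  then have "(\<Sum>\<omega>\<in>Pow (G \<union> (\<Union>j\<in>insert i I. Es j)). (\<Prod>j\<in>insert i I. f j (\<omega> \<inter> Es j)) * h (\<omega> \<inter> G)) =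
     (\<Sum>\<omega>\<in>Pow (Es i \<union> ?U). f i (\<omega> \<inter> Es i) * (\<lambda>\<omega>. (\<Prod>j\<in>I. f j (\<omega> \<inter> Es j)) * h (\<omega> \<inter> G)) (\<omega> \<inter> ?U))"
    unfolding eq by simp
  also have "\<dots> = sum (f i) (Pow (Es i)) * (\<Sum>\<omega>\<in>Pow ?U. (\<Prod>j\<in>I. f j (\<omega> \<inter> Es j)) * h (\<omega> \<inter> G))"
    using disj by (rule sum_Pow_Un_product)
  finally show ?case using IH insert.hyps by (simp add: mult.assoc)
qed

text \<open>The wired random cluster probability as a quotient of finite sums, from which measurability
and continuity in the couplings can be read off.\<close>

definition rc_prob :: "real \<Rightarrow> real \<Rightarrow> ((int ^ 'd) set \<Rightarrow> real) \<Rightarrow> (int ^ 'd) set set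
    \<Rightarrow> (int ^ 'd) set set set \<Rightarrow> real" where
  "rc_prob q \<beta> J E D =
    (\<Sum>\<omega>\<in>D. rc_weight q \<beta> J E (wired E) \<omega>) / (\<Sum>\<omega>\<in>Pow E. rc_weight q \<beta> J E (wired E) \<omega>)"

lemma rc_weight_nonneg:
  assumes "\<beta> \<ge> 0" "q \<ge> 1" "\<And>e. e \<in> E \<Longrightarrow> J e \<ge> 0"
  shows "rc_weight q \<beta> J E \<pi> \<omega> \<ge> 0"
  unfolding rc_weight_bern using bern_nonneg[of \<beta> E J] assms by simp

lemma rc_weight_empty_pos:
  assumes "q \<ge> 1"
  shows "rc_weight q \<beta> J E \<pi> {} > 0"
  unfolding rc_weight_bern bern_def edge_prob_def using assms by (intro mult_pos_pos prod_pos) auto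

lemma sum_rc_weight_pos:
  assumes "finite E" "\<beta> \<ge> 0" "q \<ge> 1" "\<And>e. e \<in> E \<Longrightarrow> J e \<ge> 0" "D \<subseteq> Pow E" "{} \<in> D"
  shows "(\<Sum>\<omega>\<in>D. rc_weight q \<beta> J E \<pi> \<omega>) > 0"
proof (rule sum_pos2[of _ "{}"])
  show "finite D" using assms finite_subset by blast
qed (use assms in \<open>auto intro!: rc_weight_nonneg rc_weight_empty_pos\<close>)

lemma measure_rc_measure:
  assumes "finite E" "\<beta> \<ge> 0" "q \<ge> 1" "\<And>e. e \<in> E \<Longrightarrow> J e \<ge> 0" "D \<subseteq> Pow E"
  shows "measure (rc_measure q \<beta> J E (wired E)) D = rc_prob q \<beta> J E D"
proof -
  let ?w = "rc_weight q \<beta> J E (wired E)"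
  have nn: "?w \<omega> / sum ?w (Pow E) \<ge> 0" for \<omega>
    using assms by (intro divide_nonneg_nonneg sum_nonneg rc_weight_nonneg) auto
  have fin: "finite D" using assms finite_subset by blast
  have "measure (rc_measure q \<beta> J E (wired E)) D = enn2real (\<Sum>\<omega>\<in>D. ennreal (?w \<omega> / sum ?w (Pow E)))"
    unfolding rc_measure_def Sigma_Algebra.measure_def
    using assms by (simp add: emeasure_point_measure_finite)
  also have "\<dots> = (\<Sum>\<omega>\<in>D. ?w \<omega> / sum ?w (Pow E))"
    using nn by (simp add: sum_ennreal sum_nonneg)
  finally show ?thesis by (simp add: rc_prob_def sum_divide_distrib)
qed

lemma rc_prob_pos:
  assumes "finite E" "\<beta> \<ge> 0" "q \<ge> 1" "\<And>e. e \<in> E \<Longrightarrow> J e \<ge> 0" "D \<subseteq> Pow E" "{} \<in> D"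
  shows "rc_prob q \<beta> J E D > 0"
  unfolding rc_prob_def using assms by (intro divide_pos_pos sum_rc_weight_pos) auto

lemma rc_prob_le_1:
  assumes "finite E" "\<beta> \<ge> 0" "q \<ge> 1" "\<And>e. e \<in> E \<Longrightarrow> J e \<ge> 0" "D \<subseteq> Pow E"
  shows "rc_prob q \<beta> J E D \<le> 1"
  unfolding rc_prob_def
proof (rule divide_le_eq_1_pos[THEN iffD2])
  show "0 < sum (rc_weight q \<beta> J E (wired E)) (Pow E)" using assms by (intro sum_rc_weight_pos) auto
  show "sum (rc_weight q \<beta> J E (wired E)) D \<le> sum (rc_weight q \<beta> J E (wired E)) (Pow E)"
    using assms by (intro sum_mono2 rc_weight_nonneg) auto
qed

text \<open>The combinatorial core of the comparison. The configuration \<open>A \<union> wired E\<close>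
is contained in \<open>(B \<inter> Es i) \<union> wired (Es i)\<close> for every \<open>B \<supseteq> A\<close>. Hence an edge of \<open>Es i\<close> that merges two
clusters for the wired tile also merges two clusters for the wired box, and edges outside the
tiles do not change the right-hand counts at all.\<close>

lemma wired_clusters_ordered:
  fixes E :: "(int ^ 'd) set set"
  assumes E: "finite E" "E \<subseteq> edges UNIV" "finite (\<Union>E)"
    and I: "finite I" "disjoint_family_on Es I" "\<And>i. i \<in> I \<Longrightarrow> Es i \<subseteq> E"
    and AB: "A \<subseteq> E" "B \<subseteq> E"
  shows "num_clusters E (wired E) A + (\<Sum>i\<in>I. num_clusters (Es i) (wired (Es i)) (B \<inter> Es i))
    \<le> num_clusters E (wired E) (A \<inter> B) + (\<Sum>i\<in>I. num_clusters (Es i) (wired (Es i)) ((A \<union> B) \<inter> Es i))"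
proof -
  let ?f = "\<lambda>A. real (num_clusters E (wired E) A)"
  let ?k = "\<lambda>i B. num_clusters (Es i) (wired (Es i)) (B \<inter> Es i)"
  let ?g = "\<lambda>B. real (\<Sum>i\<in>I. ?k i B)"
  have insert_cl: "num_clusters E' \<pi> \<omega> =
    num_clusters E' \<pi> (insert {x, y} \<omega>) + (if (x, y) \<in> connected_by (\<omega> \<union> \<pi>) then 0 else 1)"
    if "E' \<subseteq> E" "{x, y} \<in> E'" for E' \<pi> \<omega> x y
  proof -
    have "finite (\<Union>E')" using E(3) that(1) by (meson Union_mono finite_subset)
    then show ?thesis
      unfolding num_clusters_def Un_insert_left
      by (rule card_quotient_insert_edge) (use that in auto)
  qed
  have "?f A + ?g B \<le> ?f (A \<inter> B) + ?g (A \<union> B)"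
  proof (rule increments_imp_lattice_condition[OF E(1) _ AB])
    fix A B e assume AB: "A \<subseteq> B" "B \<subseteq> E" and e: "e \<in> E - B"
    obtain x y where xy: "e = {x, y}" using e E(2) by (auto simp: edges_def)
    let ?ind = "\<lambda>S. if (x, y) \<in> connected_by S then 0 else 1 :: nat"
    have f: "num_clusters E (wired E) A = num_clusters E (wired E) (insert e A) + ?ind (A \<union> wired E)"
      using insert_cl[of E x y "wired E" A] e xy by simp
    have g: "(\<Sum>i\<in>I. ?k i B) \<le> (\<Sum>i\<in>I. ?k i (insert e B)) + ?ind (A \<union> wired E)"
    proof (cases "\<exists>i\<in>I. e \<in> Es i")
      case True
      then obtain i where i: "i \<in> I" "e \<in> Es i" by blast
      have "?k j (insert e B) = ?k j B" if "j \<in> I - {i}" for j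
      proof -
        have "e \<notin> Es j" using i that I(2) unfolding disjoint_family_on_def by blast
        then show ?thesis by simp
      qed
      then have rest: "(\<Sum>j\<in>I - {i}. ?k j (insert e B)) = (\<Sum>j\<in>I - {i}. ?k j B)" by simp
      have "?k i B = num_clusters (Es i) (wired (Es i)) (insert e (B \<inter> Es i)) + ?ind ((B \<inter> Es i) \<union> wired (Es i))"
        using insert_cl[OF I(3)[OF i(1)], of x y "wired (Es i)" "B \<inter> Es i"] i xy by simp
      moreover have "insert e (B \<inter> Es i) = insert e B \<inter> Es i" using i by auto
      moreover have "A \<union> wired E \<subseteq> (B \<inter> Es i) \<union> wired (Es i)"
        using AB I(3)[OF i(1)] E(2) unfolding wired_def by auto
      then have "?ind ((B \<inter> Es i) \<union> wired (Es i)) \<le> ?ind (A \<union> wired E)"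
        using connected_by_mono[of "A \<union> wired E" "(B \<inter> Es i) \<union> wired (Es i)"] by auto
      ultimately have "?k i B \<le> ?k i (insert e B) + ?ind (A \<union> wired E)" by simp
      then show ?thesis
        using rest sum.remove[OF I(1) i(1), of "\<lambda>j. ?k j B"]
          sum.remove[OF I(1) i(1), of "\<lambda>j. ?k j (insert e B)"] by simp
    next
      case False
      then have "(\<Sum>i\<in>I. ?k i (insert e B)) = (\<Sum>i\<in>I. ?k i B)" by (intro sum.cong) auto
      then show ?thesis by simp
    qed
    show "?f (insert e A) + ?g B \<le> ?f A + ?g (insert e B)" using f g by linarith
  qed
  then show ?thesis by linarith
qed

text \<open>The reference measure \<open>\<nu>\<close> makes the tiles independent and wired, and the remaining edges independent
with parameters \<open>p\<^sub>e\<close>. Since \<open>q \<ge> 1\<close>, the order between cluster increments gives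
\<open>W A * \<nu> B \<le> \<nu> (A \<union> B) * W (A \<inter> B)\<close>, so by the four functions inequality \<open>\<nu>\<close> stochastically dominates the
wired measure \<open>W\<close> of the large box, and \<open>W\<close> gives more mass to the decreasing event \<open>D\<close>.\<close>

lemma rc_prob_tiles:
  fixes E :: "(int ^ 'd) set set"
  assumes \<beta>: "\<beta> \<ge> 0" and q: "q \<ge> 1" and J: "\<And>e. e \<in> E \<Longrightarrow> J e \<ge> 0"
    and E: "finite E" "E \<subseteq> edges UNIV" "finite (\<Union>E)"
    and I: "finite I" "disjoint_family_on Es I" "\<And>i. i \<in> I \<Longrightarrow> Es i \<subseteq> E"
    and F: "F \<subseteq> E - (\<Union>i\<in>I. Es i)"
    and Ds: "\<And>i. i \<in> I \<Longrightarrow> Ds i \<subseteq> Pow (Es i)"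
    and D: "D \<subseteq> Pow E" "\<And>\<omega> \<omega>'. \<omega> \<in> D \<Longrightarrow> \<omega>' \<subseteq> \<omega> \<Longrightarrow> \<omega>' \<in> D"
    and sub: "\<And>\<omega>. \<omega> \<subseteq> E \<Longrightarrow> \<omega> \<inter> F = {} \<Longrightarrow> (\<And>i. i \<in> I \<Longrightarrow> \<omega> \<inter> Es i \<in> Ds i) \<Longrightarrow> \<omega> \<in> D"
  shows "(\<Prod>i\<in>I. rc_prob q \<beta> J (Es i) (Ds i)) * (\<Prod>e\<in>F. 1 - edge_prob \<beta> J e) \<le> rc_prob q \<beta> J E D"
proof -
  define w where "w = (\<lambda>i. rc_weight q \<beta> J (Es i) (wired (Es i)))"
  define W where "W = rc_weight q \<beta> J E (wired E)"
  define G where "G = E - (\<Union>i\<in>I. Es i)"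
  define k where "k = (\<lambda>i \<omega>. num_clusters (Es i) (wired (Es i)) (\<omega> \<inter> Es i))"
  define \<nu> where "\<nu> = (\<lambda>\<omega>. (\<Prod>i\<in>I. w i (\<omega> \<inter> Es i)) * bern \<beta> J G (\<omega> \<inter> G))"
  have E_eq: "E = G \<union> (\<Union>i\<in>I. Es i)" using I(3) by (auto simp: G_def)
  have G: "finite G" "G \<inter> (\<Union>i\<in>I. Es i) = {}" using E(1) by (auto simp: G_def)
  have finEs: "finite (Es i)" if "i \<in> I" for i using I(3)[OF that] E(1) finite_subset by blast
  have w_nn: "w i \<omega> \<ge> 0" if "i \<in> I" for i \<omega>
    unfolding w_def using \<beta> q J I(3)[OF that] by (intro rc_weight_nonneg) auto
  have W_nn: "W \<omega> \<ge> 0" for \<omega> unfolding W_def using \<beta> q J by (intro rc_weight_nonneg) auto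
  have bG: "bern \<beta> J G \<omega> \<ge> 0" for \<omega> using \<beta> J by (intro bern_nonneg) (auto simp: G_def)
  have \<nu>_nn: "\<nu> \<omega> \<ge> 0" for \<omega> unfolding \<nu>_def using w_nn bG by (intro mult_nonneg_nonneg prod_nonneg) auto
  have \<nu>_eq: "\<nu> \<omega> = bern \<beta> J E \<omega> * q ^ (\<Sum>i\<in>I. k i \<omega>)" for \<omega>
  proof -
    have "bern \<beta> J E \<omega> = bern \<beta> J G \<omega> * (\<Prod>i\<in>I. bern \<beta> J (Es i) \<omega>)"
    proof -
      have fU: "finite (\<Union>i\<in>I. Es i)" using I(1) finEs by auto
      have "bern \<beta> J E \<omega> = bern \<beta> J G \<omega> * bern \<beta> J (\<Union>i\<in>I. Es i) \<omega>"
        unfolding bern_def by (subst E_eq, rule prod.union_disjoint[OF G(1) fU G(2)])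
      also have "bern \<beta> J (\<Union>i\<in>I. Es i) \<omega> = (\<Prod>i\<in>I. bern \<beta> J (Es i) \<omega>)"
        unfolding bern_def
        by (rule prod.UNION_disjoint) (use I finEs in \<open>auto simp: disjoint_family_on_def\<close>)
      finally show ?thesis .
    qed
    moreover have "\<nu> \<omega> = (\<Prod>i\<in>I. bern \<beta> J (Es i) \<omega> * q ^ k i \<omega>) * bern \<beta> J G \<omega>"
      by (simp add: \<nu>_def w_def rc_weight_bern bern_Int k_def)
    ultimately show ?thesis by (simp add: prod.distrib power_sum)
  qed
  have lattice: "W A * \<nu> B \<le> \<nu> (A \<union> B) * W (A \<inter> B)" if "A \<subseteq> E" "B \<subseteq> E" for A B
  proof -
    let ?c = "num_clusters E (wired E)"
    have "W A * \<nu> B = (bern \<beta> J E A * bern \<beta> J E B) * q ^ (?c A + (\<Sum>i\<in>I. k i B))"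
      by (simp add: W_def rc_weight_bern \<nu>_eq power_add)
    also have "\<dots> \<le> (bern \<beta> J E A * bern \<beta> J E B) * q ^ (?c (A \<inter> B) + (\<Sum>i\<in>I. k i (A \<union> B)))"
      using wired_clusters_ordered[OF E I that] q bern_nonneg[of \<beta> E J] \<beta> J unfolding k_def
      by (intro mult_left_mono power_increasing) auto
    also have "\<dots> = (bern \<beta> J E (A \<union> B) * bern \<beta> J E (A \<inter> B)) *
        q ^ (?c (A \<inter> B) + (\<Sum>i\<in>I. k i (A \<union> B)))"
      by (simp only: bern_Un_Int)
    also have "\<dots> = \<nu> (A \<union> B) * W (A \<inter> B)"
      by (simp add: W_def rc_weight_bern \<nu>_eq power_add)
    finally show ?thesis .
  qed
  let ?\<nu>D = "\<lambda>\<omega>. if \<omega> \<in> D then \<nu> \<omega> else 0" and ?WD = "\<lambda>\<omega>. if \<omega> \<in> D then W \<omega> else 0"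
  have four: "sum W (Pow E) * sum ?\<nu>D (Pow E) \<le> sum \<nu> (Pow E) * sum ?WD (Pow E)"
  proof (rule four_functions[OF E(1)])
    fix A B assume AB: "A \<subseteq> E" "B \<subseteq> E"
    show "W A * ?\<nu>D B \<le> \<nu> (A \<union> B) * ?WD (A \<inter> B)"
      using lattice[OF AB] D(2)[of B "A \<inter> B"] \<nu>_nn W_nn by auto
  qed (use W_nn \<nu>_nn in auto)
  have sumW: "sum ?WD (Pow E) = sum W D"
    using D(1) E(1) by (intro sum.mono_neutral_cong_right) auto
  have total: "sum \<nu> (Pow E) = (\<Prod>i\<in>I. sum (w i) (Pow (Es i)))"
  proof -
    have "sum (bern \<beta> J G) (Pow G) = 1"
      using sum_bern_closed[OF G(1), of "{}" \<beta> J] by simp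
    then show ?thesis
      unfolding \<nu>_def E_eq using sum_Pow_UN_product[OF I(1,2) G(2), of w "bern \<beta> J G"] by simp
  qed
  have good: "(\<Prod>i\<in>I. sum (w i) (Ds i)) * (\<Prod>e\<in>F. 1 - edge_prob \<beta> J e) \<le> sum ?\<nu>D (Pow E)"
  proof -
    let ?f = "\<lambda>i \<omega>. if \<omega> \<in> Ds i then w i \<omega> else 0"
    let ?h = "\<lambda>\<omega>. if \<omega> \<inter> F = {} then bern \<beta> J G \<omega> else 0"
    have "sum (?f i) (Pow (Es i)) = sum (w i) (Ds i)" if "i \<in> I" for i
      using Ds[OF that] finEs[OF that] by (intro sum.mono_neutral_cong_right) auto
    moreover have "sum ?h (Pow G) = (\<Prod>e\<in>F. 1 - edge_prob \<beta> J e)"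
      using F by (intro sum_bern_closed G(1)) (auto simp: G_def)
    ultimately have "(\<Prod>i\<in>I. sum (w i) (Ds i)) * (\<Prod>e\<in>F. 1 - edge_prob \<beta> J e) =
        (\<Sum>\<omega>\<in>Pow E. (\<Prod>i\<in>I. ?f i (\<omega> \<inter> Es i)) * ?h (\<omega> \<inter> G))"
      using sum_Pow_UN_product[OF I(1,2) G(2), of ?f ?h] unfolding E_eq by simp
    also have "\<dots> \<le> sum ?\<nu>D (Pow E)"
    proof (rule sum_mono)
      fix \<omega> assume "\<omega> \<in> Pow E"
      then have \<omega>: "\<omega> \<subseteq> E" by simp
      show "(\<Prod>i\<in>I. ?f i (\<omega> \<inter> Es i)) * ?h (\<omega> \<inter> G) \<le> ?\<nu>D \<omega>"
      proof (cases "\<omega> \<inter> F = {} \<and> (\<forall>i\<in>I. \<omega> \<inter> Es i \<in> Ds i)")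
        case True
        then have "\<omega> \<in> D" using sub \<omega> by blast
        moreover have "(\<omega> \<inter> G) \<inter> F = {}" using True by auto
        moreover have "(\<Prod>i\<in>I. ?f i (\<omega> \<inter> Es i)) = (\<Prod>i\<in>I. w i (\<omega> \<inter> Es i))"
          using True by (intro prod.cong) auto
        ultimately show ?thesis by (simp add: \<nu>_def)
      next
        case False
        have "(\<omega> \<inter> G) \<inter> F = \<omega> \<inter> F" using F by (auto simp: G_def)
        then have "(\<Prod>i\<in>I. ?f i (\<omega> \<inter> Es i)) * ?h (\<omega> \<inter> G) = 0"
          using False I(1) by (auto intro!: prod_zero)
        then show ?thesis using \<nu>_nn by auto
      qed
    qed
    finally show ?thesis .
  qed
  have posW: "sum W (Pow E) > 0" unfolding W_def using E \<beta> q J by (intro sum_rc_weight_pos) auto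
  have posw: "sum (w i) (Pow (Es i)) > 0" if "i \<in> I" for i
    unfolding w_def using finEs[OF that] \<beta> q J I(3)[OF that] by (intro sum_rc_weight_pos) auto
  have pos\<nu>: "sum \<nu> (Pow E) > 0" unfolding total using posw by (rule prod_pos)
  have "(\<Prod>i\<in>I. rc_prob q \<beta> J (Es i) (Ds i)) * (\<Prod>e\<in>F. 1 - edge_prob \<beta> J e) =
      ((\<Prod>i\<in>I. sum (w i) (Ds i)) * (\<Prod>e\<in>F. 1 - edge_prob \<beta> J e)) / sum \<nu> (Pow E)"
    by (simp add: rc_prob_def w_def prod_dividef total)
  also have "\<dots> \<le> sum ?\<nu>D (Pow E) / sum \<nu> (Pow E)"
    using good pos\<nu> by (simp add: divide_right_mono)
  also have "\<dots> \<le> sum W D / sum W (Pow E)"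
    using four posW pos\<nu> unfolding sumW by (simp add: divide_simps mult.commute)
  finally show ?thesis by (simp add: rc_prob_def W_def)
qed

section \<open>Disconnecting a box by disconnecting its tiles\<close>

lemma adj_sym: "adj x y \<longleftrightarrow> adj y x"
  by (simp add: adj_def norm_minus_commute)

lemma edges_doubleton: "{x, y} \<in> edges \<Lambda> \<longleftrightarrow> x \<in> \<Lambda> \<and> y \<in> \<Lambda> \<and> adj x y"
  by (auto simp: edges_def doubleton_eq_iff adj_sym)

lemma adj_height:
  assumes "adj x y" "norm n = 1"
  shows "\<bar>lat x \<bullet> n - lat y \<bullet> n\<bar> \<le> 1"
  using Cauchy_Schwarz_ineq2[of "lat x - lat y" n] assms by (simp add: adj_def inner_diff_left)

lemma disconnection_empty: "{} \<in> disconnection x n \<Lambda>" for x n :: "real ^ 'd"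
proof -
  have "{(x, y). {x, y} \<in> ({} :: (int ^ 'd) set set)} = {}" by simp
  then have "connected_by {} = (Id :: ((int ^ 'd) \<times> (int ^ 'd)) set)" unfolding connected_by_def by simp
  then show ?thesis by (auto simp: disconnection_def upper_boundary_def lower_boundary_def)
qed

lemma disconnection_subset: "disconnection x n \<Lambda> \<subseteq> Pow (edges \<Lambda>)"
  by (auto simp: disconnection_def)

lemma disconnection_decreasing:
  assumes "\<omega> \<in> disconnection x n \<Lambda>" "\<omega>' \<subseteq> \<omega>"
  shows "\<omega>' \<in> disconnection x n \<Lambda>"
  using assms connected_by_mono[OF assms(2)] unfolding disconnection_def by blast

text \<open>The edges near the hyperplane that lie in no tile; closing them joins the cuts inside the tiles to
a cut of the whole box.\<close>

definition interstitial :: "real \<Rightarrow> real ^ 'd \<Rightarrow> (int ^ 'd) set \<Rightarrow> ('i \<Rightarrow> (int ^ 'd) set) \<Rightarrow> 'i set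
    \<Rightarrow> (int ^ 'd) set set" where
  "interstitial c n \<Lambda> \<Lambda>s I =
    {e \<in> edges \<Lambda>. (\<forall>i\<in>I. e \<notin> edges (\<Lambda>s i)) \<and> (\<forall>y\<in>e. \<bar>lat y \<bullet> n\<bar> \<le> c)}"

text \<open>A vertex set \<open>A\<close> is exhibited which contains the upper boundary of the box, avoids the lower one and is
not left by any open edge. In a tile, \<open>A\<close> consists of the vertices joined to the upper boundary of
the tile; outside the tiles, of the vertices above the hyperplane. On the boundary of a tile the
disconnection event makes \<open>A\<close> agree with the vertices above the centre of that tile, so an
edge that changes sides without lying in a tile must be close to the hyperplane, hence closed.\<close>

lemma disconnection_of_tiles:
  fixes n :: "real ^ 'd" and z :: "'i \<Rightarrow> real ^ 'd"
  assumes n: "norm n = 1"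
    and disj: "disjoint_family_on \<Lambda>s I"
    and inner: "\<And>i y y'. i \<in> I \<Longrightarrow> y \<in> \<Lambda>s i \<Longrightarrow> adj y y' \<Longrightarrow> y' \<in> \<Lambda>"
    and z: "\<And>i. i \<in> I \<Longrightarrow> \<bar>z i \<bullet> n\<bar> \<le> c"
    and c: "c \<ge> 0"
    and \<omega>: "\<omega> \<subseteq> edges \<Lambda>" "\<omega> \<inter> interstitial (c + 1) n \<Lambda> \<Lambda>s I = {}"
    and tiles: "\<And>i. i \<in> I \<Longrightarrow> \<omega> \<inter> edges (\<Lambda>s i) \<in> disconnection (z i) n (\<Lambda>s i)"
  shows "\<omega> \<in> disconnection 0 n \<Lambda>"
proof -
  define joined where "joined = (\<lambda>i y. \<exists>a\<in>upper_boundary (z i) n (\<Lambda>s i).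
    (a, y) \<in> connected_by (\<omega> \<inter> edges (\<Lambda>s i)))"
  define A where "A = {y. (\<exists>i\<in>I. y \<in> \<Lambda>s i \<and> joined i y) \<or>
    ((\<forall>i\<in>I. y \<notin> \<Lambda>s i) \<and> lat y \<bullet> n \<ge> 0)}"
  have uniq: "i = j" if "i \<in> I" "j \<in> I" "y \<in> \<Lambda>s i" "y \<in> \<Lambda>s j" for i j y
    using disj that unfolding disjoint_family_on_def by blast
  have A_tile: "y \<in> A \<longleftrightarrow> joined i y" if "i \<in> I" "y \<in> \<Lambda>s i" for i y
    using that uniq unfolding A_def by blast
  have A_out: "y \<in> A \<longleftrightarrow> lat y \<bullet> n \<ge> 0" if "\<forall>i\<in>I. y \<notin> \<Lambda>s i" for y
    using that unfolding A_def by blast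
  have A_bd: "y \<in> A \<longleftrightarrow> (lat y - z i) \<bullet> n \<ge> 0" if "i \<in> I" "y \<in> inner_boundary (\<Lambda>s i)" for i y
  proof (cases "(lat y - z i) \<bullet> n \<ge> 0")
    case True
    then have "y \<in> upper_boundary (z i) n (\<Lambda>s i)" using that by (simp add: upper_boundary_def)
    moreover have "(y, y) \<in> connected_by (\<omega> \<inter> edges (\<Lambda>s i))" by (simp add: connected_by_def)
    ultimately have "joined i y" unfolding joined_def by blast
    then show ?thesis using True A_tile[OF that(1)] that(2) by (simp add: inner_boundary_def)
  next
    case False
    then have "y \<in> lower_boundary (z i) n (\<Lambda>s i)" using that by (simp add: lower_boundary_def)
    then have "\<not> joined i y" using tiles[OF that(1)] unfolding joined_def disconnection_def by blast
    then show ?thesis using False A_tile[OF that(1)] that(2) by (simp add: inner_boundary_def)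
  qed
  define rim where "rim = (\<lambda>y. (\<forall>i\<in>I. y \<notin> \<Lambda>s i) \<or> (\<exists>i\<in>I. y \<in> inner_boundary (\<Lambda>s i)))"
  have rim_in: "lat y \<bullet> n \<ge> - c" if "rim y" "y \<in> A" for y
    using that A_out[of y] A_bd[of _ y] z c unfolding rim_def by (fastforce simp: inner_diff_left abs_le_iff)
  have rim_out: "lat y \<bullet> n \<le> c" if "rim y" "y \<notin> A" for y
    using that A_out[of y] A_bd[of _ y] z c unfolding rim_def by (fastforce simp: inner_diff_left abs_le_iff)
  have step: "y' \<in> A" if e: "{y, y'} \<in> \<omega>" and y: "y \<in> A" for y y'
  proof (cases "\<exists>i\<in>I. {y, y'} \<in> edges (\<Lambda>s i)")
    case True
    then obtain i where i: "i \<in> I" "{y, y'} \<in> edges (\<Lambda>s i)" by blast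
    then have mem: "y \<in> \<Lambda>s i" "y' \<in> \<Lambda>s i" by (auto simp: edges_doubleton)
    have "(y, y') \<in> connected_by (\<omega> \<inter> edges (\<Lambda>s i))"
      using e i unfolding connected_by_def by auto
    then have "joined i y'"
      using A_tile[OF i(1) mem(1)] y connected_by_trans unfolding joined_def by blast
    then show ?thesis using A_tile[OF i(1) mem(2)] by simp
  next
    case False
    have adj: "adj y y'" and mem: "{y, y'} \<in> edges \<Lambda>" using e \<omega>(1) by (auto simp: edges_doubleton)
    have rim1: "rim v" if "adj v v'" "\<forall>i\<in>I. {v, v'} \<notin> edges (\<Lambda>s i)" for v v'
    proof (cases "\<exists>i\<in>I. v \<in> \<Lambda>s i")
      case True
      then obtain i where i: "i \<in> I" "v \<in> \<Lambda>s i" by blast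
      then have "v' \<notin> \<Lambda>s i" using that by (auto simp: edges_doubleton)
      then have "v \<in> inner_boundary (\<Lambda>s i)"
        using i that(1) adj_sym by (auto simp: inner_boundary_def)
      then show ?thesis using i unfolding rim_def by blast
    qed (auto simp: rim_def)
    have rims: "rim y" "rim y'"
      using rim1[of y y'] rim1[of y' y] False adj adj_sym[of y y'] by (auto simp: insert_commute)
    show ?thesis
    proof (rule ccontr)
      assume "y' \<notin> A"
      then have "lat y' \<bullet> n \<le> c" "lat y \<bullet> n \<ge> - c" using rims rim_in rim_out y by auto
      then have "\<bar>lat y \<bullet> n\<bar> \<le> c + 1" "\<bar>lat y' \<bullet> n\<bar> \<le> c + 1" using adj_height[OF adj n] by linarith+
      then have "{y, y'} \<in> interstitial (c + 1) n \<Lambda> \<Lambda>s I"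
        using False mem by (auto simp: interstitial_def)
      then show False using e \<omega>(2) by blast
    qed
  qed
  have path: "b \<in> A" if "(a, b) \<in> connected_by \<omega>" "a \<in> A" for a b
    using that(1) unfolding connected_by_def
    by (induction rule: rtrancl_induct) (use that(2) step in auto)
  have bd_out: "\<forall>i\<in>I. y \<notin> \<Lambda>s i" if "y \<in> inner_boundary \<Lambda>" for y
    using that inner adj_sym unfolding inner_boundary_def by blast
  have "a \<in> A" if "a \<in> upper_boundary 0 n \<Lambda>" for a
    using that A_out[of a] bd_out[of a] by (simp add: upper_boundary_def)
  moreover have "b \<notin> A" if "b \<in> lower_boundary 0 n \<Lambda>" for b
    using that A_out[of b] bd_out[of b] by (simp add: lower_boundary_def)
  ultimately show ?thesis using path \<omega>(1) unfolding disconnection_def by blast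
qed

lemma finite_edges: "finite \<Lambda> \<Longrightarrow> finite (edges \<Lambda>)"
  by (rule finite_subset[of _ "Pow \<Lambda>"]) (auto simp: edges_def)

lemma edges_mono: "A \<subseteq> B \<Longrightarrow> edges A \<subseteq> edges B"
  by (auto simp: edges_def)

lemma disjoint_edges: "A \<inter> B = {} \<Longrightarrow> edges A \<inter> edges B = {}"
  by (auto simp: edges_def doubleton_eq_iff)

text \<open>The surface tension before division by the area; this is the quantity that is almost additive.\<close>

definition free_energy :: "real \<Rightarrow> real \<Rightarrow> ((int ^ 'd) set \<Rightarrow> real) \<Rightarrow> real ^ 'd \<Rightarrow> real ^ 'd
    \<Rightarrow> (int ^ 'd) set \<Rightarrow> real" where
  "free_energy q \<beta> J x n \<Lambda> = - ln (rc_prob q \<beta> J (edges \<Lambda>) (disconnection x n \<Lambda>))"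

lemma tau_J_free_energy:
  fixes n :: "real ^ 'd"
  assumes "\<beta> \<ge> 0" "q \<ge> 1" "\<And>e. e \<in> edges (discretize (box_R x L H S n)) \<Longrightarrow> J e \<ge> 0"
    "finite (discretize (box_R x L H S n))"
  shows "tau_J q \<beta> J x L H S n = free_energy q \<beta> J x n (discretize (box_R x L H S n)) / L ^ (CARD('d) - 1)"
proof -
  let ?\<Lambda> = "discretize (box_R x L H S n)"
  have "measure (rc_measure q \<beta> J (edges ?\<Lambda>) (wired (edges ?\<Lambda>))) (disconnection x n ?\<Lambda>) =
    rc_prob q \<beta> J (edges ?\<Lambda>) (disconnection x n ?\<Lambda>)"
    using assms by (intro measure_rc_measure finite_edges disconnection_subset) auto
  then show ?thesis by (simp add: tau_J_def free_energy_def Let_def)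
qed

lemma free_energy_nonneg:
  assumes "\<beta> \<ge> 0" "q \<ge> 1" "\<And>e. e \<in> edges UNIV \<Longrightarrow> J e \<ge> 0" "finite \<Lambda>"
  shows "free_energy q \<beta> J x n \<Lambda> \<ge> 0"
proof -
  have J: "\<And>e. e \<in> edges \<Lambda> \<Longrightarrow> J e \<ge> 0" using assms(3) edges_mono[of \<Lambda> UNIV] by auto
  have "rc_prob q \<beta> J (edges \<Lambda>) (disconnection x n \<Lambda>) \<le> 1"
    by (intro rc_prob_le_1 finite_edges disconnection_subset assms J)
  moreover have "rc_prob q \<beta> J (edges \<Lambda>) (disconnection x n \<Lambda>) > 0"
    by (intro rc_prob_pos finite_edges disconnection_subset disconnection_empty assms J)
  ultimately show ?thesis by (simp add: free_energy_def)
qed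

lemma free_energy_tiles:
  fixes n :: "real ^ 'd"
  assumes \<beta>: "\<beta> \<ge> 0" and q: "q \<ge> 1" and J: "\<And>e. e \<in> edges UNIV \<Longrightarrow> J e \<in> {0..1}"
    and n: "norm n = 1"
    and \<Lambda>: "finite \<Lambda>"
    and I: "finite I" "disjoint_family_on \<Lambda>s I" "\<And>i. i \<in> I \<Longrightarrow> \<Lambda>s i \<subseteq> \<Lambda>"
    and inner: "\<And>i y y'. i \<in> I \<Longrightarrow> y \<in> \<Lambda>s i \<Longrightarrow> adj y y' \<Longrightarrow> y' \<in> \<Lambda>"
    and z: "\<And>i. i \<in> I \<Longrightarrow> \<bar>z i \<bullet> n\<bar> \<le> c"
    and c: "c \<ge> 0"
  shows "free_energy q \<beta> J 0 n \<Lambda> \<le> (\<Sum>i\<in>I. free_energy q \<beta> J (z i) n (\<Lambda>s i))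
     + \<beta> * card (interstitial (c + 1) n \<Lambda> \<Lambda>s I)"
proof -
  let ?F = "interstitial (c + 1) n \<Lambda> \<Lambda>s I"
  have J': "\<And>e. e \<in> edges V \<Longrightarrow> J e \<ge> 0" for V using J edges_mono[of V UNIV] by fastforce
  have fin: "finite (\<Lambda>s i)" if "i \<in> I" for i using I(3)[OF that] \<Lambda> finite_subset by blast
  have F: "?F \<subseteq> edges \<Lambda>" by (auto simp: interstitial_def)
  have finF: "finite ?F" using finite_subset[OF F finite_edges[OF \<Lambda>]] .
  have pos: "rc_prob q \<beta> J (edges V) (disconnection x n V) > 0" if "finite V" for x V
    using that by (intro rc_prob_pos finite_edges disconnection_subset disconnection_empty \<beta> q J')
  have main: "(\<Prod>i\<in>I. rc_prob q \<beta> J (edges (\<Lambda>s i)) (disconnection (z i) n (\<Lambda>s i))) *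
      (\<Prod>e\<in>?F. 1 - edge_prob \<beta> J e) \<le> rc_prob q \<beta> J (edges \<Lambda>) (disconnection 0 n \<Lambda>)"
  proof (rule rc_prob_tiles[OF \<beta> q J'[of _ \<Lambda>] finite_edges[OF \<Lambda>] edges_mono _ I(1)])
    show "finite (\<Union> (edges \<Lambda>))"
      using \<Lambda> by (rule rev_finite_subset) (auto simp: edges_def)
    show "disjoint_family_on (\<lambda>i. edges (\<Lambda>s i)) I"
      using I(2) disjoint_edges unfolding disjoint_family_on_def by blast
    show "?F \<subseteq> edges \<Lambda> - (\<Union>i\<in>I. edges (\<Lambda>s i))" by (auto simp: interstitial_def)
  next
    fix \<omega> assume \<omega>: "\<omega> \<subseteq> edges \<Lambda>" "\<omega> \<inter> ?F = {}"
      "\<And>i. i \<in> I \<Longrightarrow> \<omega> \<inter> edges (\<Lambda>s i) \<in> disconnection (z i) n (\<Lambda>s i)"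
    show "\<omega> \<in> disconnection 0 n \<Lambda>"
      by (rule disconnection_of_tiles[OF n I(2) inner z c \<omega>])
  next
    fix i assume "i \<in> I"
    then show "edges (\<Lambda>s i) \<subseteq> edges \<Lambda>" by (intro edges_mono I(3))
  qed (assumption | rule disconnection_subset subset_UNIV | erule (1) disconnection_decreasing)+
  have "exp (- \<beta> * card ?F) \<le> (\<Prod>e\<in>?F. 1 - edge_prob \<beta> J e)"
  proof -
    have "exp (- \<beta> * card ?F) = exp (card ?F * (- \<beta>))"
      by (simp only: mult.commute)
    also have "\<dots> = exp (- \<beta>) ^ card ?F" by (rule exp_of_nat_mult)
    also have "\<dots> = (\<Prod>e\<in>?F. exp (- \<beta>))" by (rule prod_constant[symmetric])
    also have "\<dots> \<le> (\<Prod>e\<in>?F. 1 - edge_prob \<beta> J e)"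
    proof (rule prod_mono)
      fix e assume "e \<in> ?F"
      then have "J e \<le> 1" using F J[of e] edges_mono[of \<Lambda> UNIV] by auto
      then have "\<beta> * J e \<le> \<beta>" using \<beta> by (simp add: mult_left_le)
      then show "0 \<le> exp (- \<beta>) \<and> exp (- \<beta>) \<le> 1 - edge_prob \<beta> J e" by (simp add: edge_prob_def)
    qed
    finally show ?thesis .
  qed
  let ?P = "\<Prod>i\<in>I. rc_prob q \<beta> J (edges (\<Lambda>s i)) (disconnection (z i) n (\<Lambda>s i))"
  have P: "?P > 0" using pos fin by (intro prod_pos) auto
  have "?P * exp (- \<beta> * card ?F) \<le> rc_prob q \<beta> J (edges \<Lambda>) (disconnection 0 n \<Lambda>)"
    using \<open>exp (- \<beta> * card ?F) \<le> _\<close> P main by (meson less_imp_le mult_left_mono order_trans)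
  then have "ln (?P * exp (- \<beta> * card ?F)) \<le> ln (rc_prob q \<beta> J (edges \<Lambda>) (disconnection 0 n \<Lambda>))"
    using P pos[OF \<Lambda>] by (subst ln_le_cancel_iff) auto
  moreover have "ln (?P * exp (- \<beta> * card ?F)) = ln ?P - \<beta> * card ?F"
    using P by (subst ln_mult_pos) auto
  moreover have "ln ?P = (\<Sum>i\<in>I. ln (rc_prob q \<beta> J (edges (\<Lambda>s i)) (disconnection (z i) n (\<Lambda>s i))))"
    by (intro ln_prod I(1) less_imp_neq[OF pos, symmetric] fin)
  ultimately show ?thesis by (simp add: free_energy_def sum_negf)
qed

section \<open>Rotation invariance of volumes\<close>

lemma nn_integral_lborel_shift:
  fixes g :: "'a::euclidean_space \<Rightarrow> ennreal"
  assumes [measurable]: "g \<in> borel_measurable borel"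
  shows "(\<integral>\<^sup>+x. g (c + x) \<partial>lborel) = (\<integral>\<^sup>+x. g x \<partial>lborel)"
proof -
  have "(\<integral>\<^sup>+x. g x \<partial>lborel) = (\<integral>\<^sup>+x. g x \<partial>distr lborel borel ((+) c))" by (simp add: lborel_distr_plus)
  also have "\<dots> = (\<integral>\<^sup>+x. g (c + x) \<partial>lborel)" by (subst nn_integral_distr) simp_all
  finally show ?thesis by simp
qed

lemma emeasure_lborel_shift:
  fixes B :: "'a::euclidean_space set"
  assumes [measurable]: "B \<in> sets borel"
  shows "emeasure lborel {x. c + x \<in> B} = emeasure lborel B"
proof -
  have "emeasure lborel {x. c + x \<in> B} = (\<integral>\<^sup>+x. indicator B (c + x) \<partial>lborel)"
  proof -
    have "(\<lambda>x. indicator B (c + x) :: ennreal) = indicator {x. c + x \<in> B}" by (auto simp: indicator_def)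
    then show ?thesis by simp
  qed
  then show ?thesis by (simp add: nn_integral_lborel_shift)
qed

text \<open>Uniqueness of translation invariant measures, in the form of Fubini's theorem: with \<open>b\<close> the unit
ball, the double integral of \<open>indicator b (f x) * indicator B (f x + y)\<close> is \<open>vol b * vol B\<close> when \<open>y\<close> is
integrated first, and \<open>vol b * vol (f -` B)\<close> after the substitution \<open>x \<rightarrow> x - f\<inverse> y\<close>. The ball is preserved
by \<open>f\<close> and has positive finite volume, so it can be cancelled.\<close>

lemma emeasure_lborel_orthogonal_vimage:
  fixes f :: "'a::euclidean_space \<Rightarrow> 'a"
  assumes f: "orthogonal_transformation f" and [measurable]: "B \<in> sets borel"
  shows "emeasure lborel (f -` B) = emeasure lborel B"
proof -
  have lin: "linear f" using f by (simp add: orthogonal_transformation_linear)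
  have [measurable]: "f \<in> borel_measurable borel"
    by (intro borel_measurable_continuous_onI linear_continuous_on linear_conv_bounded_linear[THEN iffD1] lin)
  have nf: "norm (f x) = norm x" for x using f by (simp add: orthogonal_transformation_norm)
  have surj: "surj f" using f by (simp add: orthogonal_transformation_surj)
  let ?b = "ball (0::'a) 1"
  let ?v = "emeasure lborel ?b"
  have [measurable]: "?b \<in> sets borel" by simp
  let ?G = "\<lambda>x y. indicator ?b (f x) * indicator B (f x + y) :: ennreal"
  have "?v * emeasure lborel B = (\<integral>\<^sup>+x. \<integral>\<^sup>+y. ?G x y \<partial>lborel \<partial>lborel)"
  proof -
    have "(\<integral>\<^sup>+y. ?G x y \<partial>lborel) = indicator ?b x * emeasure lborel B" for x
    proof -
      have "(\<integral>\<^sup>+y. ?G x y \<partial>lborel) = indicator ?b (f x) * (\<integral>\<^sup>+y. indicator B (f x + y) \<partial>lborel)"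
        by (rule nn_integral_cmult) measurable
      also have "(\<integral>\<^sup>+y. indicator B (f x + y) \<partial>lborel) = emeasure lborel B"
        by (subst nn_integral_lborel_shift) simp_all
      finally show ?thesis by (simp add: indicator_def nf)
    qed
    moreover have "(\<integral>\<^sup>+x. indicator ?b x * emeasure lborel B \<partial>lborel) =
        (\<integral>\<^sup>+x. indicator ?b x \<partial>lborel) * emeasure lborel B"
      by (rule nn_integral_multc) measurable
    ultimately show ?thesis by simp
  qed
  also have "\<dots> = (\<integral>\<^sup>+y. \<integral>\<^sup>+x. ?G x y \<partial>lborel \<partial>lborel)"
    by (rule lborel_pair.Fubini') measurable
  also have "\<dots> = (\<integral>\<^sup>+y. \<integral>\<^sup>+x. indicator ?b (f x - y) * indicator B (f x) \<partial>lborel \<partial>lborel)"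
  proof (rule nn_integral_cong)
    fix y :: 'a
    obtain c where c: "f c = - y" using surj by (metis surjD)
    have "f (c + x) = f x - y" for x using lin c by (simp add: linear_add)
    then have "(\<integral>\<^sup>+x. indicator ?b (f x - y) * indicator B (f x) \<partial>lborel) =
        (\<integral>\<^sup>+x. (\<lambda>x. ?G x y) (c + x) \<partial>lborel)" by simp
    also have "\<dots> = (\<integral>\<^sup>+x. ?G x y \<partial>lborel)" by (rule nn_integral_lborel_shift) measurable
    finally show "(\<integral>\<^sup>+x. ?G x y \<partial>lborel) = (\<integral>\<^sup>+x. indicator ?b (f x - y) * indicator B (f x) \<partial>lborel)" by simp
  qed
  also have "\<dots> = (\<integral>\<^sup>+x. \<integral>\<^sup>+y. indicator ?b (f x - y) * indicator B (f x) \<partial>lborel \<partial>lborel)"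
    by (rule lborel_pair.Fubini') measurable
  also have "\<dots> = (\<integral>\<^sup>+x. ?v * indicator (f -` B) x \<partial>lborel)"
  proof (rule nn_integral_cong)
    fix x
    have "(\<integral>\<^sup>+y. indicator ?b (f x - y) * indicator B (f x) \<partial>lborel) =
        (\<integral>\<^sup>+y. indicator ?b (f x - y) \<partial>lborel) * indicator B (f x)"
      by (rule nn_integral_multc) measurable
    also have "(\<integral>\<^sup>+y. indicator ?b (f x - y) \<partial>lborel) = (\<integral>\<^sup>+y. (indicator ?b (- f x + y) :: ennreal) \<partial>lborel)"
      by (intro nn_integral_cong) (simp add: indicator_def norm_minus_commute)
    also have "\<dots> = ?v" by (subst nn_integral_lborel_shift) simp_all
    finally show "(\<integral>\<^sup>+y. indicator ?b (f x - y) * indicator B (f x) \<partial>lborel) = ?v * indicator (f -` B) x"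
      by (simp add: indicator_def)
  qed
  also have "\<dots> = ?v * emeasure lborel (f -` B)"
  proof -
    have [measurable]: "f -` B \<in> sets borel" using measurable_sets[of f borel borel B] by simp
    have "(\<integral>\<^sup>+x. ?v * indicator (f -` B) x \<partial>lborel) = ?v * (\<integral>\<^sup>+x. indicator (f -` B) x \<partial>lborel)"
      by (rule nn_integral_cmult) measurable
    then show ?thesis by simp
  qed
  finally have "?v * emeasure lborel B = ?v * emeasure lborel (f -` B)" .
  moreover have "?v < \<top>" using emeasure_lborel_ball_finite by simp
  moreover have "?v \<noteq> 0"
    using content_ball_pos[of 1 "0::'a"] by (auto simp: Sigma_Algebra.measure_def)
  ultimately show ?thesis by (auto simp: ennreal_mult_cancel_left)
qed

section \<open>Boxes in an orthonormal frame\<close>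

lemma orthonormal_basis_inner:
  fixes u :: "nat \<Rightarrow> real ^ 'd"
  assumes "orthonormal_basis u" "i \<in> {1..CARD('d)}" "j \<in> {1..CARD('d)}"
  shows "u i \<bullet> u j = (if i = j then 1 else 0)"
  using assms unfolding orthonormal_basis_def by blast

lemma orthonormal_basis_norm:
  fixes u :: "nat \<Rightarrow> real ^ 'd"
  assumes "orthonormal_basis u" "i \<in> {1..CARD('d)}"
  shows "norm (u i) = 1"
  using orthonormal_basis_inner[OF assms(1) assms(2) assms(2)] by (simp add: norm_eq_sqrt_inner)

lemma orthonormal_basis_eq_sum:
  fixes u :: "nat \<Rightarrow> real ^ 'd"
  assumes "orthonormal_basis u"
  shows "(\<Sum>k\<in>{1..CARD('d)}. (w \<bullet> u k) *\<^sub>R u k) = w"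
proof -
  let ?K = "{1..CARD('d)}"
  have inj: "inj_on u ?K"
  proof (rule inj_onI, rule ccontr)
    fix i j assume ij: "i \<in> ?K" "j \<in> ?K" "u i = u j" "i \<noteq> j"
    then show False using orthonormal_basis_inner[OF assms ij(1,2)] orthonormal_basis_inner[OF assms ij(1,1)] by simp
  qed
  have "(\<Sum>b\<in>u ` ?K. (w \<bullet> b) *\<^sub>R b) = w"
  proof (rule orthonormal_basis_expand)
    show "pairwise orthogonal (u ` ?K)"
      using orthonormal_basis_inner[OF assms] by (fastforce simp: pairwise_def orthogonal_def)
    show "norm b = 1" if "b \<in> u ` ?K" for b using that orthonormal_basis_norm[OF assms] by auto
    show "w \<in> span (u ` ?K)" using assms by (simp add: orthonormal_basis_def)
  qed simp
  then show ?thesis by (simp only: sum.reindex[OF inj] o_def)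
qed

lemma orthonormal_basis_sum_inner:
  fixes u :: "nat \<Rightarrow> real ^ 'd"
  assumes "orthonormal_basis u" "K \<subseteq> {1..CARD('d)}" "j \<in> {1..CARD('d)}"
  shows "(\<Sum>k\<in>K. t k *\<^sub>R u k) \<bullet> u j = (if j \<in> K then t j else 0)"
proof -
  have "finite K" using assms(2) finite_subset by blast
  have "(\<Sum>k\<in>K. t k *\<^sub>R u k) \<bullet> u j = (\<Sum>k\<in>K. if k = j then t k else 0)"
    unfolding inner_sum_left
    using assms orthonormal_basis_inner[OF assms(1) _ assms(3)] by (intro sum.cong) (auto simp: subset_eq)
  then show ?thesis using \<open>finite K\<close> by simp
qed

lemma atLeastAtMost_insert_last:
  "{1..CARD('d::finite)} = insert CARD('d) {1..CARD('d) - 1}" "CARD('d) \<in> {1..CARD('d)}"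
  using zero_less_card_finite[where 'a = 'd] by (auto simp del: zero_less_card_finite)

text \<open>The open box with centre \<open>x\<close> in the frame \<open>u\<close>, given by half-widths: \<open>a\<close> in the first directions and
\<open>h\<close> along the last vector, which plays the role of the normal.\<close>

definition frame_box :: "(nat \<Rightarrow> real ^ 'd) \<Rightarrow> real ^ 'd \<Rightarrow> real \<Rightarrow> real \<Rightarrow> (real ^ 'd) set" where
  "frame_box u x a h =
    {w. (\<forall>k\<in>{1..CARD('d) - 1}. \<bar>(w - x) \<bullet> u k\<bar> < a) \<and> \<bar>(w - x) \<bullet> u CARD('d)\<bar> < h}"

definition cube :: "(nat \<Rightarrow> real ^ 'd) \<Rightarrow> (real ^ 'd) set" where
  "cube u = {\<Sum>k\<in>{1..CARD('d) - 1}. t k *\<^sub>R u k | t. \<forall>k\<in>{1..CARD('d) - 1}. t k \<in> {- (1/2)..1/2}}"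

lemma open_frame_box:
  fixes u :: "nat \<Rightarrow> real ^ 'd"
  shows "open (frame_box u x a h)"
proof -
  have "frame_box u x a h = (\<Inter>k\<in>{1..CARD('d) - 1}. {w. \<bar>(w - x) \<bullet> u k\<bar> < a}) \<inter> {w. \<bar>(w - x) \<bullet> u CARD('d)\<bar> < h}"
    by (auto simp: frame_box_def)
  then show ?thesis
    by (simp only:) (intro open_Int open_INT ballI open_Collect_less continuous_intros finite_atLeastAtMost)
qed

lemma box_R_iff:
  fixes u :: "nat \<Rightarrow> real ^ 'd"
  assumes u: "orthonormal_basis u" and L: "L > 0"
  shows "w \<in> box_R x L H (cube u) (u CARD('d)) \<longleftrightarrow>
    (\<forall>k\<in>{1..CARD('d) - 1}. \<bar>(w - x) \<bullet> u k\<bar> \<le> L / 2) \<and> \<bar>(w - x) \<bullet> u CARD('d)\<bar> \<le> H"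
proof
  let ?K = "{1..CARD('d) - 1}" and ?d = "CARD('d)"
  have d: "?d \<in> {1..?d}" "?K \<subseteq> {1..?d}" "?d \<notin> ?K" using atLeastAtMost_insert_last[where 'd = 'd] by auto
  {
    assume "w \<in> box_R x L H (cube u) (u ?d)"
    then obtain t h where t: "\<forall>k\<in>?K. t k \<in> {- (1/2)..1/2}" and h: "h \<in> {- H..H}"
      and w: "w = x + L *\<^sub>R (\<Sum>k\<in>?K. t k *\<^sub>R u k) + h *\<^sub>R u ?d"
      by (auto simp: box_R_def cube_def)
    have inner: "(w - x) \<bullet> u j = L * (if j \<in> ?K then t j else 0) + h * (if ?d = j then 1 else 0)"
      if "j \<in> {1..?d}" for j
      using orthonormal_basis_sum_inner[OF u d(2) that, of t] orthonormal_basis_inner[OF u d(1) that]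
      by (simp add: w inner_add_left)
    show "(\<forall>k\<in>?K. \<bar>(w - x) \<bullet> u k\<bar> \<le> L / 2) \<and> \<bar>(w - x) \<bullet> u ?d\<bar> \<le> H"
    proof (intro conjI ballI)
      fix k assume k: "k \<in> ?K"
      then have "(w - x) \<bullet> u k = L * t k" using inner[of k] d by auto
      moreover have "t k \<in> {- (1/2)..1/2}" using t k by blast
      then have "\<bar>t k\<bar> \<le> 1 / 2" by auto
      then have "L * \<bar>t k\<bar> \<le> L * (1/2)" using L by (intro mult_left_mono) auto
      ultimately show "\<bar>(w - x) \<bullet> u k\<bar> \<le> L / 2" using L by (simp add: abs_mult)
    next
      show "\<bar>(w - x) \<bullet> u ?d\<bar> \<le> H" using inner[OF d(1)] d(3) h by (simp add: abs_le_iff)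
    qed
  }
  {
    assume *: "(\<forall>k\<in>?K. \<bar>(w - x) \<bullet> u k\<bar> \<le> L / 2) \<and> \<bar>(w - x) \<bullet> u ?d\<bar> \<le> H"
    define t where "t = (\<lambda>k. ((w - x) \<bullet> u k) / L)"
    have "w - x = (\<Sum>k\<in>{1..?d}. ((w - x) \<bullet> u k) *\<^sub>R u k)" using orthonormal_basis_eq_sum[OF u] by simp
    also have "\<dots> = ((w - x) \<bullet> u ?d) *\<^sub>R u ?d + (\<Sum>k\<in>?K. ((w - x) \<bullet> u k) *\<^sub>R u k)"
      by (subst atLeastAtMost_insert_last(1)) (rule sum.insert[OF finite_atLeastAtMost d(3)])
    also have "(\<Sum>k\<in>?K. ((w - x) \<bullet> u k) *\<^sub>R u k) = L *\<^sub>R (\<Sum>k\<in>?K. t k *\<^sub>R u k)"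
      using L by (simp add: scaleR_sum_right t_def)
    finally have "w = x + L *\<^sub>R (\<Sum>k\<in>?K. t k *\<^sub>R u k) + ((w - x) \<bullet> u ?d) *\<^sub>R u ?d"
      by (simp add: algebra_simps)
    moreover have "\<forall>k\<in>?K. t k \<in> {- (1/2)..1/2}"
      using * L by (fastforce simp: t_def abs_le_iff field_simps)
    moreover have "(w - x) \<bullet> u ?d \<in> {- H..H}" using * by (auto simp: abs_le_iff)
    ultimately show "w \<in> box_R x L H (cube u) (u ?d)"
      unfolding box_R_def cube_def by blast
  }
qed

lemma interior_box_R:
  fixes u :: "nat \<Rightarrow> real ^ 'd"
  assumes u: "orthonormal_basis u" and L: "L > 0"
  shows "interior (box_R x L H (cube u) (u CARD('d))) = frame_box u x (L / 2) H"
proof (intro equalityI subsetI)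
  let ?K = "{1..CARD('d) - 1}" and ?d = "CARD('d)"
  let ?R = "box_R x L H (cube u) (u CARD('d))"
  have d: "?d \<in> {1..?d}" "?K \<subseteq> {1..?d}" using atLeastAtMost_insert_last[where 'd = 'd] by auto
  fix w assume "w \<in> interior ?R"
  then obtain e where e: "e > 0" "ball w e \<subseteq> ?R" by (auto simp: mem_interior)
  \<comment> \<open>Moving a little along a frame vector stays in the box, so no coordinate is extremal.\<close>
  have "\<exists>w'\<in>?R. \<bar>(w' - x) \<bullet> u k\<bar> > \<bar>(w - x) \<bullet> u k\<bar>" if "k \<in> {1..?d}" for k
  proof -
    define s :: real where "s = (if (w - x) \<bullet> u k \<ge> 0 then 1 else - 1)"
    let ?w = "w + (s * (e / 2)) *\<^sub>R u k"
    have "dist w ?w = e / 2"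
      using orthonormal_basis_norm[OF u that] e(1) by (simp add: dist_norm s_def)
    then have "?w \<in> ?R" using e by (intro subsetD[OF e(2)]) simp
    moreover have "(?w - x) \<bullet> u k = (w - x) \<bullet> u k + s * (e / 2)"
      using orthonormal_basis_inner[OF u that that] by (simp add: algebra_simps)
    then have "\<bar>(?w - x) \<bullet> u k\<bar> > \<bar>(w - x) \<bullet> u k\<bar>" using e(1) by (auto simp: s_def)
    ultimately show ?thesis by blast
  qed
  note move = this
  have "\<bar>(w - x) \<bullet> u k\<bar> < L / 2" if k: "k \<in> ?K" for k
  proof -
    obtain w' where "w' \<in> ?R" "\<bar>(w' - x) \<bullet> u k\<bar> > \<bar>(w - x) \<bullet> u k\<bar>"
      using move[OF subsetD[OF d(2) k]] by blast
    moreover have "\<bar>(w' - x) \<bullet> u k\<bar> \<le> L / 2"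
      using \<open>w' \<in> ?R\<close> k unfolding box_R_iff[OF u L] by blast
    ultimately show ?thesis by linarith
  qed
  moreover have "\<bar>(w - x) \<bullet> u ?d\<bar> < H"
  proof -
    obtain w' where "w' \<in> ?R" "\<bar>(w' - x) \<bullet> u ?d\<bar> > \<bar>(w - x) \<bullet> u ?d\<bar>"
      using move[OF d(1)] by blast
    moreover have "\<bar>(w' - x) \<bullet> u ?d\<bar> \<le> H"
      using \<open>w' \<in> ?R\<close> unfolding box_R_iff[OF u L] by blast
    ultimately show ?thesis by linarith
  qed
  ultimately show "w \<in> frame_box u x (L / 2) H" by (simp add: frame_box_def)
next
  fix w assume "w \<in> frame_box u x (L / 2) H"
  moreover have "frame_box u x (L / 2) H \<subseteq> box_R x L H (cube u) (u CARD('d))"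
    unfolding subset_eq box_R_iff[OF u L] by (auto simp: frame_box_def intro: less_imp_le)
  ultimately show "w \<in> interior (box_R x L H (cube u) (u CARD('d)))"
    using interior_maximal[OF _ open_frame_box] by blast
qed

text \<open>The coordinates in the frame form an orthogonal map onto the standard coordinates, which takes the
frame box to an axis-parallel one.\<close>

lemma emeasure_frame_box:
  fixes u :: "nat \<Rightarrow> real ^ 'd"
  assumes u: "orthonormal_basis u" and a: "a > 0" and h: "h > 0"
  shows "emeasure lborel (frame_box u x a h) = ennreal ((2 * a) ^ (CARD('d) - 1) * (2 * h))"
proof -
  let ?K = "{1..CARD('d) - 1}" and ?d = "CARD('d)"
  obtain b where b: "bij_betw b (UNIV :: 'd set) {1..?d}"
    using finite_same_card_bij[of "UNIV :: 'd set" "{1..?d}"] by auto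
  define f where "f = (\<lambda>w. \<chi> i. w \<bullet> u (b i))"
  define s where "s = (\<lambda>k. if k = ?d then h else a)"
  have "orthogonal_transformation f"
    unfolding orthogonal_transformation_def
  proof (intro conjI allI)
    show "linear f" by (rule linearI) (auto simp: f_def vec_eq_iff inner_add_left)
    fix v w
    have "f v \<bullet> f w = (\<Sum>i\<in>UNIV. (v \<bullet> u (b i)) * (w \<bullet> u (b i)))" by (simp add: f_def inner_vec_def)
    also have "\<dots> = (\<Sum>k\<in>{1..?d}. (v \<bullet> u k) * (w \<bullet> u k))"
      using b by (rule sum.reindex_bij_betw)
    also have "\<dots> = (\<Sum>k\<in>{1..?d}. (v \<bullet> u k) *\<^sub>R u k) \<bullet> w"
      unfolding inner_sum_left by (simp add: inner_commute)
    finally show "f v \<bullet> f w = v \<bullet> w" using orthonormal_basis_eq_sum[OF u] by simp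
  qed
  let ?B = "box (\<chi> i. - s (b i)) (\<chi> i. s (b i))"
  have "w \<in> frame_box u 0 a h \<longleftrightarrow> f w \<in> ?B" for w
  proof -
    have "- y < v \<and> v < y \<longleftrightarrow> \<bar>v\<bar> < y" for v y :: real by linarith
    then have "f w \<in> ?B \<longleftrightarrow> (\<forall>i. \<bar>w \<bullet> u (b i)\<bar> < s (b i))" by (simp add: f_def mem_box_cart)
    also have "\<dots> \<longleftrightarrow> (\<forall>k\<in>{1..?d}. \<bar>w \<bullet> u k\<bar> < s k)"
      using bij_betw_imp_surj_on[OF b] by (metis UNIV_I imageE image_eqI)
    also have "\<dots> \<longleftrightarrow> w \<in> frame_box u 0 a h"
      using atLeastAtMost_insert_last[where 'd = 'd] by (auto simp: frame_box_def s_def)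
    finally show ?thesis by simp
  qed
  then have f0: "frame_box u 0 a h = f -` ?B" by auto
  have "frame_box u x a h = {w. - x + w \<in> frame_box u 0 a h}"
    by (auto simp: frame_box_def)
  then have "emeasure lborel (frame_box u x a h) = emeasure lborel (frame_box u 0 a h)"
    by (simp only: emeasure_lborel_shift[OF borel_open[OF open_frame_box]])
  also have "\<dots> = emeasure lborel ?B"
    unfolding f0 by (rule emeasure_lborel_orthogonal_vimage) (use \<open>orthogonal_transformation f\<close> in auto)
  also have "\<dots> = ennreal (\<Prod>i\<in>Basis. ((\<chi> i. s (b i)) - (\<chi> i. - s (b i))) \<bullet> i)"
    using a h by (intro emeasure_lborel_box) (auto simp: Basis_vec_def inner_axis s_def)
  also have "(\<Prod>i\<in>Basis. ((\<chi> i. s (b i)) - (\<chi> i. - s (b i))) \<bullet> i) = (\<Prod>i\<in>UNIV. 2 * s (b i))"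
  proof -
    have inj: "inj (\<lambda>i::'d. axis i (1::real))" by (auto simp: inj_def axis_eq_axis)
    have B: "(Basis :: (real ^ 'd) set) = range (\<lambda>i. axis i 1)" by (auto simp: Basis_vec_def)
    show ?thesis unfolding B prod.reindex[OF inj] o_def by (simp add: inner_axis)
  qed
  also have "\<dots> = (\<Prod>k\<in>{1..?d}. 2 * s k)" using b by (rule prod.reindex_bij_betw)
  also have "\<dots> = (2 * h) * (\<Prod>k\<in>?K. 2 * s k)"
    using zero_less_card_finite[where 'a = 'd] unfolding atLeastAtMost_insert_last(1)[where 'd = 'd]
    by (subst prod.insert) (auto simp: s_def simp del: zero_less_card_finite)
  also have "(\<Prod>k\<in>?K. 2 * s k) = (\<Prod>k\<in>?K. 2 * a)"
    using zero_less_card_finite[where 'a = 'd]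
    by (intro prod.cong) (auto simp: s_def simp del: zero_less_card_finite)
  also have "\<dots> = (2 * a) ^ (?d - 1)" by simp
  finally show ?thesis by (simp add: mult.commute)
qed

lemma fmeasurable_frame_box:
  fixes u :: "nat \<Rightarrow> real ^ 'd"
  assumes "orthonormal_basis u" "a > 0" "h > 0"
  shows "frame_box u x a h \<in> fmeasurable lborel"
  using borel_open[OF open_frame_box, of u x a h] emeasure_frame_box[OF assms, of x]
  by (intro fmeasurableI) (auto simp del: zero_less_card_finite)

lemma measure_frame_box:
  fixes u :: "nat \<Rightarrow> real ^ 'd"
  assumes "orthonormal_basis u" "a > 0" "h > 0"
  shows "measure lborel (frame_box u x a h) = (2 * a) ^ (CARD('d) - 1) * (2 * h)"
  using emeasure_frame_box[OF assms] assms by (simp add: Sigma_Algebra.measure_def)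

section \<open>Lattice points and grids\<close>

lemma lat_add: "lat (x + y) = lat x + lat y"
  by (simp add: lat_def vec_eq_iff)

lemma lat_diff: "lat (x - y) = lat x - lat y"
  by (simp add: lat_def vec_eq_iff)

lemma lat_zero: "lat 0 = 0"
  by (simp add: lat_def vec_eq_iff)

lemma dist_lat_ge_1:
  assumes "x \<noteq> y"
  shows "dist (lat x) (lat y) \<ge> 1"
proof -
  obtain i where "x $ i \<noteq> y $ i" using assms by (auto simp: vec_eq_iff)
  then have "1 \<le> \<bar>x $ i - y $ i\<bar>" by linarith
  then have "1 \<le> \<bar>real_of_int (x $ i - y $ i)\<bar>" by linarith
  also have "\<dots> = norm ((lat x - lat y) $ i)" by (simp add: lat_def)
  also have "\<dots> \<le> norm (lat x - lat y)" by (rule Finite_Cartesian_Product.norm_nth_le)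
  finally show ?thesis by (simp add: dist_norm)
qed

lemma finite_lattice_points:
  fixes B :: "(real ^ 'd) set"
  assumes "bounded B"
  shows "finite {y. lat y \<in> B}"
proof -
  obtain m where m: "\<And>x. x \<in> B \<Longrightarrow> norm x \<le> m" using assms by (auto simp: bounded_iff)
  let ?T = "{- \<lceil>m\<rceil>..\<lceil>m\<rceil>}"
  have "{y. lat y \<in> B} \<subseteq> vec_lambda ` (UNIV \<rightarrow>\<^sub>E ?T)"
  proof
    fix y assume y: "y \<in> {y. lat y \<in> B}"
    have "y $ i \<in> ?T" for i
    proof -
      have "\<bar>real_of_int (y $ i)\<bar> \<le> norm (lat y)"
        using component_le_norm_cart[of "lat y" i] by (simp add: lat_def)
      then have "\<bar>real_of_int (y $ i)\<bar> \<le> m" using m[of "lat y"] y by simp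
      then show ?thesis by (simp add: abs_le_iff) linarith
    qed
    then have "($) y \<in> UNIV \<rightarrow>\<^sub>E ?T" by auto
    then show "y \<in> vec_lambda ` (UNIV \<rightarrow>\<^sub>E ?T)" by (intro image_eqI[of _ _ "($) y"]) simp_all
  qed
  then show ?thesis by (rule finite_subset) (intro finite_imageI finite_PiE; simp)
qed

text \<open>Distinct lattice points have distance at least \<open>1\<close>, so the balls of radius \<open>1/2\<close> around them are
disjoint. Balls, unlike lattice cubes, are well adapted to boxes in any orthonormal frame.\<close>

lemma card_lattice_points_le:
  fixes X :: "(real ^ 'd) set"
  assumes "finite Y" "X \<in> fmeasurable lborel" "\<And>y. y \<in> Y \<Longrightarrow> ball (lat y) (1/2) \<subseteq> X"
  shows "card Y * measure lborel (ball (0 :: real ^ 'd) (1/2)) \<le> measure lborel X"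
proof -
  have "card Y * measure lborel (ball (0 :: real ^ 'd) (1/2)) =
      (\<Sum>y\<in>Y. measure lborel (ball (lat y) (1/2)))"
    by (simp add: content_ball)
  also have "\<dots> = measure lborel (\<Union>y\<in>Y. ball (lat y) (1/2))"
  proof (rule measure_UNION'[symmetric, OF assms(1)])
    show "ball (lat y) (1/2) \<in> fmeasurable lborel" for y
      using emeasure_lborel_ball_finite by (intro fmeasurableI) auto
    show "pairwise (\<lambda>x y. disjnt (ball (lat x) (1/2)) (ball (lat y) (1/2))) Y"
    proof (rule pairwiseI)
      fix x y :: "int ^ 'd" assume "x \<noteq> y"
      then have "1 \<le> dist (lat x) (lat y)" by (rule dist_lat_ge_1)
      then have "w \<notin> ball (lat y) (1/2)" if "w \<in> ball (lat x) (1/2)" for w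
        using dist_triangle2[of "lat x" "lat y" w] that by auto
      then show "disjnt (ball (lat x) (1/2)) (ball (lat y) (1/2))" unfolding disjnt_def by blast
    qed
  qed
  also have "\<dots> \<le> measure lborel X"
    using assms by (intro measure_mono_fmeasurable UN_least) auto
  finally show ?thesis .
qed

definition lattice_floor :: "real ^ 'd \<Rightarrow> int ^ 'd" where
  "lattice_floor x = (\<chi> i. \<lfloor>x $ i\<rfloor>)"

lemma norm_lattice_floor:
  fixes x :: "real ^ 'd"
  shows "norm (lat (lattice_floor x) - x) \<le> CARD('d)"
proof -
  have "\<bar>(lat (lattice_floor x) - x) $ i\<bar> \<le> 1" for i
    unfolding lattice_floor_def lat_def by simp linarith
  then have "(\<Sum>i\<in>UNIV. \<bar>(lat (lattice_floor x) - x) $ i\<bar>) \<le> (\<Sum>i\<in>(UNIV::'d set). 1)"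
    by (intro sum_mono)
  then show ?thesis using norm_le_l1_cart[of "lat (lattice_floor x) - x"] by simp
qed

definition num_neighbours :: "'d::finite itself \<Rightarrow> nat" where
  "num_neighbours _ = card {v :: int ^ 'd. adj 0 v}"

lemma neighbours:
  fixes y :: "int ^ 'd"
  shows "finite {y'. adj y y'}" "card {y'. adj y y'} = num_neighbours TYPE('d)"
proof -
  have eq: "{y'. adj y y'} = (+) y ` {v. adj 0 v}" for y :: "int ^ 'd"
  proof -
    have "adj y y' \<longleftrightarrow> adj 0 (y' - y)" for y'
      by (simp add: adj_def lat_diff lat_zero)
    then show ?thesis by (force simp: image_iff)
  qed
  have "finite {v :: int ^ 'd. adj 0 v}"
  proof (rule finite_subset[OF _ finite_lattice_points])
    show "{v. adj 0 v} \<subseteq> {v. lat v \<in> cball (0 :: real ^ 'd) 1}" by (auto simp: adj_def lat_zero)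
  qed simp
  then show "finite {y'. adj y y'}" "card {y'. adj y y'} = num_neighbours TYPE('d)"
    unfolding eq[of y] num_neighbours_def by (auto simp: card_image)
qed

lemma orthonormal_basis_inner_le:
  fixes u :: "nat \<Rightarrow> real ^ 'd"
  assumes "orthonormal_basis u" "i \<in> {1..CARD('d)}"
  shows "\<bar>v \<bullet> u i\<bar> \<le> norm v"
  using Cauchy_Schwarz_ineq2[of v "u i"] orthonormal_basis_norm[OF assms] by simp

lemma bounded_frame_box:
  fixes u :: "nat \<Rightarrow> real ^ 'd"
  assumes u: "orthonormal_basis u"
  shows "bounded (frame_box u x a h)"
proof -
  let ?d = "CARD('d)"
  have "norm (w - x) \<le> ?d * (\<bar>a\<bar> + \<bar>h\<bar>)" if w: "w \<in> frame_box u x a h" for w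
  proof -
    have "norm (w - x) = norm (\<Sum>k\<in>{1..?d}. ((w - x) \<bullet> u k) *\<^sub>R u k)"
      using orthonormal_basis_eq_sum[OF u, of "w - x"] by simp
    also have "\<dots> \<le> (\<Sum>k\<in>{1..?d}. \<bar>(w - x) \<bullet> u k\<bar>)"
      by (rule sum_norm_le) (simp add: orthonormal_basis_norm[OF u])
    also have "\<dots> \<le> (\<Sum>k\<in>{1..?d}. \<bar>a\<bar> + \<bar>h\<bar>)"
    proof (rule sum_mono)
      fix k assume "k \<in> {1..?d}"
      then have "k \<in> {1..?d - 1} \<or> k = ?d" by auto
      then have "\<bar>(w - x) \<bullet> u k\<bar> < a \<or> \<bar>(w - x) \<bullet> u k\<bar> < h" using w unfolding frame_box_def by blast
      then show "\<bar>(w - x) \<bullet> u k\<bar> \<le> \<bar>a\<bar> + \<bar>h\<bar>" by linarith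
    qed
    finally show ?thesis by simp
  qed
  then have "norm w \<le> norm x + ?d * (\<bar>a\<bar> + \<bar>h\<bar>)" if "w \<in> frame_box u x a h" for w
    using that norm_triangle_sub[of w x] by fastforce
  then show ?thesis by (auto simp: bounded_iff)
qed

definition tile :: "(nat \<Rightarrow> real ^ 'd) \<Rightarrow> real ^ 'd \<Rightarrow> real \<Rightarrow> real \<Rightarrow> (int ^ 'd) set" where
  "tile u x L H = {y. lat y \<in> frame_box u x (L / 2) H}"

lemma finite_tile: "orthonormal_basis u \<Longrightarrow> finite (tile u x L H)"
  unfolding tile_def by (intro finite_lattice_points bounded_frame_box)

lemma discretize_box_R:
  fixes u :: "nat \<Rightarrow> real ^ 'd"
  assumes "orthonormal_basis u" "L > 0"
  shows "discretize (box_R x L H (cube u) (u CARD('d))) = tile u x L H"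
  by (simp add: discretize_def tile_def interior_box_R[OF assms])

lemma tile_translate: "tile u (lat z) L H = (+) z ` tile u 0 L H"
proof -
  have "y \<in> tile u (lat z) L H \<longleftrightarrow> y - z \<in> tile u 0 L H" for y
    by (simp add: tile_def frame_box_def lat_diff)
  then show ?thesis by (force simp: image_iff)
qed

text \<open>Two frames with the same normal: since \<open>u j\<close> is orthogonal to the normal, a coordinate of \<open>v\<close> along
\<open>u j\<close> only involves the tangential coordinates of \<open>v\<close> in the frame \<open>u'\<close>.\<close>

lemma frame_change_bound:
  fixes u u' :: "nat \<Rightarrow> real ^ 'd" and r :: real
  assumes u: "orthonormal_basis u" and u': "orthonormal_basis u'" and same: "u' CARD('d) = u CARD('d)"
    and v: "\<And>k. k \<in> {1..CARD('d) - 1} \<Longrightarrow> \<bar>v \<bullet> u' k\<bar> \<le> r" and r: "r \<ge> 0"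
    and j: "j \<in> {1..CARD('d) - 1}"
  shows "\<bar>v \<bullet> u j\<bar> \<le> CARD('d) * r"
proof -
  let ?d = "CARD('d)" let ?K = "{1..?d - 1}"
  have d: "?d \<in> {1..?d}" "?K \<subseteq> {1..?d}" "?d \<notin> ?K" using atLeastAtMost_insert_last[where 'd = 'd] by auto
  have "v = (\<Sum>k\<in>{1..?d}. (v \<bullet> u' k) *\<^sub>R u' k)" using orthonormal_basis_eq_sum[OF u'] by simp
  also have "\<dots> = (v \<bullet> u' ?d) *\<^sub>R u' ?d + (\<Sum>k\<in>?K. (v \<bullet> u' k) *\<^sub>R u' k)"
    by (subst atLeastAtMost_insert_last(1)) (rule sum.insert[OF finite_atLeastAtMost d(3)])
  finally have eq: "v = (v \<bullet> u' ?d) *\<^sub>R u' ?d + (\<Sum>k\<in>?K. (v \<bullet> u' k) *\<^sub>R u' k)" .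
  have "v \<bullet> u j = (v \<bullet> u' ?d) * (u ?d \<bullet> u j) + (\<Sum>k\<in>?K. (v \<bullet> u' k) * (u' k \<bullet> u j))"
    using arg_cong[OF eq, of "\<lambda>x. x \<bullet> u j"]
    by (simp only: inner_add_left inner_scaleR_left inner_sum_left same)
  moreover have "u ?d \<bullet> u j = 0" using orthonormal_basis_inner[OF u d(1), of j] j d by auto
  ultimately have "\<bar>v \<bullet> u j\<bar> = \<bar>\<Sum>k\<in>?K. (v \<bullet> u' k) * (u' k \<bullet> u j)\<bar>" by simp
  also have "\<dots> \<le> (\<Sum>k\<in>?K. \<bar>(v \<bullet> u' k) * (u' k \<bullet> u j)\<bar>)" by (rule sum_abs)
  also have "\<dots> \<le> (\<Sum>k\<in>?K. r)"
  proof (rule sum_mono)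
    fix k assume k: "k \<in> ?K"
    have "\<bar>u' k \<bullet> u j\<bar> \<le> 1"
      using orthonormal_basis_inner_le[OF u, of j "u' k"] orthonormal_basis_norm[OF u', of k] j k d by auto
    then have "\<bar>v \<bullet> u' k\<bar> * \<bar>u' k \<bullet> u j\<bar> \<le> r * 1" using v[OF k] r by (intro mult_mono) auto
    then show "\<bar>(v \<bullet> u' k) * (u' k \<bullet> u j)\<bar> \<le> r" by (simp add: abs_mult)
  qed
  also have "\<dots> \<le> ?d * r" using r by (simp add: mult_right_mono)
  finally show ?thesis .
qed

text \<open>The hyperplane lattice of mesh \<open>a\<close> spanned by the tangential vectors of the frame; its points are the
ideal centres of the tiles.\<close>

definition grid :: "(nat \<Rightarrow> real ^ 'd) \<Rightarrow> real \<Rightarrow> (real ^ 'd) set" where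
  "grid u a = {\<Sum>k\<in>{1..CARD('d) - 1}. (a * of_int (m k)) *\<^sub>R u k | m. True}"

lemma grid_inner:
  fixes u :: "nat \<Rightarrow> real ^ 'd" and a :: real
  assumes u: "orthonormal_basis u" and c: "c \<in> grid u a"
  shows "c \<bullet> u CARD('d) = 0"
    and "\<exists>m::nat \<Rightarrow> int. (\<forall>k\<in>{1..CARD('d) - 1}. c \<bullet> u k = a * m k)
      \<and> c = (\<Sum>k\<in>{1..CARD('d) - 1}. (a * of_int (m k)) *\<^sub>R u k)"
proof -
  let ?d = "CARD('d)" let ?K = "{1..?d - 1}"
  have d: "?d \<in> {1..?d}" "?K \<subseteq> {1..?d}" "?d \<notin> ?K" using atLeastAtMost_insert_last[where 'd = 'd] by auto
  obtain m :: "nat \<Rightarrow> int" where m: "c = (\<Sum>k\<in>?K. (a * of_int (m k)) *\<^sub>R u k)"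
    using c unfolding grid_def by blast
  have i: "c \<bullet> u j = (if j \<in> ?K then a * m j else 0)" if "j \<in> {1..?d}" for j
    unfolding m by (rule orthonormal_basis_sum_inner[OF u d(2) that])
  show "c \<bullet> u ?d = 0" using i[OF d(1)] d(3) by simp
  show "\<exists>m::nat \<Rightarrow> int. (\<forall>k\<in>?K. c \<bullet> u k = a * m k) \<and> c = (\<Sum>k\<in>?K. (a * of_int (m k)) *\<^sub>R u k)"
    using i m d(2) by (intro exI[of _ m]) auto
qed

lemma grid_separated:
  fixes u :: "nat \<Rightarrow> real ^ 'd" and a :: real
  assumes u: "orthonormal_basis u" and a: "a > 0" and c: "c \<in> grid u a" "c' \<in> grid u a" "c \<noteq> c'"
  shows "\<exists>k\<in>{1..CARD('d) - 1}. \<bar>(c - c') \<bullet> u k\<bar> \<ge> a"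
proof -
  obtain m m' :: "nat \<Rightarrow> int" where m: "\<forall>k\<in>{1..CARD('d) - 1}. c \<bullet> u k = a * m k"
      "c = (\<Sum>k\<in>{1..CARD('d) - 1}. (a * of_int (m k)) *\<^sub>R u k)"
    and m': "\<forall>k\<in>{1..CARD('d) - 1}. c' \<bullet> u k = a * m' k"
      "c' = (\<Sum>k\<in>{1..CARD('d) - 1}. (a * of_int (m' k)) *\<^sub>R u k)"
    using grid_inner(2)[OF u c(1)] grid_inner(2)[OF u c(2)] by blast
  have "\<exists>k\<in>{1..CARD('d) - 1}. m k \<noteq> m' k"
  proof (rule ccontr)
    assume "\<not> ?thesis"
    then have "c = c'" unfolding m(2) m'(2) by (intro sum.cong) auto
    then show False using c(3) by simp
  qed
  then obtain k where k: "k \<in> {1..CARD('d) - 1}" "m k \<noteq> m' k" by blast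
  then have "\<bar>m k - m' k\<bar> \<ge> 1" by linarith
  then have "\<bar>real_of_int (m k - m' k)\<bar> \<ge> 1" by linarith
  then have "a * \<bar>real_of_int (m k - m' k)\<bar> \<ge> a * 1" using a by (intro mult_left_mono) auto
  moreover have "(c - c') \<bullet> u k = a * real_of_int (m k - m' k)"
    using m(1) m'(1) k(1) by (simp add: inner_diff_left algebra_simps)
  ultimately show ?thesis using k(1) a by (intro bexI[of _ k]) (simp_all add: abs_mult)
qed

lemma grid_near:
  fixes u :: "nat \<Rightarrow> real ^ 'd" and a :: real
  assumes u: "orthonormal_basis u" and a: "a > 0"
  shows "\<exists>c\<in>grid u a. \<forall>k\<in>{1..CARD('d) - 1}. \<bar>(w - c) \<bullet> u k\<bar> \<le> a / 2"
proof -
  let ?d = "CARD('d)" let ?K = "{1..?d - 1}"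
  have d: "?K \<subseteq> {1..?d}" by auto
  define m where "m = (\<lambda>k. round (w \<bullet> u k / a))"
  define c where "c = (\<Sum>k\<in>?K. (a * of_int (m k)) *\<^sub>R u k)"
  have "\<bar>(w - c) \<bullet> u k\<bar> \<le> a / 2" if k: "k \<in> ?K" for k
  proof -
    have "c \<bullet> u k = a * m k"
      unfolding c_def using orthonormal_basis_sum_inner[OF u d subsetD[OF d k]] k by simp
    then have "(w - c) \<bullet> u k = - (a * (of_int (m k) - w \<bullet> u k / a))"
      using a by (simp add: inner_diff_left field_simps)
    moreover have "a * \<bar>of_int (m k) - w \<bullet> u k / a\<bar> \<le> a * (1 / 2)"
      unfolding m_def by (intro mult_left_mono of_int_round_abs_le) (use a in simp)
    ultimately show ?thesis using a by (simp add: abs_mult)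
  qed
  moreover have "c \<in> grid u a" unfolding c_def grid_def by blast
  ultimately show ?thesis by blast
qed

section \<open>Packing a box with tiles\<close>

lemma interstitial_subset_incident:
  assumes n: "norm n = 1"
    and core: "\<And>y. y \<in> \<Lambda> - B \<Longrightarrow> \<bar>lat y \<bullet> n\<bar> \<le> c \<Longrightarrow>
      \<exists>i\<in>I. y \<in> \<Lambda>s i \<and> (\<forall>y'. adj y y' \<longrightarrow> y' \<in> \<Lambda>s i)"
  shows "interstitial c n \<Lambda> \<Lambda>s I \<subseteq> (\<Union>y\<in>B. (\<lambda>y'. {y, y'}) ` {y'. adj y y'})"
proof
  fix e assume e: "e \<in> interstitial c n \<Lambda> \<Lambda>s I"
  then obtain y y' where yy: "e = {y, y'}" "y \<in> \<Lambda>" "adj y y'" "\<bar>lat y \<bullet> n\<bar> \<le> c"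
    "\<forall>i\<in>I. {y, y'} \<notin> edges (\<Lambda>s i)"
    by (auto simp: interstitial_def edges_def)
  have "y \<in> B"
  proof (rule ccontr)
    assume "y \<notin> B"
    then obtain i where "i \<in> I" "y \<in> \<Lambda>s i" "y' \<in> \<Lambda>s i" using core[of y] yy by blast
    then show False using yy(3,5) by (auto simp: edges_doubleton)
  qed
  then show "e \<in> (\<Union>y\<in>B. (\<lambda>y'. {y, y'}) ` {y'. adj y y'})" using yy by blast
qed

text \<open>An interstitial edge has no endpoint in the core of a tile, that is, among the vertices all of whose
neighbours lie in the tile; so it is incident to the set \<open>B\<close> of remaining vertices.\<close>

lemma card_interstitial_le:
  fixes \<Lambda> B :: "(int ^ 'd) set"
  assumes "norm n = 1" "finite B"
    and "\<And>y. y \<in> \<Lambda> - B \<Longrightarrow> \<bar>lat y \<bullet> n\<bar> \<le> c \<Longrightarrow>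
      \<exists>i\<in>I. y \<in> \<Lambda>s i \<and> (\<forall>y'. adj y y' \<longrightarrow> y' \<in> \<Lambda>s i)"
  shows "card (interstitial c n \<Lambda> \<Lambda>s I) \<le> num_neighbours TYPE('d) * card B"
proof -
  have "card (interstitial c n \<Lambda> \<Lambda>s I) \<le> card (\<Union>y\<in>B. (\<lambda>y'. {y, y'}) ` {y'. adj y y'})"
    using neighbours(1) assms(2) by (intro card_mono interstitial_subset_incident assms) auto
  also have "\<dots> \<le> (\<Sum>y\<in>B. card ((\<lambda>y'. {y, y'}) ` {y'. adj y y'}))"
    using assms(2) by (rule card_UN_le)
  also have "\<dots> \<le> (\<Sum>y\<in>B. num_neighbours TYPE('d))"
    by (intro sum_mono) (metis card_image_le neighbours)
  finally show ?thesis by (simp add: mult.commute)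
qed

lemma frame_box_subset_frame_box:
  fixes u u' :: "nat \<Rightarrow> real ^ 'd" and a a' :: real
  assumes u: "orthonormal_basis u" and u': "orthonormal_basis u'" and same: "u' CARD('d) = u CARD('d)"
    and c: "c \<bullet> u CARD('d) = 0" "\<And>k. k \<in> {1..CARD('d) - 1} \<Longrightarrow> \<bar>c \<bullet> u k\<bar> + CARD('d) * a' < a"
    and a': "a' \<ge> 0"
  shows "frame_box u' c a' h \<subseteq> frame_box u 0 a h"
proof
  let ?d = "CARD('d)" let ?K = "{1..?d - 1}"
  fix w assume w: "w \<in> frame_box u' c a' h"
  have "\<bar>w \<bullet> u k\<bar> < a" if k: "k \<in> ?K" for k
  proof -
    have "\<bar>(w - c) \<bullet> u' j\<bar> \<le> a'" if "j \<in> ?K" for j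
      using w that unfolding frame_box_def by (blast intro: less_imp_le)
    then have "\<bar>(w - c) \<bullet> u k\<bar> \<le> ?d * a'"
      using a' k by (intro frame_change_bound[OF u u' same])
    then show ?thesis using c(2)[OF k] by (simp add: inner_diff_left)
  qed
  moreover have "\<bar>w \<bullet> u ?d\<bar> < h" using w c(1) same by (simp add: frame_box_def inner_diff_left)
  ultimately show "w \<in> frame_box u 0 a h" by (simp add: frame_box_def)
qed

lemma grid_boxes_disjoint:
  fixes u :: "nat \<Rightarrow> real ^ 'd" and a r h :: real
  assumes u: "orthonormal_basis u" and r: "r \<le> a / 2" "a > 0"
    and c: "c \<in> grid u a" "c' \<in> grid u a" "c \<noteq> c'"
  shows "frame_box u c r h \<inter> frame_box u c' r h = {}"
proof -
  obtain k where k: "k \<in> {1..CARD('d) - 1}" "\<bar>(c - c') \<bullet> u k\<bar> \<ge> a"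
    using grid_separated[OF u r(2) c] by blast
  have False if "w \<in> frame_box u c r h" "w \<in> frame_box u c' r h" for w
  proof -
    have "\<bar>(w - c) \<bullet> u k\<bar> < r" "\<bar>(w - c') \<bullet> u k\<bar> < r"
      using that k(1) unfolding frame_box_def by blast+
    then show False using k(2) r by (simp add: inner_diff_left)
  qed
  then show ?thesis by blast
qed

text \<open>Boxes centred at grid points are disjoint as long as their width does not exceed the mesh.\<close>

lemma sum_grid_boxes_le:
  fixes u u' :: "nat \<Rightarrow> real ^ 'd" and a r h :: real
  assumes u: "orthonormal_basis u" and u': "orthonormal_basis u'"
    and C: "finite C" "C \<subseteq> grid u' a" and r: "0 < r" "r \<le> a / 2" and h: "h > 0"
    and X: "X \<in> fmeasurable lborel" and sub: "\<And>c. c \<in> C \<Longrightarrow> frame_box u' c r h \<subseteq> X"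
  shows "(\<Union>c\<in>C. frame_box u' c r h) \<in> fmeasurable lborel"
    and "measure lborel (\<Union>c\<in>C. frame_box u' c r h) = card C * ((2 * r) ^ (CARD('d) - 1) * (2 * h))"
    and "card C * ((2 * r) ^ (CARD('d) - 1) * (2 * h)) \<le> measure lborel X"
proof -
  show fU: "(\<Union>c\<in>C. frame_box u' c r h) \<in> fmeasurable lborel"
    using fmeasurable_frame_box[OF u' r(1) h] C(1) by (intro fmeasurable.finite_UN) auto
  have "measure lborel (\<Union>c\<in>C. frame_box u' c r h) = (\<Sum>c\<in>C. measure lborel (frame_box u' c r h))"
  proof (rule measure_UNION'[OF C(1) fmeasurable_frame_box[OF u' r(1) h]])
    show "pairwise (\<lambda>c c'. disjnt (frame_box u' c r h) (frame_box u' c' r h)) C"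
      using C(2) r grid_boxes_disjoint[OF u' r(2)]
      by (intro pairwiseI) (simp add: disjnt_def subset_eq)
  qed
  then show eq: "measure lborel (\<Union>c\<in>C. frame_box u' c r h) = card C * ((2 * r) ^ (CARD('d) - 1) * (2 * h))"
    using measure_frame_box[OF u' r(1) h] by simp
  have "measure lborel (\<Union>c\<in>C. frame_box u' c r h) \<le> measure lborel X"
    using fU X sub by (intro measure_mono_fmeasurable UN_least) (auto dest: fmeasurableD)
  then show "card C * ((2 * r) ^ (CARD('d) - 1) * (2 * h)) \<le> measure lborel X" unfolding eq .
qed

text \<open>Tiles are placed at the lattice points \<open>lattice_floor c\<close> for the grid points \<open>c\<close> of mesh
\<open>a = L + 2 * d\<close> whose tangential coordinates are at most \<open>N / 2 - b\<close>. Rounding moves a centre by at most \<open>d\<close>,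
whence the mesh; the margin \<open>b\<close> keeps the tiles and their neighbours inside the large box.
All four estimates compare volumes of frame boxes: the tiles fit into the large box, the grid
cells around their centres almost cover it, and the balls around the lattice points
that are near the hyperplane and outside the cores of the tiles fit into the complement of the
slightly shrunk tiles.\<close>

lemma tiling:
  fixes u u' :: "nat \<Rightarrow> real ^ 'd" and L H N H' d b a :: real
  defines "d \<equiv> real CARD('d)"
  defines "b \<equiv> d + d * L / 2 + 2" and "a \<equiv> L + 2 * d"
  assumes u: "orthonormal_basis u" and u': "orthonormal_basis u'" and same: "u' CARD('d) = u CARD('d)"
    and L: "L > 2 * d + 4" and H': "H' > 2 * d + 2" and H: "H > H' + d + 1" and N: "N > 2 * b + d * a"
  shows "\<exists>Z. finite Z \<and> disjoint_family_on (\<lambda>z. tile u' (lat z) L H') Z \<and>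
    (\<forall>z\<in>Z. \<bar>lat z \<bullet> u CARD('d)\<bar> \<le> d) \<and>
    (\<forall>z\<in>Z. tile u' (lat z) L H' \<subseteq> tile u 0 N H) \<and>
    (\<forall>z\<in>Z. \<forall>y\<in>tile u' (lat z) L H'. \<forall>y'. adj y y' \<longrightarrow> y' \<in> tile u 0 N H) \<and>
    card Z * L ^ (CARD('d) - 1) \<le> N ^ (CARD('d) - 1) \<and>
    (N - 2 * b - d * a) ^ (CARD('d) - 1) \<le> card Z * (a + 1) ^ (CARD('d) - 1) \<and>
    card (interstitial (d + 1) (u CARD('d)) (tile u 0 N H) (\<lambda>z. tile u' (lat z) L H') Z) *
        measure lborel (ball (0 :: real ^ 'd) (1/2))
      \<le> num_neighbours TYPE('d) *
        (((N + 2) ^ (CARD('d) - 1) - card Z * (L - 2 * d - 4) ^ (CARD('d) - 1)) * (2 * (d + 2)))"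
proof -
  define K where "K = {1..CARD('d) - 1}"
  define n where "n = u CARD('d)"
  define C where "C = {c \<in> grid u' a. \<forall>k\<in>K. \<bar>c \<bullet> u k\<bar> \<le> N / 2 - b}"
  define T where "T = (\<lambda>z. tile u' (lat z) L H')"
  define fl :: "real ^ 'd \<Rightarrow> int ^ 'd" where "fl = lattice_floor"
  have d1: "d \<ge> 1" using zero_less_card_finite[where 'a = 'd] by (simp add: d_def Suc_leI del: zero_less_card_finite)
  have K: "K \<subseteq> {1..CARD('d)}" "CARD('d) \<in> {1..CARD('d)}"
    using atLeastAtMost_insert_last[where 'd = 'd] by (auto simp: K_def)
  have KD: "k \<in> {1..CARD('d)}" if "k \<in> K" for k using K(1) that by blast
  have a0: "a > 0" using L d1 by (simp add: a_def)
  have Npos: "N > 0"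
  proof -
    have "0 \<le> d * L / 2" "0 \<le> d * a" using d1 L a0 by simp_all
    moreover from this have "b \<ge> 0" using d1 unfolding b_def by linarith
    ultimately show ?thesis using N by linarith
  qed
  have n1: "norm n = 1" unfolding n_def using K(2) by (rule orthonormal_basis_norm[OF u])
  have n'[simp]: "u' CARD('d) = n" by (simp add: n_def same)
  have Cg: "C \<subseteq> grid u' a" by (auto simp: C_def)
  have Cn: "c \<bullet> n = 0" if "c \<in> C" for c
    using grid_inner(1)[OF u', of c a] that Cg by auto
  have Cb: "\<bar>c \<bullet> u k\<bar> \<le> N / 2 - b" if "c \<in> C" "k \<in> K" for c k using that by (simp add: C_def)
  have fl: "norm (lat (fl c) - c) \<le> d" for c using norm_lattice_floor[of c] by (simp add: fl_def d_def)
  have flu: "\<bar>lat (fl c) \<bullet> u k - c \<bullet> u k\<bar> \<le> d" "\<bar>lat (fl c) \<bullet> u' k - c \<bullet> u' k\<bar> \<le> d"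
    if "k \<in> {1..CARD('d)}" for c k
    using orthonormal_basis_inner_le[OF u that, of "lat (fl c) - c"]
      orthonormal_basis_inner_le[OF u' that, of "lat (fl c) - c"] fl[of c]
    by (simp_all add: inner_diff_left)
  have zn: "\<bar>lat (fl c) \<bullet> n\<bar> \<le> d" if "c \<in> C" for c
    using flu(1)[OF K(2), of c] Cn[OF that] by (simp add: n_def)
  have T_iff: "y \<in> T z \<longleftrightarrow> (\<forall>k\<in>K. \<bar>(lat y - lat z) \<bullet> u' k\<bar> < L / 2) \<and> \<bar>(lat y - lat z) \<bullet> n\<bar> < H'" for y z
    by (simp add: T_def tile_def frame_box_def K_def)
  have big_iff: "y \<in> tile u 0 N H \<longleftrightarrow> (\<forall>k\<in>K. \<bar>lat y \<bullet> u k\<bar> < N / 2) \<and> \<bar>lat y \<bullet> n\<bar> < H" for y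
    by (simp add: tile_def frame_box_def K_def n_def)
  have apart: False if c: "c \<in> C" "c' \<in> C" "c \<noteq> c'" and y: "y \<in> T (fl c)" "y \<in> T (fl c')" for c c' y
  proof -
    obtain k where k: "k \<in> K" "\<bar>(c - c') \<bullet> u' k\<bar> \<ge> a"
      using grid_separated[OF u' a0, of c c'] c Cg unfolding K_def by blast
    have "\<bar>(lat y - lat (fl c)) \<bullet> u' k\<bar> < L / 2" "\<bar>(lat y - lat (fl c')) \<bullet> u' k\<bar> < L / 2"
      using y k(1) by (auto simp: T_iff)
    then show False
      using k(2) flu(2)[OF KD[OF k(1)], of c] flu(2)[OF KD[OF k(1)], of c']
      unfolding inner_diff_left a_def by linarith
  qed
  have self: "fl c \<in> T (fl c)" for c using L H' d1 by (simp add: T_iff)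
  have inj: "inj_on fl C" using apart self by (intro inj_onI) metis
  have near: "\<bar>lat y \<bullet> u k\<bar> \<le> N / 2 - 2" if c: "c \<in> C" and y: "y \<in> T (fl c)" and k: "k \<in> K" for c y k
  proof -
    have "\<bar>(lat y - lat (fl c)) \<bullet> u k\<bar> \<le> CARD('d) * (L / 2)"
    proof (rule frame_change_bound[OF u u' same])
      show "\<bar>(lat y - lat (fl c)) \<bullet> u' j\<bar> \<le> L / 2" if "j \<in> {1..CARD('d) - 1}" for j
        using y that by (auto simp: T_iff K_def intro: less_imp_le)
    qed (use L d1 k in \<open>auto simp: K_def\<close>)
    then show ?thesis
      using Cb[OF c k] flu(1)[OF KD[OF k], of c] unfolding inner_diff_left b_def d_def by linarith
  qed
  have near_n: "\<bar>lat y \<bullet> n\<bar> < H' + d" if c: "c \<in> C" and y: "y \<in> T (fl c)" for c y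
  proof -
    have "\<bar>(lat y - lat (fl c)) \<bullet> n\<bar> < H'" using y unfolding T_iff by blast
    then show ?thesis using zn[OF c] unfolding inner_diff_left by linarith
  qed
  have sub: "T (fl c) \<subseteq> tile u 0 N H" if "c \<in> C" for c
  proof
    fix y assume y: "y \<in> T (fl c)"
    show "y \<in> tile u 0 N H"
      unfolding big_iff
    proof (intro conjI ballI)
      show "\<bar>lat y \<bullet> u k\<bar> < N / 2" if "k \<in> K" for k using near[OF \<open>c \<in> C\<close> y that] by linarith
      show "\<bar>lat y \<bullet> n\<bar> < H" using near_n[OF that y] H by linarith
    qed
  qed
  have step: "\<bar>lat y' \<bullet> v - lat y \<bullet> v\<bar> \<le> 1" if "adj y y'" "norm v = 1" for y y' v
    using adj_height[OF that] by (simp add: abs_minus_commute)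
  have nbr: "y' \<in> tile u 0 N H" if c: "c \<in> C" and y: "y \<in> T (fl c)" and adj: "adj y y'" for c y y'
    unfolding big_iff
  proof (intro conjI ballI)
    fix k assume k: "k \<in> K"
    then have "norm (u k) = 1" by (intro orthonormal_basis_norm[OF u] KD)
    then show "\<bar>lat y' \<bullet> u k\<bar> < N / 2" using step[OF adj] near[OF c y k] by (smt (verit, best))
  next
    show "\<bar>lat y' \<bullet> n\<bar> < H" using step[OF adj n1] near_n[OF c y] H by linarith
  qed
  have finC: "finite C"
  proof (rule finite_imageD[OF _ inj])
    show "finite (fl ` C)"
      by (rule finite_subset[OF _ finite_tile[OF u, of 0 N H]]) (use self sub in blast)
  qed
  have pw: "(2 * (x / 2)) = x" for x :: real by simp
  have upper: "card C * L ^ (CARD('d) - 1) \<le> N ^ (CARD('d) - 1)"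
  proof -
    have "card C * ((2 * (L / 2)) ^ (CARD('d) - 1) * (2 * 1)) \<le> measure lborel (frame_box u 0 (N / 2) 1)"
    proof (rule sum_grid_boxes_le(3)[OF u u' finC Cg])
      show "frame_box u 0 (N / 2) 1 \<in> fmeasurable lborel"
        using Npos by (intro fmeasurable_frame_box u) auto
      show "frame_box u' c (L / 2) 1 \<subseteq> frame_box u 0 (N / 2) 1" if "c \<in> C" for c
      proof (rule frame_box_subset_frame_box[OF u u' same])
        show "\<bar>c \<bullet> u k\<bar> + CARD('d) * (L / 2) < N / 2" if "k \<in> {1..CARD('d) - 1}" for k
          using Cb[OF \<open>c \<in> C\<close>, of k] that d1 by (simp add: b_def d_def K_def)
      qed (use Cn[OF that] L d1 in \<open>auto simp: n_def\<close>)
    qed (use L d1 in \<open>auto simp: a_def\<close>)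
    also have "\<dots> = (2 * (N / 2)) ^ (CARD('d) - 1) * (2 * 1)"
      using Npos by (intro measure_frame_box[OF u]) auto
    finally show ?thesis by simp
  qed
  \<comment> \<open>The closed grid cells cover; they are enlarged by \<open>1\<close> to fit into open boxes.\<close>
  have lower: "(N - 2 * b - d * a) ^ (CARD('d) - 1) \<le> card C * (a + 1) ^ (CARD('d) - 1)"
  proof -
    let ?r = "N / 2 - b - d * a / 2"
    have fm: "frame_box u' c ((a + 1) / 2) 1 \<in> fmeasurable lborel" for c
      using a0 by (intro fmeasurable_frame_box u') auto
    have "frame_box u 0 ?r 1 \<subseteq> (\<Union>c\<in>C. frame_box u' c ((a + 1) / 2) 1)"
    proof
      fix w assume w: "w \<in> frame_box u 0 ?r 1"
      obtain c where c: "c \<in> grid u' a" "\<forall>k\<in>K. \<bar>(w - c) \<bullet> u' k\<bar> \<le> a / 2"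
        using grid_near[OF u' a0] unfolding K_def by blast
      have "\<bar>c \<bullet> u k\<bar> \<le> N / 2 - b" if k: "k \<in> K" for k
      proof -
        have "\<bar>(w - c) \<bullet> u k\<bar> \<le> CARD('d) * (a / 2)"
          by (rule frame_change_bound[OF u u' same]) (use c(2) a0 k in \<open>auto simp: K_def\<close>)
        moreover have "\<bar>w \<bullet> u k\<bar> < ?r" using w k by (simp add: frame_box_def K_def)
        moreover have "CARD('d) * (a / 2) = d * a / 2" by (simp add: d_def)
        ultimately show ?thesis unfolding inner_diff_left by linarith
      qed
      then have "c \<in> C" using c(1) by (simp add: C_def)
      moreover have "w \<in> frame_box u' c ((a + 1) / 2) 1"
        using c(2) w Cn[OF \<open>c \<in> C\<close>] by (fastforce simp: frame_box_def K_def inner_diff_left same n_def)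
      ultimately show "w \<in> (\<Union>c\<in>C. frame_box u' c ((a + 1) / 2) 1)" by blast
    qed
    then have "measure lborel (frame_box u 0 ?r 1) \<le> measure lborel (\<Union>c\<in>C. frame_box u' c ((a + 1) / 2) 1)"
      using fm finC by (intro measure_mono_fmeasurable fmeasurable.finite_UN) (auto intro!: borel_open open_frame_box)
    also have "\<dots> \<le> (\<Sum>c\<in>C. measure lborel (frame_box u' c ((a + 1) / 2) 1))"
      using fm finC by (intro measure_UNION_le) (auto intro: borel_open open_frame_box)
    also have "\<dots> = card C * ((2 * ((a + 1) / 2)) ^ (CARD('d) - 1) * (2 * 1))"
      using a0 by (subst measure_frame_box[OF u']) auto
    also have "measure lborel (frame_box u 0 ?r 1) = (2 * ?r) ^ (CARD('d) - 1) * (2 * 1)"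
      by (rule measure_frame_box[OF u]) (use N in auto)
    finally have "(2 * ?r) ^ (CARD('d) - 1) \<le> card C * (2 * ((a + 1) / 2)) ^ (CARD('d) - 1)" by simp
    moreover have "2 * ?r = N - 2 * b - d * a" by (simp add: algebra_simps)
    ultimately show ?thesis unfolding pw by simp
  qed
  \<comment> \<open>Every interstitial edge has an endpoint in \<open>B\<close>: a vertex with all tangential coordinates relative
    to some tile below \<open>L / 2 - 1\<close> has its neighbours in that tile.\<close>
  define B where "B = {y \<in> tile u 0 N H. \<bar>lat y \<bullet> n\<bar> \<le> d + 1 \<and>
    (\<forall>c\<in>C. \<exists>k\<in>K. \<bar>(lat y - lat (fl c)) \<bullet> u' k\<bar> \<ge> L / 2 - 1)}"
  have finB: "finite B" using finite_tile[OF u, of 0 N H] by (auto simp: B_def)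
  have card_F: "card (interstitial (d + 1) n (tile u 0 N H) T (fl ` C)) \<le> num_neighbours TYPE('d) * card B"
  proof (rule card_interstitial_le[OF n1 finB])
    fix y assume y: "y \<in> tile u 0 N H - B" and slab: "\<bar>lat y \<bullet> n\<bar> \<le> d + 1"
    then obtain c where c: "c \<in> C" "\<And>k. k \<in> K \<Longrightarrow> \<bar>(lat y - lat (fl c)) \<bullet> u' k\<bar> < L / 2 - 1"
      unfolding B_def by (auto simp: not_le)
    have h: "\<bar>(lat y - lat (fl c)) \<bullet> n\<bar> \<le> 2 * d + 1" using slab zn[OF c(1)] by (simp add: inner_diff_left)
    have "y \<in> T (fl c)"
      unfolding T_iff
    proof (intro conjI ballI)
      show "\<bar>(lat y - lat (fl c)) \<bullet> u' k\<bar> < L / 2" if "k \<in> K" for k using c(2)[OF that] by linarith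
      show "\<bar>(lat y - lat (fl c)) \<bullet> n\<bar> < H'" using h H' by linarith
    qed
    moreover have "y' \<in> T (fl c)" if adj: "adj y y'" for y'
      unfolding T_iff
    proof (intro conjI ballI)
      fix k assume k: "k \<in> K"
      then have "norm (u' k) = 1" by (intro orthonormal_basis_norm[OF u'] KD)
      from step[OF adj this] show "\<bar>(lat y' - lat (fl c)) \<bullet> u' k\<bar> < L / 2"
        using c(2)[OF k] unfolding inner_diff_left by linarith
    next
      show "\<bar>(lat y' - lat (fl c)) \<bullet> n\<bar> < H'"
        using step[OF adj n1] h H' unfolding inner_diff_left by linarith
    qed
    ultimately show "\<exists>i\<in>fl ` C. y \<in> T i \<and> (\<forall>y'. adj y y' \<longrightarrow> y' \<in> T i)" using c(1) by blast
  qed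
  let ?W = "frame_box u 0 (N / 2 + 1) (d + 2)"
  let ?U = "\<Union>c\<in>C. frame_box u' c (L / 2 - d - 2) (d + 2)"
  have N0: "N / 2 + 1 > 0" using Npos by simp
  have fW: "?W \<in> fmeasurable lborel" using N0 d1 by (intro fmeasurable_frame_box u) auto
  have subW: "frame_box u' c (L / 2 - d - 2) (d + 2) \<subseteq> ?W" if "c \<in> C" for c
  proof (rule frame_box_subset_frame_box[OF u u' same])
    have le: "CARD('d) * (L / 2 - d - 2) \<le> d * L / 2" using d1 by (simp add: d_def algebra_simps)
    show "\<bar>c \<bullet> u k\<bar> + CARD('d) * (L / 2 - d - 2) < N / 2 + 1" if "k \<in> {1..CARD('d) - 1}" for k
      using Cb[OF \<open>c \<in> C\<close>, of k] that le d1 unfolding b_def K_def by auto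
  qed (use Cn[OF that] L in \<open>auto simp: n_def\<close>)
  have r: "0 < L / 2 - d - 2" "L / 2 - d - 2 \<le> a / 2" "0 < d + 2" using L d1 by (auto simp: a_def)
  have boxU: "measure lborel ?U = card C * ((2 * (L / 2 - d - 2)) ^ (CARD('d) - 1) * (2 * (d + 2)))"
    by (rule sum_grid_boxes_le(2)[OF u u' finC Cg r fW subW])
  have fU: "?U \<in> fmeasurable lborel"
    by (rule sum_grid_boxes_le(1)[OF u u' finC Cg r fW subW])
  have card_B: "card B * measure lborel (ball (0 :: real ^ 'd) (1/2)) \<le> measure lborel (?W - ?U)"
  proof (rule card_lattice_points_le[OF finB])
    show "?W - ?U \<in> fmeasurable lborel" using fW fU by (intro fmeasurable_Diff) (auto dest: fmeasurableD)
    fix y assume y: "y \<in> B"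
    show "ball (lat y) (1/2) \<subseteq> ?W - ?U"
    proof
      fix w assume "w \<in> ball (lat y) (1/2)"
      then have dw: "norm (w - lat y) < 1 / 2" by (simp add: dist_norm norm_minus_commute)
      have cl: "\<bar>w \<bullet> u k - lat y \<bullet> u k\<bar> < 1 / 2" "\<bar>w \<bullet> u' k - lat y \<bullet> u' k\<bar> < 1 / 2" if "k \<in> {1..CARD('d)}" for k
        using orthonormal_basis_inner_le[OF u that, of "w - lat y"]
          orthonormal_basis_inner_le[OF u' that, of "w - lat y"] dw
        by (simp_all add: inner_diff_left)
      have "w \<in> ?W"
      proof -
        have "\<bar>w \<bullet> u k\<bar> < N / 2 + 1" if "k \<in> K" for k
        proof -
          have "\<bar>lat y \<bullet> u k\<bar> < N / 2" using y that by (simp add: B_def big_iff)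
          then show ?thesis using cl(1)[OF KD[OF that]] by linarith
        qed
        moreover have "\<bar>w \<bullet> n\<bar> < d + 2"
        proof -
          have "\<bar>lat y \<bullet> n\<bar> \<le> d + 1" using y by (simp add: B_def)
          then show ?thesis using cl(1)[OF K(2)] unfolding n_def by linarith
        qed
        ultimately show ?thesis by (simp add: frame_box_def K_def n_def)
      qed
      moreover have "w \<notin> frame_box u' c (L / 2 - d - 2) (d + 2)" if c: "c \<in> C" for c
      proof
        assume w: "w \<in> frame_box u' c (L / 2 - d - 2) (d + 2)"
        obtain k where k: "k \<in> K" "\<bar>(lat y - lat (fl c)) \<bullet> u' k\<bar> \<ge> L / 2 - 1" using y c by (auto simp: B_def)
        have "\<bar>(w - c) \<bullet> u' k\<bar> < L / 2 - d - 2" using w k(1) unfolding frame_box_def K_def by blast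
        then show False
          using k(2) cl(2)[OF KD[OF k(1)]] flu(2)[OF KD[OF k(1)], of c] unfolding inner_diff_left by linarith
      qed
      ultimately show "w \<in> ?W - ?U" by blast
    qed
  qed
  have "measure lborel (?W - ?U) = measure lborel ?W - measure lborel ?U"
    by (rule measurable_measure_Diff[OF fW]) (use fU subW in \<open>auto dest: fmeasurableD\<close>)
  also have "\<dots> = (2 * (N / 2 + 1)) ^ (CARD('d) - 1) * (2 * (d + 2)) -
      card C * ((2 * (L / 2 - d - 2)) ^ (CARD('d) - 1) * (2 * (d + 2)))"
    using boxU measure_frame_box[OF u N0 r(3), of 0] by (simp only:)
  also have "\<dots> = ((N + 2) ^ (CARD('d) - 1) - card C * (L - 2 * d - 4) ^ (CARD('d) - 1)) * (2 * (d + 2))"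
  proof -
    have "2 * (N / 2 + 1) = N + 2" "2 * (L / 2 - d - 2) = L - 2 * d - 4" by simp_all
    then show ?thesis by (simp only: left_diff_distrib mult.assoc)
  qed
  finally have vol: "measure lborel (?W - ?U) =
    ((N + 2) ^ (CARD('d) - 1) - card C * (L - 2 * d - 4) ^ (CARD('d) - 1)) * (2 * (d + 2))" .
  have final: "card (interstitial (d + 1) n (tile u 0 N H) T (fl ` C)) * measure lborel (ball (0 :: real ^ 'd) (1/2))
      \<le> num_neighbours TYPE('d) *
        (((N + 2) ^ (CARD('d) - 1) - card C * (L - 2 * d - 4) ^ (CARD('d) - 1)) * (2 * (d + 2)))"
  proof -
    let ?v = "measure lborel (ball (0 :: real ^ 'd) (1/2))"
    have "card (interstitial (d + 1) n (tile u 0 N H) T (fl ` C)) * ?v \<le> (num_neighbours TYPE('d) * card B) * ?v"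
      using card_F by (intro mult_right_mono) (simp_all only: of_nat_mult[symmetric] of_nat_le_iff measure_nonneg)
    also have "\<dots> = num_neighbours TYPE('d) * (card B * ?v)" by simp
    also have "\<dots> \<le> num_neighbours TYPE('d) * measure lborel (?W - ?U)"
      using card_B by (intro mult_left_mono) auto
    finally show ?thesis unfolding vol .
  qed
  have cardZ: "card (fl ` C) = card C" using inj by (rule card_image)
  show ?thesis
  proof (intro exI[of _ "fl ` C"] conjI)
    show "disjoint_family_on (\<lambda>z. tile u' (lat z) L H') (fl ` C)"
      using apart unfolding disjoint_family_on_def T_def by blast
  qed (use finC zn sub nbr upper lower final in \<open>auto simp: cardZ T_def n_def\<close>)
qed

section \<open>Approximate subadditivity of the surface tension\<close>

lemma unit_cubes_iff:
  fixes n :: "real ^ 'd"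
  shows "S \<in> unit_cubes n \<longleftrightarrow> (\<exists>u. orthonormal_basis u \<and> u CARD('d) = n \<and> S = cube u)"
  unfolding unit_cubes_def cube_def by blast

lemma eventually_real_gt: "\<forall>\<^sub>F N in sequentially. real N > c"
  using filterlim_real_sequentially unfolding filterlim_at_top_dense by blast

text \<open>For fixed \<open>L\<close> and large \<open>N\<close> the tiles cover a fraction at least about \<open>\<rho> L\<close> of the middle section, and
the interstitial edges number at most a constant times \<open>(1 - \<sigma> L) * N ^ D\<close>; both \<open>\<rho> L\<close> and \<open>\<sigma> L\<close>
tend to \<open>1\<close> as \<open>L\<close> grows.\<close>

lemma tau_tiling:
  fixes n :: "real ^ 'd" and \<delta> \<delta>' \<epsilon> :: real
  assumes \<beta>: "\<beta> \<ge> 0" and q: "q \<ge> 1" and n: "norm n = 1"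
    and S: "S \<in> unit_cubes n" "S' \<in> unit_cubes n"
    and \<delta>: "\<delta> > 0" "\<delta>' > 0" and \<epsilon>: "\<epsilon> > 0"
  defines "D \<equiv> CARD('d) - 1"
  shows "\<forall>\<^sub>F L in sequentially. \<forall>\<^sub>F N in sequentially. \<exists>Z :: (int ^ 'd) set.
    finite Z \<and>
    disjoint_family_on (\<lambda>z. discretize (box_R (lat z) (real L) (\<delta>' * real L) S' n)) Z \<and>
    card Z * real L ^ D \<le> real N ^ D \<and>
    (1 - \<epsilon>) * real N ^ D \<le> card Z * real L ^ D \<and>
    (\<forall>J. (\<forall>e\<in>edges UNIV. J e \<in> {0..1}) \<longrightarrow>
      tau_J q \<beta> J 0 (real N) (\<delta> * real N) S n \<le>
        (real L / real N) ^ D * (\<Sum>z\<in>Z. tau_J q \<beta> J (lat z) (real L) (\<delta>' * real L) S' n) + \<epsilon>)"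
    (is "\<forall>\<^sub>F L in sequentially. \<forall>\<^sub>F N in sequentially. ?P L N")
proof -
  define d where "d = real CARD('d)"
  obtain u u' where u: "orthonormal_basis u" "u CARD('d) = n" "S = cube u"
    and u': "orthonormal_basis u'" "u' CARD('d) = n" "S' = cube u'"
    using S unfolding unit_cubes_iff by blast
  define v where "v = measure lborel (ball (0 :: real ^ 'd) (1/2))"
  have v: "v > 0" unfolding v_def by (rule content_ball_pos) simp
  define M where "M = \<beta> * num_neighbours TYPE('d) * (2 * (d + 2)) / v"
  have d0: "d \<ge> 0" by (simp add: d_def)
  have M: "M \<ge> 0" unfolding M_def using \<beta> v d0 by simp
  define \<rho> where "\<rho> = (\<lambda>L::nat. (real L / (real L + (2 * d + 1))) ^ D)"
  define \<sigma> where "\<sigma> = (\<lambda>L::nat. ((real L - (2 * d + 4)) / (real L + (2 * d + 1))) ^ D)"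
  define b where "b = (\<lambda>L::nat. 2 * (d + d * real L / 2 + 2) + d * (real L + 2 * d))"
  have lim1: "(\<lambda>L. (real L - c) / (real L + c')) \<longlonglongrightarrow> 1" for c c' :: real by real_asymp
  have "\<rho> \<longlonglongrightarrow> 1 ^ D" unfolding \<rho>_def using lim1[of 0 "2 * d + 1"] by (intro tendsto_power) simp
  then have "\<forall>\<^sub>F L in sequentially. \<rho> L > 1 - \<epsilon>" using \<epsilon> by (intro order_tendstoD(1)[of _ 1]) auto
  moreover have "\<forall>\<^sub>F L in sequentially. M * (1 - \<sigma> L) < \<epsilon>"
  proof -
    have "(\<lambda>L. M * (1 - \<sigma> L)) \<longlonglongrightarrow> M * (1 - 1 ^ D)"
      unfolding \<sigma>_def by (intro tendsto_intros lim1)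
    then show ?thesis using \<epsilon> by (intro order_tendstoD(2)[of _ 0]) auto
  qed
  moreover have "\<forall>\<^sub>F L in sequentially. real L > 2 * d + 4" by (rule eventually_real_gt)
  moreover have "\<forall>\<^sub>F L in sequentially. real L > (2 * d + 2) / \<delta>'" by (rule eventually_real_gt)
  ultimately show ?thesis
  proof eventually_elim
    fix L :: nat
    assume L\<rho>: "\<rho> L > 1 - \<epsilon>" and L\<sigma>: "M * (1 - \<sigma> L) < \<epsilon>" and Ld: "real L > 2 * d + 4"
      and L\<delta>: "real L > (2 * d + 2) / \<delta>'"
    have L0: "real L > 0" using Ld d0 by linarith
    have H': "\<delta>' * real L > 2 * d + 2" using L\<delta> \<delta>(2) by (simp add: field_simps)
    have lim2: "(\<lambda>N. (1 - b L / real N) ^ D * s) \<longlonglongrightarrow> (1 - 0) ^ D * s" for s :: real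
      by (intro tendsto_intros lim_const_over_n)
    have "\<forall>\<^sub>F N in sequentially. (1 - b L / real N) ^ D * \<rho> L > 1 - \<epsilon>"
      using lim2[of "\<rho> L"] L\<rho> by (intro order_tendstoD(1)[of _ "\<rho> L"]) auto
    moreover have "\<forall>\<^sub>F N in sequentially. M * ((1 + 2 / real N) ^ D - (1 - b L / real N) ^ D * \<sigma> L) < \<epsilon>"
    proof -
      have "(\<lambda>N. M * ((1 + 2 / real N) ^ D - (1 - b L / real N) ^ D * \<sigma> L)) \<longlonglongrightarrow>
          M * ((1 + 0) ^ D - (1 - 0) ^ D * \<sigma> L)"
        by (intro tendsto_intros lim_const_over_n)
      then show ?thesis using L\<sigma> by (intro order_tendstoD(2)[of _ "M * (1 - \<sigma> L)"]) auto
    qed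
    moreover have "\<forall>\<^sub>F N in sequentially. real N > (\<delta>' * real L + d + 1) / \<delta>" by (rule eventually_real_gt)
    moreover have "\<forall>\<^sub>F N in sequentially. real N > b L" by (rule eventually_real_gt)
    moreover have "\<forall>\<^sub>F N in sequentially. real N > 0" by (rule eventually_real_gt)
    ultimately show "\<forall>\<^sub>F N in sequentially. ?P L N"
    proof eventually_elim
      fix N :: nat
      assume N\<rho>: "(1 - b L / real N) ^ D * \<rho> L > 1 - \<epsilon>"
        and N\<sigma>: "M * ((1 + 2 / real N) ^ D - (1 - b L / real N) ^ D * \<sigma> L) < \<epsilon>"
        and N\<delta>: "real N > (\<delta>' * real L + d + 1) / \<delta>" and Nb: "real N > b L" and N0: "real N > 0"
      have H: "\<delta> * real N > \<delta>' * real L + d + 1" using N\<delta> \<delta>(1) by (simp add: field_simps)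
      let ?T = "\<lambda>z. tile u' (lat z) (real L) (\<delta>' * real L)" and ?\<Lambda> = "tile u 0 (real N) (\<delta> * real N)"
      obtain Z :: "(int ^ 'd) set" where Z: "finite Z" "disjoint_family_on ?T Z"
        "\<And>z. z \<in> Z \<Longrightarrow> \<bar>lat z \<bullet> n\<bar> \<le> d"
        "\<And>z. z \<in> Z \<Longrightarrow> ?T z \<subseteq> ?\<Lambda>"
        "\<And>z y y'. z \<in> Z \<Longrightarrow> y \<in> ?T z \<Longrightarrow> adj y y' \<Longrightarrow> y' \<in> ?\<Lambda>"
        and upper: "card Z * real L ^ D \<le> real N ^ D"
        and lower: "(real N - b L) ^ D \<le> card Z * (real L + (2 * d + 1)) ^ D"
        and inter: "card (interstitial (d + 1) n ?\<Lambda> ?T Z) * v \<le> num_neighbours TYPE('d) *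
          (((real N + 2) ^ D - card Z * (real L - (2 * d + 4)) ^ D) * (2 * (d + 2)))"
        using tiling[OF u(1) u'(1), where L = "real L" and H' = "\<delta>' * real L" and H = "\<delta> * real N" and N = "real N"]
          u'(2)
          Ld H' H Nb unfolding d_def[symmetric] b_def D_def[symmetric] v_def[symmetric] u(2)
        by (auto simp: algebra_simps)
      have pos: "real L + (2 * d + 1) > 0" using L0 d0 by linarith
      have low: "(1 - b L / real N) ^ D * (s / (real L + (2 * d + 1))) ^ D * real N ^ D \<le> card Z * s ^ D"
        if s: "s \<ge> 0" for s :: real
      proof -
        have "(1 - b L / real N) ^ D * real N ^ D = (real N - b L) ^ D"
          using N0 by (simp add: power_mult_distrib[symmetric] left_diff_distrib)
        then have "(1 - b L / real N) ^ D * (s / (real L + (2 * d + 1))) ^ D * real N ^ D =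
            (real N - b L) ^ D * (s / (real L + (2 * d + 1))) ^ D" by (simp add: mult_ac)
        also have "\<dots> \<le> (card Z * (real L + (2 * d + 1)) ^ D) * (s / (real L + (2 * d + 1))) ^ D"
          using lower s pos by (intro mult_right_mono) auto
        also have "\<dots> = card Z * s ^ D" using pos by (simp add: power_divide)
        finally show ?thesis .
      qed
      have card_low: "(1 - \<epsilon>) * real N ^ D \<le> card Z * real L ^ D"
      proof -
        have "(1 - \<epsilon>) * real N ^ D \<le> (1 - b L / real N) ^ D * \<rho> L * real N ^ D"
          using N\<rho> by (intro mult_right_mono) auto
        then show ?thesis using low[of "real L"] unfolding \<rho>_def by simp
      qed
      let ?F = "interstitial (d + 1) n ?\<Lambda> ?T Z"
      have closed: "\<beta> * card ?F \<le> \<epsilon> * real N ^ D"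
      proof -
        have "\<beta> * card ?F = \<beta> / v * (card ?F * v)" using v by simp
        also have "\<dots> \<le> \<beta> / v * (num_neighbours TYPE('d) *
          (((real N + 2) ^ D - card Z * (real L - (2 * d + 4)) ^ D) * (2 * (d + 2))))"
          using \<beta> v by (intro mult_left_mono inter) simp
        also have "\<dots> = M * ((real N + 2) ^ D - card Z * (real L - (2 * d + 4)) ^ D)"
          by (simp add: M_def)
        also have "\<dots> \<le> M * ((1 + 2 / real N) ^ D * real N ^ D - (1 - b L / real N) ^ D * \<sigma> L * real N ^ D)"
        proof (intro mult_left_mono[OF _ M] diff_mono)
          show "(real N + 2) ^ D \<le> (1 + 2 / real N) ^ D * real N ^ D"
            using N0 by (simp add: power_mult_distrib[symmetric] distrib_right)
          show "(1 - b L / real N) ^ D * \<sigma> L * real N ^ D \<le> card Z * (real L - (2 * d + 4)) ^ D"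
            using low[of "real L - (2 * d + 4)"] Ld unfolding \<sigma>_def by simp
        qed
        also have "\<dots> = M * ((1 + 2 / real N) ^ D - (1 - b L / real N) ^ D * \<sigma> L) * real N ^ D"
          by (simp add: algebra_simps)
        also have "\<dots> \<le> \<epsilon> * real N ^ D" using N\<sigma> by (intro mult_right_mono) auto
        finally show ?thesis .
      qed
      have disc: "discretize (box_R (lat z) (real L) (\<delta>' * real L) S' n) = ?T z"
        "discretize (box_R 0 (real N) (\<delta> * real N) S n) = ?\<Lambda>" for z
        using discretize_box_R[OF u'(1) L0] discretize_box_R[OF u(1) N0] unfolding u(2,3) u'(2,3) by auto
      have main: "tau_J q \<beta> J 0 (real N) (\<delta> * real N) S n \<le>
          (real L / real N) ^ D * (\<Sum>z\<in>Z. tau_J q \<beta> J (lat z) (real L) (\<delta>' * real L) S' n) + \<epsilon>"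
        if J: "\<forall>e\<in>edges UNIV. J e \<in> {0..1}" for J
      proof -
        have J0: "\<And>e V. e \<in> edges V \<Longrightarrow> J e \<ge> 0" using J edges_mono[OF subset_UNIV] by fastforce
        have t: "tau_J q \<beta> J (lat z) (real L) (\<delta>' * real L) S' n = free_energy q \<beta> J (lat z) n (?T z) / real L ^ D" for z
          using tau_J_free_energy[where J = J and x = "lat z" and L = "real L" and H = "\<delta>' * real L" and S = S' and n = n,
              OF \<beta> q J0]
            finite_tile[OF u'(1)] by (simp add: disc D_def)
        have T: "tau_J q \<beta> J 0 (real N) (\<delta> * real N) S n = free_energy q \<beta> J 0 n ?\<Lambda> / real N ^ D"
          using tau_J_free_energy[where J = J and x = 0 and L = "real N" and H = "\<delta> * real N" and S = S and n = n,
              OF \<beta> q J0]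
            finite_tile[OF u(1)] by (simp add: disc D_def)
        have "free_energy q \<beta> J 0 n ?\<Lambda> \<le> (\<Sum>z\<in>Z. free_energy q \<beta> J (lat z) n (?T z)) + \<beta> * card ?F"
          using J d0 by (intro free_energy_tiles[OF \<beta> q _ n finite_tile[OF u(1)] Z(1,2,4,5,3)]) auto
        also have "(\<Sum>z\<in>Z. free_energy q \<beta> J (lat z) n (?T z)) =
            real L ^ D * (\<Sum>z\<in>Z. tau_J q \<beta> J (lat z) (real L) (\<delta>' * real L) S' n)"
          using L0 by (simp add: t sum_distrib_left)
        finally have "free_energy q \<beta> J 0 n ?\<Lambda> \<le>
          real L ^ D * (\<Sum>z\<in>Z. tau_J q \<beta> J (lat z) (real L) (\<delta>' * real L) S' n) + \<epsilon> * real N ^ D"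
          using closed by linarith
        then show ?thesis unfolding T using N0 by (simp add: field_simps power_divide)
      qed
      show "?P L N"
        using Z(1,2) upper card_low main unfolding disc by blast
    qed
  qed
qed

section \<open>Processes bounded by averages of independent copies\<close>

text \<open>The form of Fekete's lemma suited to approximate subadditivity: every value taken infinitely often
by one sequence is, up to \<open>\<epsilon>\<close>, an eventual upper bound of all sequences. The limit is the infimum of
these bounds.\<close>

lemma eventually_sandwich_limit:
  fixes e :: "'s \<Rightarrow> nat \<Rightarrow> real"
  assumes ne: "Sh \<noteq> {}"
    and nonneg: "\<And>s. s \<in> Sh \<Longrightarrow> \<forall>\<^sub>F N in sequentially. e s N \<ge> 0"
    and sub: "\<And>s s' \<epsilon>. s \<in> Sh \<Longrightarrow> s' \<in> Sh \<Longrightarrow> \<epsilon> > 0 \<Longrightarrow>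
      \<forall>\<^sub>F L in sequentially. \<forall>\<^sub>F N in sequentially. e s N \<le> e s' L + \<epsilon>"
  shows "\<exists>t\<ge>0. \<forall>s\<in>Sh. e s \<longlonglongrightarrow> t"
proof -
  define R where "R = {r. \<forall>s\<in>Sh. \<forall>\<epsilon>>0. \<forall>\<^sub>F N in sequentially. e s N \<le> r + \<epsilon>}"
  have freq: "r \<in> R" if s': "s' \<in> Sh" and r: "\<exists>\<^sub>F L in sequentially. e s' L \<le> r" for s' r
    unfolding R_def
  proof (intro CollectI ballI allI impI)
    fix s and \<epsilon> :: real assume "s \<in> Sh" "\<epsilon> > 0"
    then have "\<exists>\<^sub>F L in sequentially. e s' L \<le> r \<and> (\<forall>\<^sub>F N in sequentially. e s N \<le> e s' L + \<epsilon>)"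
      by (intro frequently_eventually_frequently r sub s')
    then obtain L where L: "e s' L \<le> r" "\<forall>\<^sub>F N in sequentially. e s N \<le> e s' L + \<epsilon>"
      by (auto dest: frequently_ex)
    from L(2) show "\<forall>\<^sub>F N in sequentially. e s N \<le> r + \<epsilon>"
      by eventually_elim (use L(1) in linarith)
  qed
  obtain s0 where s0: "s0 \<in> Sh" using ne by blast
  have R_ne: "R \<noteq> {}"
  proof -
    obtain L where "\<forall>\<^sub>F N in sequentially. e s0 N \<le> e s0 L + 1"
      using eventually_happens[OF sub[OF s0 s0, of 1]] by auto
    then have "e s0 L + 1 \<in> R" by (intro freq[OF s0] eventually_frequently) auto
    then show ?thesis by blast
  qed
  have R_nn: "r \<ge> 0" if r: "r \<in> R" for r
  proof (rule field_le_epsilon)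
    fix \<epsilon> :: real assume "\<epsilon> > 0"
    then have "\<forall>\<^sub>F N in sequentially. e s0 N \<le> r + \<epsilon>" using r s0 by (simp add: R_def)
    then have "\<forall>\<^sub>F N in sequentially. 0 \<le> r + \<epsilon>" using nonneg[OF s0] by eventually_elim linarith
    then show "0 \<le> r + \<epsilon>" by simp
  qed
  then have bdd: "bdd_below R" by (intro bdd_belowI[of R 0])
  define t where "t = Inf R"
  have "e s \<longlonglongrightarrow> t" if s: "s \<in> Sh" for s
  proof (rule tendstoI)
    fix \<eta> :: real assume \<eta>: "\<eta> > 0"
    obtain r where r: "r \<in> R" "r < t + \<eta> / 2"
      using cInf_lessD[OF R_ne, of "t + \<eta> / 2"] \<eta> unfolding t_def by auto
    have "\<forall>\<^sub>F N in sequentially. e s N \<le> r + \<eta> / 2" using r(1) s \<eta> by (simp add: R_def)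
    moreover have "\<forall>\<^sub>F N in sequentially. e s N > t - \<eta>"
    proof (rule ccontr)
      assume "\<not> ?thesis"
      then have "\<exists>\<^sub>F N in sequentially. e s N \<le> t - \<eta>" by (simp add: not_eventually not_less)
      then have "t - \<eta> \<in> R" by (rule freq[OF s])
      then have "t \<le> t - \<eta>" unfolding t_def using bdd by (rule cInf_lower)
      then show False using \<eta> by simp
    qed
    ultimately show "\<forall>\<^sub>F N in sequentially. dist (e s N) t < \<eta>"
      by eventually_elim (use r(2) in \<open>simp add: dist_real_def\<close>)
  qed
  moreover have "t \<ge> 0" unfolding t_def using R_ne R_nn by (intro cInf_greatest) auto
  ultimately show ?thesis by blast
qed

text \<open>\<open>Z\<close> indexes independent tiles of side \<open>L\<close> that cover the box of side \<open>N\<close> up to a fraction \<open>\<epsilon>\<close>; \<open>Y\<close> gives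
their values and \<open>X\<close> the value of the box, which exceeds the average over the tiles by at most \<open>\<epsilon>\<close>. Areas are measured by powers of side lengths.\<close>

definition (in prob_space) tile_bound ::
    "nat \<Rightarrow> real \<Rightarrow> nat \<Rightarrow> nat \<Rightarrow> ('i \<Rightarrow> 'a \<Rightarrow> real) \<Rightarrow> ('a \<Rightarrow> real) \<Rightarrow> 'i set \<Rightarrow> bool" where
  "tile_bound D \<epsilon> L N Y X Z \<longleftrightarrow> finite Z \<and> indep_vars (\<lambda>_. borel) Y Z \<and>
    card Z * real L ^ D \<le> real N ^ D \<and> (1 - \<epsilon>) * real N ^ D \<le> card Z * real L ^ D \<and>
    (\<forall>\<omega>\<in>space M. X \<omega> \<le> (real L / real N) ^ D * (\<Sum>z\<in>Z. Y z \<omega>) + \<epsilon>)"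

text \<open>An index \<open>s\<close> in \<open>Sh\<close> is a shape, \<open>N\<close> is a scale and \<open>D\<close> the dimension of the hyperplane. \<open>Y s L z\<close> is
the copy of \<open>X s L\<close> for the tile at position \<open>z\<close>. The last axiom is approximate subadditivity
with respect to tilings by independent copies.\<close>

locale tiled_process = prob_space M for M :: "'a measure" +
  fixes X :: "'s \<Rightarrow> nat \<Rightarrow> 'a \<Rightarrow> real" and Y :: "'s \<Rightarrow> nat \<Rightarrow> 'i \<Rightarrow> 'a \<Rightarrow> real"
    and Sh :: "'s set" and D :: nat
  assumes Sh_ne: "Sh \<noteq> {}" and D_pos: "D > 0"
    and meas_X: "\<And>s N. s \<in> Sh \<Longrightarrow> N > 0 \<Longrightarrow> X s N \<in> borel_measurable M"
    and bounded_X: "\<And>s N. s \<in> Sh \<Longrightarrow> N > 0 \<Longrightarrow> \<exists>B. \<forall>\<omega>\<in>space M. X s N \<omega> \<in> {0..B}"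
    and copy: "\<And>s L z. s \<in> Sh \<Longrightarrow> L > 0 \<Longrightarrow> distr M borel (Y s L z) = distr M borel (X s L)"
    and tiles: "\<And>s s' \<epsilon>. s \<in> Sh \<Longrightarrow> s' \<in> Sh \<Longrightarrow> \<epsilon> > 0 \<Longrightarrow>
      \<forall>\<^sub>F L in sequentially. \<forall>\<^sub>F N in sequentially. \<exists>Z. tile_bound D \<epsilon> L N (Y s' L) (X s N) Z"
begin

lemma integrable_X: "s \<in> Sh \<Longrightarrow> N > 0 \<Longrightarrow> integrable M (X s N)"
proof -
  assume *: "s \<in> Sh" "N > 0"
  obtain B where "\<forall>\<omega>\<in>space M. X s N \<omega> \<in> {0..B}" using bounded_X[OF *] by blast
  then show "integrable M (X s N)"
    using meas_X[OF *] by (intro integrable_const_bound[of _ B]) auto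
qed

lemma mean_nonneg: "s \<in> Sh \<Longrightarrow> N > 0 \<Longrightarrow> expectation (X s N) \<ge> 0"
proof -
  assume "s \<in> Sh" "N > 0"
  then obtain B where "\<forall>\<omega>\<in>space M. X s N \<omega> \<in> {0..B}" using bounded_X by blast
  then show ?thesis by (intro integral_nonneg_AE AE_I2) auto
qed

lemma iid:
  assumes "s \<in> Sh" "L > 0" "finite Z" "indep_vars (\<lambda>_. borel) (Y s L) Z"
    "\<And>\<omega>. \<omega> \<in> space M \<Longrightarrow> X s L \<omega> \<in> {0..B}"
  shows "iid_interval_bounded_random_variables M Z (Y s L) (X s L) 0 B"
  using assms copy[OF assms(1,2)] meas_X[OF assms(1,2)] by unfold_locales auto

lemma mean_subadditive:
  assumes s: "s \<in> Sh" "s' \<in> Sh" and \<epsilon>: "\<epsilon> > 0"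
  shows "\<forall>\<^sub>F L in sequentially. \<forall>\<^sub>F N in sequentially. expectation (X s N) \<le> expectation (X s' L) + \<epsilon>"
  using tiles[OF s \<epsilon>] eventually_gt_at_top[of 0]
proof eventually_elim
  fix L :: nat
  assume ev: "\<forall>\<^sub>F N in sequentially. \<exists>Z. tile_bound D \<epsilon> L N (Y s' L) (X s N) Z" and L: "L > 0"
  obtain B where B: "\<And>\<omega>. \<omega> \<in> space M \<Longrightarrow> X s' L \<omega> \<in> {0..B}" using bounded_X[OF s(2) L] by blast
  show "\<forall>\<^sub>F N in sequentially. expectation (X s N) \<le> expectation (X s' L) + \<epsilon>"
    using ev eventually_gt_at_top[of 0]
  proof eventually_elim
    fix N :: nat
    assume "\<exists>Z. tile_bound D \<epsilon> L N (Y s' L) (X s N) Z" and N: "N > 0"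
    then obtain Z where Z: "finite Z" "indep_vars (\<lambda>_. borel) (Y s' L) Z"
        "card Z * real L ^ D \<le> real N ^ D"
        "\<And>\<omega>. \<omega> \<in> space M \<Longrightarrow> X s N \<omega> \<le> (real L / real N) ^ D * (\<Sum>z\<in>Z. Y s' L z \<omega>) + \<epsilon>"
      unfolding tile_bound_def by blast
    interpret iid_interval_bounded_random_variables M Z "Y s' L" "X s' L" 0 B
      by (rule iid[OF s(2) L Z(1,2) B])
    have int: "integrable M (Y s' L z)" if "z \<in> Z" for z
      using that by (rule interval_bounded_random_variable.integrable[OF X.bounded_random_variable])
    have "expectation (X s N) \<le> expectation (\<lambda>\<omega>. (real L / real N) ^ D * (\<Sum>z\<in>Z. Y s' L z \<omega>) + \<epsilon>)"
      using int Z(4) by (intro integral_mono integrable_X[OF s(1) N]) auto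
    also have "\<dots> = (real L / real N) ^ D * (card Z * expectation (X s' L)) + \<epsilon>"
      using int by (simp add: prob_space)
    also have "(real L / real N) ^ D * (card Z * expectation (X s' L)) =
        (card Z * real L ^ D) / real N ^ D * expectation (X s' L)" by (simp add: power_divide)
    also have "\<dots> \<le> 1 * expectation (X s' L)"
      using Z(3) N by (intro mult_right_mono mean_nonneg[OF s(2) L]) simp
    finally show "expectation (X s N) \<le> expectation (X s' L) + \<epsilon>" by simp
  qed
qed

lemma mean_limit: "\<exists>t\<ge>0. \<forall>s\<in>Sh. (\<lambda>N. expectation (X s N)) \<longlonglongrightarrow> t"
proof (rule eventually_sandwich_limit[OF Sh_ne _ mean_subadditive])
  show "\<forall>\<^sub>F N in sequentially. expectation (X s N) \<ge> 0" if "s \<in> Sh" for s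
    using eventually_gt_at_top[of 0] by eventually_elim (rule mean_nonneg[OF that])
qed

text \<open>Needed to control the mean on events of small probability: the process at large scales is at most
an average of copies at one fixed scale.\<close>

lemma eventually_bounded:
  assumes s: "s \<in> Sh"
  shows "\<exists>B>0. \<forall>\<^sub>F N in sequentially. AE \<omega> in M. X s N \<omega> \<le> B"
proof -
  obtain L where L: "L > 0" and ev: "\<forall>\<^sub>F N in sequentially. \<exists>Z. tile_bound D 1 L N (Y s L) (X s N) Z"
    using eventually_happens[OF eventually_conj[OF tiles[OF s s, of 1] eventually_gt_at_top[of 0]]] by auto
  obtain B where B: "\<And>\<omega>. \<omega> \<in> space M \<Longrightarrow> X s L \<omega> \<in> {0..B}" using bounded_X[OF s L] by blast
  have B0: "B \<ge> 0"
  proof -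
    obtain \<omega> where "\<omega> \<in> space M" using not_empty by blast
    then show ?thesis using B by fastforce
  qed
  have "\<forall>\<^sub>F N in sequentially. AE \<omega> in M. X s N \<omega> \<le> B + 1"
    using ev eventually_gt_at_top[of 0]
  proof eventually_elim
    fix N :: nat
    assume "\<exists>Z. tile_bound D 1 L N (Y s L) (X s N) Z" and N: "N > 0"
    then obtain Z where Z: "finite Z" "indep_vars (\<lambda>_. borel) (Y s L) Z"
        "card Z * real L ^ D \<le> real N ^ D"
        "\<And>\<omega>. \<omega> \<in> space M \<Longrightarrow> X s N \<omega> \<le> (real L / real N) ^ D * (\<Sum>z\<in>Z. Y s L z \<omega>) + 1"
      unfolding tile_bound_def by blast
    interpret iid_interval_bounded_random_variables M Z "Y s L" "X s L" 0 B
      by (rule iid[OF s L Z(1,2) B])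
    have "AE \<omega> in M. \<forall>z\<in>Z. Y s L z \<omega> \<in> {0..B}"
      using X.AE_in_interval Z(1) by (intro AE_finite_allI) auto
    then show "AE \<omega> in M. X s N \<omega> \<le> B + 1"
      using AE_space
    proof eventually_elim
      case (elim \<omega>)
      have "(real L / real N) ^ D * (\<Sum>z\<in>Z. Y s L z \<omega>) \<le> (real L / real N) ^ D * (\<Sum>z\<in>Z. B)"
        using elim by (intro mult_left_mono sum_mono) auto
      also have "\<dots> = (card Z * real L ^ D) / real N ^ D * B" by (simp add: power_divide)
      also have "\<dots> \<le> 1 * B" using Z(3) N B0 by (intro mult_right_mono) simp_all
      finally show ?case using Z(4)[OF elim(2)] by linarith
    qed
  qed
  then show ?thesis using B0 by (intro exI[of _ "B + 1"]) simp
qed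

text \<open>At a scale \<open>L\<close> whose mean is close to \<open>t\<close>, the process at scale \<open>N\<close> is at most an average of about
\<open>(N / L) ^ D\<close> independent bounded copies, to which Hoeffding's inequality applies.\<close>

lemma upper_deviation:
  assumes s: "s \<in> Sh" and t: "(\<lambda>N. expectation (X s N)) \<longlonglongrightarrow> t" and \<eta>: "\<eta> > 0"
  shows "(\<lambda>N. prob {\<omega> \<in> space M. X s N \<omega> > t + \<eta>}) \<longlonglongrightarrow> 0"
proof -
  \<comment> \<open>One third of \<open>\<eta>\<close> each is spent on the tiling error, on the mean at scale \<open>L\<close> and on the fluctuations.\<close>
  define \<epsilon> where "\<epsilon> = min (\<eta> / 3) (1 / 2)"
  have \<epsilon>: "\<epsilon> > 0" "\<epsilon> \<le> \<eta> / 3" "\<epsilon> \<le> 1 / 2" using \<eta> by (auto simp: \<epsilon>_def)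
  have mean: "\<forall>\<^sub>F L in sequentially. expectation (X s L) < t + \<eta> / 3"
    using \<eta> by (intro order_tendstoD(2)[OF t]) simp
  obtain L where L: "L > 0" "expectation (X s L) < t + \<eta> / 3" and ev: "\<forall>\<^sub>F N in sequentially. \<exists>Z. tile_bound D \<epsilon> L N (Y s L) (X s N) Z"
    using eventually_happens'[OF sequentially_bot
        eventually_conj[OF tiles[OF s s \<epsilon>(1)] eventually_conj[OF mean eventually_gt_at_top[of 0]]]]
    by blast
  obtain B0 where B0: "\<And>\<omega>. \<omega> \<in> space M \<Longrightarrow> X s L \<omega> \<in> {0..B0}" using bounded_X[OF s L(1)] by blast
  \<comment> \<open>Hoeffding's inequality asks for a nondegenerate interval.\<close>
  define B where "B = max B0 1"
  have B: "B > 0" "\<And>\<omega>. \<omega> \<in> space M \<Longrightarrow> X s L \<omega> \<in> {0..B}" using B0 by (fastforce simp: B_def)+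
  \<comment> \<open>The exponent in Hoeffding's inequality is proportional to \<open>card Z\<close>, which is at least
    \<open>N ^ D / (2 * L ^ D)\<close> because \<open>\<epsilon> \<le> 1 / 2\<close>.\<close>
  define c where "c = (\<eta> / 3)\<^sup>2 / (B\<^sup>2 * real L ^ D)"
  have c: "c > 0" using \<eta> B L(1) by (simp add: c_def)
  have bound: "\<forall>\<^sub>F N in sequentially. prob {\<omega> \<in> space M. X s N \<omega> > t + \<eta>} \<le> exp (- c * real N)"
    using ev eventually_gt_at_top[of 0]
  proof eventually_elim
    fix N :: nat
    assume "\<exists>Z. tile_bound D \<epsilon> L N (Y s L) (X s N) Z" and N: "N > 0"
    then obtain Z where Z: "finite Z" "indep_vars (\<lambda>_. borel) (Y s L) Z"
        "card Z * real L ^ D \<le> real N ^ D" "(1 - \<epsilon>) * real N ^ D \<le> card Z * real L ^ D"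
        "\<And>\<omega>. \<omega> \<in> space M \<Longrightarrow> X s N \<omega> \<le> (real L / real N) ^ D * (\<Sum>z\<in>Z. Y s L z \<omega>) + \<epsilon>"
      unfolding tile_bound_def by blast
    interpret iid_interval_bounded_random_variables M Z "Y s L" "X s L" 0 B
      by (rule iid[OF s L(1) Z(1,2) B(2)])
    interpret H: Hoeffding_ineq_iid M Z "Y s L" "X s L" 0 B "expectation (X s L)"
      by unfold_locales simp
    have "1 / 2 * real N ^ D \<le> (1 - \<epsilon>) * real N ^ D" using \<epsilon>(3) by (intro mult_right_mono) auto
    then have k: "real N ^ D \<le> 2 * (card Z * real L ^ D)" using Z(4) by linarith
    moreover have "real N ^ D > 0" using N by simp
    ultimately have "card Z > 0" by (cases "card Z = 0") auto
    then have Zne: "Z \<noteq> {}" by auto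
    have meas: "Y s L z \<in> borel_measurable M" if "z \<in> Z" for z using that by (rule random_variable)
    have "prob {\<omega> \<in> space M. X s N \<omega> > t + \<eta>} \<le>
        prob {\<omega> \<in> space M. (\<Sum>z\<in>Z. Y s L z \<omega>) / card Z \<ge> expectation (X s L) + \<eta> / 3}"
    proof (intro finite_measure_mono subsetI)
      show "{\<omega> \<in> space M. (\<Sum>z\<in>Z. Y s L z \<omega>) / card Z \<ge> expectation (X s L) + \<eta> / 3} \<in> events"
        using meas by measurable
      fix \<omega> assume "\<omega> \<in> {\<omega> \<in> space M. X s N \<omega> > t + \<eta>}"
      then have \<omega>: "\<omega> \<in> space M" "X s N \<omega> > t + \<eta>" by auto
      let ?S = "\<Sum>z\<in>Z. Y s L z \<omega>" and ?r = "(real L / real N) ^ D"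
      have S: "?r * ?S > expectation (X s L) + \<eta> / 3" using Z(5)[OF \<omega>(1)] \<omega>(2) L(2) \<epsilon>(2) by linarith
      have r: "?r > 0" using N L(1) by simp
      have "?r * ?S > 0" using S mean_nonneg[OF s L(1)] \<eta> by linarith
      then have S0: "?S > 0" using r zero_less_mult_pos by blast
      have "?r \<le> 1 / card Z"
        using Z(3) N \<open>card Z > 0\<close> by (simp add: power_divide field_simps)
      then have "?r * ?S \<le> 1 / card Z * ?S" using S0 by (intro mult_right_mono) auto
      then show "\<omega> \<in> {\<omega> \<in> space M. (\<Sum>z\<in>Z. Y s L z \<omega>) / card Z \<ge> expectation (X s L) + \<eta> / 3}"
        using S \<omega>(1) by simp
    qed
    also have "\<dots> \<le> exp (- 2 * real (card Z) * (\<eta> / 3)\<^sup>2 / (B - 0)\<^sup>2)"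
      using \<eta> B(1) Zne by (intro H.Hoeffding_ineq_ge') auto
    also have "\<dots> \<le> exp (- c * real N)"
    proof -
      have "real N \<le> real N ^ D" using N D_pos by (intro self_le_power) auto
      then have "real N \<le> 2 * (card Z * real L ^ D)" using k by linarith
      then have "c * real N \<le> c * (2 * (card Z * real L ^ D))" using c by (intro mult_left_mono) auto
      also have "\<dots> = 2 * real (card Z) * (\<eta> / 3)\<^sup>2 / B\<^sup>2" using L(1) by (simp add: c_def)
      finally show ?thesis by simp
    qed
    finally show "prob {\<omega> \<in> space M. X s N \<omega> > t + \<eta>} \<le> exp (- c * real N)" .
  qed
  have lim: "(\<lambda>N. exp (- c * real N)) \<longlonglongrightarrow> 0"
  proof -
    have "(\<lambda>N. exp (- c) ^ N) \<longlonglongrightarrow> 0" using c by (intro LIMSEQ_power_zero) simp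
    moreover have "exp (- c * real N) = exp (- c) ^ N" for N
      by (subst mult.commute) (rule exp_of_nat_mult)
    ultimately show ?thesis by presburger
  qed
  show ?thesis
    by (rule tendsto_sandwich[OF always_eventually[OF allI[OF measure_nonneg]] bound tendsto_const lim])
qed

text \<open>As large values are unlikely and bounded, the mean could not stay near \<open>t\<close> if values below \<open>t - \<eta>\<close>
had a probability bounded away from \<open>0\<close>.\<close>

lemma lower_deviation:
  assumes s: "s \<in> Sh" and t: "(\<lambda>N. expectation (X s N)) \<longlonglongrightarrow> t" and \<eta>: "\<eta> > 0" and t0: "t \<ge> 0"
  shows "(\<lambda>N. prob {\<omega> \<in> space M. X s N \<omega> < t - \<eta>}) \<longlonglongrightarrow> 0"
proof (rule tendstoI)
  fix \<epsilon> :: real assume \<epsilon>: "\<epsilon> > 0"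
  obtain B where B: "B > 0" "\<forall>\<^sub>F N in sequentially. AE \<omega> in M. X s N \<omega> \<le> B" using eventually_bounded[OF s] by blast
  \<comment> \<open>The mean, the upper deviations and the margin above \<open>t\<close> each contribute at most \<open>c\<close>, and \<open>3 * c < \<eta> * \<epsilon>\<close>.\<close>
  define c where "c = \<eta> * \<epsilon> / 4"
  have c: "c > 0" using \<eta> \<epsilon> by (simp add: c_def)
  have "\<forall>\<^sub>F N in sequentially. prob {\<omega> \<in> space M. X s N \<omega> > t + c} < c / B"
    using c B(1) by (intro order_tendstoD(2)[OF upper_deviation[OF s t c]]) simp
  moreover have "\<forall>\<^sub>F N in sequentially. expectation (X s N) > t - c"
    using c by (intro order_tendstoD(1)[OF t]) simp
  ultimately show "\<forall>\<^sub>F N in sequentially. dist (prob {\<omega> \<in> space M. X s N \<omega> < t - \<eta>}) 0 < \<epsilon>"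
    using B(2) eventually_gt_at_top[of 0]
  proof eventually_elim
    fix N :: nat
    assume up: "prob {\<omega> \<in> space M. X s N \<omega> > t + c} < c / B" and mean: "expectation (X s N) > t - c"
      and bd: "AE \<omega> in M. X s N \<omega> \<le> B" and N: "N > 0"
    note [measurable] = meas_X[OF s N]
    let ?low = "{\<omega> \<in> space M. X s N \<omega> < t - \<eta>}" and ?up = "{\<omega> \<in> space M. X s N \<omega> > t + c}"
    have "expectation (X s N) \<le> expectation (\<lambda>\<omega>. (t + c) - \<eta> * indicat_real ?low \<omega> + B * indicat_real ?up \<omega>)"
    proof (rule integral_mono_AE[OF integrable_X[OF s N]])
      show "integrable M (\<lambda>\<omega>. (t + c) - \<eta> * indicat_real ?low \<omega> + B * indicat_real ?up \<omega>)"
        by (auto simp: emeasure_eq_measure)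
      show "AE \<omega> in M. X s N \<omega> \<le> (t + c) - \<eta> * indicat_real ?low \<omega> + B * indicat_real ?up \<omega>"
        using bd AE_space by eventually_elim (use \<eta> c B(1) t0 in \<open>auto simp: indicator_def\<close>)
    qed
    also have "\<dots> = (t + c) - \<eta> * prob ?low + B * prob ?up"
      by (simp add: prob_space emeasure_eq_measure)
    finally have "\<eta> * prob ?low < t + c - (t - c) + B * (c / B)"
      using mean up B(1) mult_strict_left_mono[OF up B(1)] by linarith
    then have "\<eta> * prob ?low < \<eta> * \<epsilon>" using B(1) \<eta> \<epsilon> by (simp add: c_def)
    then show "dist (prob ?low) 0 < \<epsilon>" using \<eta> by simp
  qed
qed

lemma tends_in_prob_mean_limit:
  assumes s: "s \<in> Sh" and t: "(\<lambda>N. expectation (X s N)) \<longlonglongrightarrow> t" and t0: "t \<ge> 0"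
  shows "tends_in_prob M (X s) t"
  unfolding tends_in_prob_def
proof (intro allI impI)
  fix \<eta> :: real assume \<eta>: "\<eta> > 0"
  have lim: "(\<lambda>N. prob {\<omega> \<in> space M. X s N \<omega> > t + \<eta>} + prob {\<omega> \<in> space M. X s N \<omega> < t - \<eta>}) \<longlonglongrightarrow> 0"
    using tendsto_add[OF upper_deviation[OF s t \<eta>] lower_deviation[OF s t \<eta> t0]] by simp
  have bound: "\<forall>\<^sub>F N in sequentially. prob {\<omega> \<in> space M. \<bar>X s N \<omega> - t\<bar> > \<eta>} \<le>
      prob {\<omega> \<in> space M. X s N \<omega> > t + \<eta>} + prob {\<omega> \<in> space M. X s N \<omega> < t - \<eta>}"
    using eventually_gt_at_top[of 0]
  proof eventually_elim
    fix N :: nat assume N: "N > 0"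
    note [measurable] = meas_X[OF s N]
    have "{\<omega> \<in> space M. \<bar>X s N \<omega> - t\<bar> > \<eta>} =
        {\<omega> \<in> space M. X s N \<omega> > t + \<eta>} \<union> {\<omega> \<in> space M. X s N \<omega> < t - \<eta>}" by auto
    then show "prob {\<omega> \<in> space M. \<bar>X s N \<omega> - t\<bar> > \<eta>} \<le>
      prob {\<omega> \<in> space M. X s N \<omega> > t + \<eta>} + prob {\<omega> \<in> space M. X s N \<omega> < t - \<eta>}"
      by (simp only:) (intro measure_Un_le; measurable)
  qed
  show "(\<lambda>N. prob {\<omega> \<in> space M. \<bar>X s N \<omega> - t\<bar> > \<eta>}) \<longlonglongrightarrow> 0"
    by (rule tendsto_sandwich[OF always_eventually[OF allI[OF measure_nonneg]] bound tendsto_const lim])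
qed

end

section \<open>Lower deviations of such processes\<close>

context tiled_process
begin

definition dev_prob :: "'s \<Rightarrow> nat \<Rightarrow> real \<Rightarrow> real" where
  "dev_prob s N \<tau> = prob {\<omega> \<in> space M. X s N \<omega> \<le> \<tau>}"

definition dev_rate :: "'s \<Rightarrow> nat \<Rightarrow> real \<Rightarrow> real" where
  "dev_rate s N \<tau> = - ln (dev_prob s N \<tau>) / real N ^ D"

lemma dev_prob_mono:
  assumes "s \<in> Sh" "N > 0" "\<tau> \<le> \<tau>'"
  shows "dev_prob s N \<tau> \<le> dev_prob s N \<tau>'"
proof -
  note [measurable] = meas_X[OF assms(1,2)]
  show ?thesis unfolding dev_prob_def using assms(3) by (intro finite_measure_mono) auto
qed

lemma dev_rate_antimono:
  assumes "s \<in> Sh" "N > 0" "\<tau> \<le> \<tau>'" "dev_prob s N \<tau> > 0"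
  shows "dev_rate s N \<tau>' \<le> dev_rate s N \<tau>"
  unfolding dev_rate_def using assms dev_prob_mono[OF assms(1-3)]
  by (intro divide_right_mono) simp_all

lemma dev_rate_nonneg: "dev_prob s N \<tau> > 0 \<Longrightarrow> dev_rate s N \<tau> \<ge> 0"
  unfolding dev_rate_def dev_prob_def by (intro divide_nonneg_nonneg) simp_all

lemma prob_tiles:
  assumes s: "s \<in> Sh" and L: "L > 0" and Z: "finite Z" "indep_vars (\<lambda>_. borel) (Y s L) Z"
  shows "prob {\<omega> \<in> space M. \<forall>z\<in>Z. Y s L z \<omega> \<le> \<theta> z} = (\<Prod>z\<in>Z. dev_prob s L (\<theta> z))"
    and "{\<omega> \<in> space M. \<forall>z\<in>Z. Y s L z \<omega> \<le> \<theta> z} \<in> events"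
proof -
  have meas: "Y s L z \<in> borel_measurable M" if "z \<in> Z" for z
    using Z(2) that unfolding indep_vars_def by blast
  note [measurable] = meas_X[OF s L]
  show "{\<omega> \<in> space M. \<forall>z\<in>Z. Y s L z \<omega> \<le> \<theta> z} \<in> events"
    using Z(1) meas by measurable
  have single: "prob (Y s L z -` {..\<theta> z} \<inter> space M) = dev_prob s L (\<theta> z)" if "z \<in> Z" for z
  proof -
    have "prob (Y s L z -` {..\<theta> z} \<inter> space M) = measure (distr M borel (Y s L z)) {..\<theta> z}"
      using meas[OF that] by (simp add: measure_distr)
    also have "\<dots> = prob (X s L -` {..\<theta> z} \<inter> space M)"
      unfolding copy[OF s L] by (simp add: measure_distr)
    also have "X s L -` {..\<theta> z} \<inter> space M = {\<omega> \<in> space M. X s L \<omega> \<le> \<theta> z}" by auto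
    finally show ?thesis by (simp add: dev_prob_def)
  qed
  show "prob {\<omega> \<in> space M. \<forall>z\<in>Z. Y s L z \<omega> \<le> \<theta> z} = (\<Prod>z\<in>Z. dev_prob s L (\<theta> z))"
  proof (cases "Z = {}")
    case True
    then show ?thesis by (simp add: prob_space)
  next
    case False
    have "{\<omega> \<in> space M. \<forall>z\<in>Z. Y s L z \<omega> \<le> \<theta> z} = (\<Inter>z\<in>Z. Y s L z -` {..\<theta> z} \<inter> space M)"
      using False by auto
    then have "prob {\<omega> \<in> space M. \<forall>z\<in>Z. Y s L z \<omega> \<le> \<theta> z} = (\<Prod>z\<in>Z. prob (Y s L z -` {..\<theta> z} \<inter> space M))"
      using indep_varsD_finite[OF Z(2) False Z(1), of "\<lambda>z. {..\<theta> z}"] by simp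
    then show ?thesis using single by simp
  qed
qed

text \<open>A fraction \<open>\<alpha>\<close> of the tiles is required to stay below \<open>\<tau>1\<close> and the others below \<open>\<tau>2\<close>. Rounding the
number of the former upwards keeps the average below the convex combination of the levels; the extra
tile contributes \<open>r1 / N ^ D\<close> to the rate, which is negligible. The case \<open>\<alpha> = 1\<close> is plain subadditivity.\<close>

lemma dev_rate_tiles:
  assumes s: "s \<in> Sh" "s' \<in> Sh" and \<epsilon>: "\<epsilon> > 0"
  shows "\<forall>\<^sub>F L in sequentially. \<forall>\<alpha>\<in>{0..1}. \<forall>\<tau>1\<ge>0. \<forall>\<tau>2\<ge>\<tau>1. dev_prob s' L \<tau>1 > 0 \<longrightarrow>
    (\<forall>\<^sub>F N in sequentially. dev_prob s N (\<alpha> * \<tau>1 + (1 - \<alpha>) * \<tau>2 + \<epsilon>) > 0 \<and>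
      dev_rate s N (\<alpha> * \<tau>1 + (1 - \<alpha>) * \<tau>2 + \<epsilon>) \<le>
        \<alpha> * dev_rate s' L \<tau>1 + (1 - \<alpha>) * dev_rate s' L \<tau>2 + \<epsilon>)"
  using tiles[OF s \<epsilon>] eventually_gt_at_top[of 0]
proof (eventually_elim, intro ballI allI impI)
  fix L :: nat and \<alpha> \<tau>1 \<tau>2 :: real
  assume ev: "\<forall>\<^sub>F N in sequentially. \<exists>Z. tile_bound D \<epsilon> L N (Y s' L) (X s N) Z" and L: "L > 0"
    and \<alpha>: "\<alpha> \<in> {0..1}" and \<tau>: "\<tau>1 \<ge> 0" "\<tau>2 \<ge> \<tau>1" and pos: "dev_prob s' L \<tau>1 > 0"
  define r1 r2 where "r1 = - ln (dev_prob s' L \<tau>1)" and "r2 = - ln (dev_prob s' L \<tau>2)"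
  have p12: "dev_prob s' L \<tau>1 \<le> dev_prob s' L \<tau>2" using \<tau>(2) by (intro dev_prob_mono[OF s(2) L])
  then have pos2: "dev_prob s' L \<tau>2 > 0" using pos by linarith
  have r: "r1 \<ge> r2" "r2 \<ge> 0" using p12 pos pos2 by (auto simp: r1_def r2_def dev_prob_def)
  have "(\<lambda>N. r1 / real N) \<longlonglongrightarrow> 0" by (rule lim_const_over_n)
  then have small: "\<forall>\<^sub>F N in sequentially. r1 / real N < \<epsilon>" using \<epsilon> by (rule order_tendstoD(2))
  show "\<forall>\<^sub>F N in sequentially. dev_prob s N (\<alpha> * \<tau>1 + (1 - \<alpha>) * \<tau>2 + \<epsilon>) > 0 \<and>
      dev_rate s N (\<alpha> * \<tau>1 + (1 - \<alpha>) * \<tau>2 + \<epsilon>) \<le>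
        \<alpha> * dev_rate s' L \<tau>1 + (1 - \<alpha>) * dev_rate s' L \<tau>2 + \<epsilon>"
    using ev small eventually_gt_at_top[of 0]
  proof eventually_elim
    fix N :: nat
    assume "\<exists>Z. tile_bound D \<epsilon> L N (Y s' L) (X s N) Z"
      and small: "r1 / real N < \<epsilon>" and N: "N > 0"
    then obtain Z where Z: "finite Z" "indep_vars (\<lambda>_. borel) (Y s' L) Z"
        "card Z * real L ^ D \<le> real N ^ D"
        "\<And>\<omega>. \<omega> \<in> space M \<Longrightarrow> X s N \<omega> \<le> (real L / real N) ^ D * (\<Sum>z\<in>Z. Y s' L z \<omega>) + \<epsilon>"
      unfolding tile_bound_def by blast
    let ?\<tau> = "\<alpha> * \<tau>1 + (1 - \<alpha>) * \<tau>2"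
    define k where "k = card Z"
    define m where "m = nat \<lceil>\<alpha> * k\<rceil>"
    have m: "\<alpha> * k \<le> m" "m \<le> \<alpha> * k + 1" using \<alpha> by (auto simp: m_def)
    have mk: "m \<le> k"
    proof -
      have "\<alpha> * real k \<le> 1 * real k" using \<alpha> by (intro mult_right_mono) auto
      then have "\<lceil>\<alpha> * k\<rceil> \<le> int k" by (simp add: ceiling_le_iff)
      then show ?thesis unfolding m_def by linarith
    qed
    obtain Z1 where Z1: "Z1 \<subseteq> Z" "card Z1 = m" "finite Z1"
      using obtain_subset_with_card_n[of m Z] mk unfolding k_def by blast
    have card2: "card (Z - Z1) = k - m" using Z1 Z(1) by (simp add: card_Diff_subset k_def)
    define \<theta> where "\<theta> = (\<lambda>z. if z \<in> Z1 then \<tau>1 else \<tau>2)"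
    have split: "(\<Prod>z\<in>Z. f (\<theta> z)) = f \<tau>1 ^ m * f \<tau>2 ^ (k - m)" for f :: "real \<Rightarrow> real"
    proof -
      have "(\<Prod>z\<in>Z. f (\<theta> z)) = (\<Prod>z\<in>Z1. f (\<theta> z)) * (\<Prod>z\<in>Z - Z1. f (\<theta> z))"
        using Z1(1) Z(1) by (metis prod.subset_diff mult.commute)
      also have "(\<Prod>z\<in>Z1. f (\<theta> z)) = (\<Prod>z\<in>Z1. f \<tau>1)" by (intro prod.cong) (auto simp: \<theta>_def)
      also have "(\<Prod>z\<in>Z - Z1. f (\<theta> z)) = (\<Prod>z\<in>Z - Z1. f \<tau>2)" by (intro prod.cong) (auto simp: \<theta>_def)
      finally show ?thesis by (simp add: Z1(2) card2)
    qed
    have sum_\<theta>: "(\<Sum>z\<in>Z. \<theta> z) \<le> k * ?\<tau>"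
    proof -
      have "(\<Sum>z\<in>Z. \<theta> z) = (\<Sum>z\<in>Z1. \<theta> z) + (\<Sum>z\<in>Z - Z1. \<theta> z)"
        using Z1(1) Z(1) by (metis sum.subset_diff add.commute)
      also have "(\<Sum>z\<in>Z1. \<theta> z) = (\<Sum>z\<in>Z1. \<tau>1)" by (intro sum.cong) (auto simp: \<theta>_def)
      also have "(\<Sum>z\<in>Z - Z1. \<theta> z) = (\<Sum>z\<in>Z - Z1. \<tau>2)" by (intro sum.cong) (auto simp: \<theta>_def)
      finally have "(\<Sum>z\<in>Z. \<theta> z) = k * \<tau>2 - m * (\<tau>2 - \<tau>1)"
        using mk by (simp add: Z1(2) card2 of_nat_diff algebra_simps)
      also have "\<dots> \<le> k * \<tau>2 - (\<alpha> * k) * (\<tau>2 - \<tau>1)"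
        using m(1) \<tau>(2) by (intro diff_left_mono mult_right_mono) auto
      also have "\<dots> = k * ?\<tau>" by (simp add: algebra_simps)
      finally show ?thesis .
    qed
    have "?\<tau> \<ge> 0" using \<alpha> \<tau> by (intro add_nonneg_nonneg mult_nonneg_nonneg) auto
    have "dev_prob s' L \<tau>1 ^ m * dev_prob s' L \<tau>2 ^ (k - m) =
        prob {\<omega> \<in> space M. \<forall>z\<in>Z. Y s' L z \<omega> \<le> \<theta> z}"
      using prob_tiles(1)[OF s(2) L Z(1,2), of \<theta>] split by simp
    also have "\<dots> \<le> dev_prob s N (?\<tau> + \<epsilon>)"
      unfolding dev_prob_def
    proof (intro finite_measure_mono subsetI)
      note [measurable] = meas_X[OF s(1) N]
      show "{\<omega> \<in> space M. X s N \<omega> \<le> ?\<tau> + \<epsilon>} \<in> events" by measurable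
      fix \<omega> assume "\<omega> \<in> {\<omega> \<in> space M. \<forall>z\<in>Z. Y s' L z \<omega> \<le> \<theta> z}"
      then have \<omega>: "\<omega> \<in> space M" "\<And>z. z \<in> Z \<Longrightarrow> Y s' L z \<omega> \<le> \<theta> z" by auto
      have "(real L / real N) ^ D * (\<Sum>z\<in>Z. Y s' L z \<omega>) \<le> (real L / real N) ^ D * (k * ?\<tau>)"
        using sum_mono[of Z "\<lambda>z. Y s' L z \<omega>" \<theta>, OF \<omega>(2)] sum_\<theta>
        by (intro mult_left_mono) auto
      also have "\<dots> = (card Z * real L ^ D) / real N ^ D * ?\<tau>" by (simp add: power_divide k_def)
      also have "\<dots> \<le> 1 * ?\<tau>" using Z(3) N \<open>?\<tau> \<ge> 0\<close> by (intro mult_right_mono) simp_all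
      finally show "\<omega> \<in> {\<omega> \<in> space M. X s N \<omega> \<le> ?\<tau> + \<epsilon>}" using Z(4)[OF \<omega>(1)] \<omega>(1) by simp
    qed
    finally have low: "dev_prob s' L \<tau>1 ^ m * dev_prob s' L \<tau>2 ^ (k - m) \<le> dev_prob s N (?\<tau> + \<epsilon>)" .
    have lowpos: "dev_prob s' L \<tau>1 ^ m * dev_prob s' L \<tau>2 ^ (k - m) > 0" using pos pos2 by simp
    then have posN: "dev_prob s N (?\<tau> + \<epsilon>) > 0" using low by linarith
    have "- ln (dev_prob s N (?\<tau> + \<epsilon>)) \<le> - ln (dev_prob s' L \<tau>1 ^ m * dev_prob s' L \<tau>2 ^ (k - m))"
      using low lowpos posN by simp
    also have "\<dots> = m * r1 + (k - m) * r2"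
      using pos pos2 by (simp add: ln_mult_pos ln_realpow r1_def r2_def)
    also have "\<dots> = k * r2 + m * (r1 - r2)" using mk by (simp add: of_nat_diff algebra_simps)
    also have "\<dots> \<le> k * r2 + (\<alpha> * k + 1) * (r1 - r2)"
      using m(2) r by (intro add_left_mono mult_right_mono) auto
    also have "\<dots> = k * (\<alpha> * r1 + (1 - \<alpha>) * r2) + (r1 - r2)" by (simp add: algebra_simps)
    also have "\<dots> \<le> k * (\<alpha> * r1 + (1 - \<alpha>) * r2) + r1" using r by simp
    finally have rate: "- ln (dev_prob s N (?\<tau> + \<epsilon>)) \<le> k * (\<alpha> * r1 + (1 - \<alpha>) * r2) + r1" .
    have "dev_rate s N (?\<tau> + \<epsilon>) \<le> (k * (\<alpha> * r1 + (1 - \<alpha>) * r2) + r1) / real N ^ D"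
      unfolding dev_rate_def using rate by (intro divide_right_mono) auto
    also have "\<dots> = k / real N ^ D * (\<alpha> * r1 + (1 - \<alpha>) * r2) + r1 / real N ^ D"
      by (simp add: add_divide_distrib)
    also have "\<dots> \<le> 1 / real L ^ D * (\<alpha> * r1 + (1 - \<alpha>) * r2) + \<epsilon>"
    proof (intro add_mono mult_right_mono)
      show "k / real N ^ D \<le> 1 / real L ^ D" using Z(3) N L by (simp add: k_def field_simps)
      show "0 \<le> \<alpha> * r1 + (1 - \<alpha>) * r2" using \<alpha> r by (intro add_nonneg_nonneg mult_nonneg_nonneg) auto
      have "real N \<le> real N ^ D" using N D_pos by (intro self_le_power) auto
      then have "r1 / real N ^ D \<le> r1 / real N" using N r by (intro divide_left_mono) auto
      then show "r1 / real N ^ D \<le> \<epsilon>" using small by linarith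
    qed
    also have "\<dots> = \<alpha> * dev_rate s' L \<tau>1 + (1 - \<alpha>) * dev_rate s' L \<tau>2 + \<epsilon>"
    proof -
      have "dev_rate s' L \<tau>1 = r1 / real L ^ D" "dev_rate s' L \<tau>2 = r2 / real L ^ D"
        by (simp_all add: dev_rate_def r1_def r2_def)
      then show ?thesis by (simp add: add_divide_distrib)
    qed
    finally show "dev_prob s N (?\<tau> + \<epsilon>) > 0 \<and>
        dev_rate s N (?\<tau> + \<epsilon>) \<le> \<alpha> * dev_rate s' L \<tau>1 + (1 - \<alpha>) * dev_rate s' L \<tau>2 + \<epsilon>"
      using posN by blast
  qed
qed

text \<open>\<open>A\<close> collects the pairs \<open>(\<tau>, r)\<close> for which, for all shapes and after an arbitrarily small increase
of both entries, \<open>r\<close> is eventually a bound for the rate at level \<open>\<tau>\<close>. It is enough that the bound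
holds for one shape at infinitely many scales, so the lower boundary \<open>I\<close> of \<open>A\<close> is also an
asymptotic lower bound for the rates. Convexity of \<open>A\<close> makes \<open>I\<close> convex, hence continuous,
and therefore the increase of the level is harmless in the limit.\<close>

theorem rate_function:
  assumes t0: "t0 \<ge> 0"
    and pos: "\<And>s \<tau>. s \<in> Sh \<Longrightarrow> \<tau> > t0 \<Longrightarrow> \<forall>\<^sub>F N in sequentially. dev_prob s N \<tau> > 0"
  shows "\<exists>I :: real \<Rightarrow> real. (\<forall>\<tau>>t0. I \<tau> \<ge> 0 \<and> (\<forall>s\<in>Sh. (\<lambda>N. dev_rate s N \<tau>) \<longlonglongrightarrow> I \<tau>)) \<and>
    continuous_on {t0<..} I \<and> convex_on {t0<..} I \<and> antimono_on {t0<..} I"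
proof -
  define A where "A = {(\<tau>, r). \<tau> > t0 \<and> (\<forall>s\<in>Sh. \<forall>\<epsilon>>0. \<forall>\<^sub>F N in sequentially.
    dev_prob s N (\<tau> + \<epsilon>) > 0 \<and> dev_rate s N (\<tau> + \<epsilon>) \<le> r + \<epsilon>)}"
  define I where "I = (\<lambda>\<tau>. Inf {r. (\<tau>, r) \<in> A})"
  have A_D: "\<forall>\<^sub>F N in sequentially. dev_prob s N (\<tau> + \<epsilon>) > 0 \<and> dev_rate s N (\<tau> + \<epsilon>) \<le> r + \<epsilon>"
    if "(\<tau>, r) \<in> A" "s \<in> Sh" "\<epsilon> > 0" for \<tau> r s \<epsilon> using that by (auto simp: A_def)
  have A_pos: "\<tau> > t0" if "(\<tau>, r) \<in> A" for \<tau> r using that by (auto simp: A_def)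
  have A_freq: "(\<tau>, r) \<in> A" if s': "s' \<in> Sh" and \<tau>: "\<tau> > t0"
    and fr: "\<exists>\<^sub>F L in sequentially. dev_prob s' L \<tau> > 0 \<and> dev_rate s' L \<tau> \<le> r" for s' \<tau> r
    unfolding A_def
  proof (intro CollectI case_prodI conjI ballI allI impI)
    fix s and \<epsilon> :: real assume s: "s \<in> Sh" and \<epsilon>: "\<epsilon> > 0"
    obtain L where L: "dev_prob s' L \<tau> > 0" "dev_rate s' L \<tau> \<le> r"
      and ev: "\<forall>\<alpha>\<in>{0..1}. \<forall>\<tau>1\<ge>0. \<forall>\<tau>2\<ge>\<tau>1. dev_prob s' L \<tau>1 > 0 \<longrightarrow>
        (\<forall>\<^sub>F N in sequentially. dev_prob s N (\<alpha> * \<tau>1 + (1 - \<alpha>) * \<tau>2 + \<epsilon>) > 0 \<and>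
        dev_rate s N (\<alpha> * \<tau>1 + (1 - \<alpha>) * \<tau>2 + \<epsilon>) \<le>
          \<alpha> * dev_rate s' L \<tau>1 + (1 - \<alpha>) * dev_rate s' L \<tau>2 + \<epsilon>)"
      using frequently_ex[OF frequently_eventually_frequently[OF fr dev_rate_tiles[OF s s' \<epsilon>]]] by blast
    have "\<tau> \<ge> 0" using \<tau> t0 by simp
    have "\<forall>\<^sub>F N in sequentially. dev_prob s N (1 * \<tau> + (1 - 1) * \<tau> + \<epsilon>) > 0 \<and>
        dev_rate s N (1 * \<tau> + (1 - 1) * \<tau> + \<epsilon>) \<le>
          1 * dev_rate s' L \<tau> + (1 - 1) * dev_rate s' L \<tau> + \<epsilon>"
      using ev[rule_format, of 1 \<tau> \<tau>] \<open>\<tau> \<ge> 0\<close> L(1) by simp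
    then show "\<forall>\<^sub>F N in sequentially. dev_prob s N (\<tau> + \<epsilon>) > 0 \<and> dev_rate s N (\<tau> + \<epsilon>) \<le> r + \<epsilon>"
      by eventually_elim (use L(2) in simp)
  qed (rule \<tau>)
  have A_convex: "(\<alpha> * \<tau>1 + (1 - \<alpha>) * \<tau>2, \<alpha> * r1 + (1 - \<alpha>) * r2) \<in> A"
    if A: "(\<tau>1, r1) \<in> A" "(\<tau>2, r2) \<in> A" and le: "\<tau>1 \<le> \<tau>2" and \<alpha>: "\<alpha> \<in> {0..1}" for \<alpha> \<tau>1 \<tau>2 r1 r2
    unfolding A_def
  proof (intro CollectI case_prodI conjI ballI allI impI)
    have "\<alpha> * \<tau>1 + (1 - \<alpha>) * \<tau>2 \<ge> \<alpha> * \<tau>1 + (1 - \<alpha>) * \<tau>1"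
      using le \<alpha> by (intro add_left_mono mult_left_mono) auto
    then show "\<alpha> * \<tau>1 + (1 - \<alpha>) * \<tau>2 > t0" using A_pos[OF A(1)] by (simp add: algebra_simps)
    fix s and \<epsilon> :: real assume s: "s \<in> Sh" and \<epsilon>: "\<epsilon> > 0"
    define e where "e = \<epsilon> / 2"
    have e: "e > 0" "\<epsilon> = e + e" using \<epsilon> by (auto simp: e_def)
    obtain L where L1: "dev_prob s L (\<tau>1 + e) > 0" "dev_rate s L (\<tau>1 + e) \<le> r1 + e"
      and L2: "dev_rate s L (\<tau>2 + e) \<le> r2 + e"
      and ev: "\<forall>\<alpha>\<in>{0..1}. \<forall>\<tau>1\<ge>0. \<forall>\<tau>2\<ge>\<tau>1. dev_prob s L \<tau>1 > 0 \<longrightarrow>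
        (\<forall>\<^sub>F N in sequentially. dev_prob s N (\<alpha> * \<tau>1 + (1 - \<alpha>) * \<tau>2 + e) > 0 \<and>
        dev_rate s N (\<alpha> * \<tau>1 + (1 - \<alpha>) * \<tau>2 + e) \<le>
          \<alpha> * dev_rate s L \<tau>1 + (1 - \<alpha>) * dev_rate s L \<tau>2 + e)"
      using eventually_happens'[OF sequentially_bot eventually_conj[OF dev_rate_tiles[OF s s e(1)]
        eventually_conj[OF A_D[OF A(1) s e(1)] A_D[OF A(2) s e(1)]]]] by blast
    have "\<tau>1 + e \<ge> 0" using A_pos[OF A(1)] t0 e by simp
    then have ev': "\<forall>\<^sub>F N in sequentially. dev_prob s N (\<alpha> * (\<tau>1 + e) + (1 - \<alpha>) * (\<tau>2 + e) + e) > 0 \<and>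
        dev_rate s N (\<alpha> * (\<tau>1 + e) + (1 - \<alpha>) * (\<tau>2 + e) + e) \<le>
          \<alpha> * dev_rate s L (\<tau>1 + e) + (1 - \<alpha>) * dev_rate s L (\<tau>2 + e) + e"
      using ev[rule_format, of \<alpha> "\<tau>1 + e" "\<tau>2 + e"] \<alpha> le L1(1) by simp
    have eq1: "\<alpha> * (\<tau>1 + e) + (1 - \<alpha>) * (\<tau>2 + e) + e = \<alpha> * \<tau>1 + (1 - \<alpha>) * \<tau>2 + \<epsilon>"
      by (simp add: e(2) algebra_simps)
    have le1: "\<alpha> * dev_rate s L (\<tau>1 + e) + (1 - \<alpha>) * dev_rate s L (\<tau>2 + e) + e \<le>
        \<alpha> * (r1 + e) + (1 - \<alpha>) * (r2 + e) + e"
      using L1(2) L2 \<alpha> by (intro add_right_mono add_mono mult_left_mono) auto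
    have eq2: "\<alpha> * (r1 + e) + (1 - \<alpha>) * (r2 + e) + e = \<alpha> * r1 + (1 - \<alpha>) * r2 + \<epsilon>"
      by (simp add: e(2) algebra_simps)
    show "\<forall>\<^sub>F N in sequentially. dev_prob s N (\<alpha> * \<tau>1 + (1 - \<alpha>) * \<tau>2 + \<epsilon>) > 0 \<and>
        dev_rate s N (\<alpha> * \<tau>1 + (1 - \<alpha>) * \<tau>2 + \<epsilon>) \<le> \<alpha> * r1 + (1 - \<alpha>) * r2 + \<epsilon>"
      using ev'[unfolded eq1]
    proof eventually_elim
      case (elim N)
      have "dev_rate s N (\<alpha> * \<tau>1 + (1 - \<alpha>) * \<tau>2 + \<epsilon>) \<le> \<alpha> * r1 + (1 - \<alpha>) * r2 + \<epsilon>"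
        by (rule order_trans[OF conjunct2[OF elim] order_trans[OF le1 eq_refl[OF eq2]]])
      then show ?case using elim by blast
    qed
  qed
  obtain s0 where s0: "s0 \<in> Sh" using Sh_ne by blast
  have A_nonneg: "r \<ge> 0" if A: "(\<tau>, r) \<in> A" for \<tau> r
  proof (rule field_le_epsilon)
    fix \<epsilon> :: real assume "\<epsilon> > 0"
    then obtain N where "dev_prob s0 N (\<tau> + \<epsilon>) > 0" "dev_rate s0 N (\<tau> + \<epsilon>) \<le> r + \<epsilon>"
      using eventually_happens'[OF sequentially_bot A_D[OF A s0]] by blast
    then show "0 \<le> r + \<epsilon>" using dev_rate_nonneg order_trans by blast
  qed
  have A_ne: "\<exists>r. (\<tau>, r) \<in> A" if \<tau>: "\<tau> > t0" for \<tau>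
  proof -
    define \<epsilon> where "\<epsilon> = (\<tau> - t0) / 2"
    have \<epsilon>: "\<epsilon> > 0" "t0 + \<epsilon> + \<epsilon> = \<tau>" using \<tau> by (auto simp: \<epsilon>_def field_simps)
    obtain L where L: "dev_prob s0 L (t0 + \<epsilon>) > 0"
      and ev: "\<forall>\<alpha>\<in>{0..1}. \<forall>\<tau>1\<ge>0. \<forall>\<tau>2\<ge>\<tau>1. dev_prob s0 L \<tau>1 > 0 \<longrightarrow>
        (\<forall>\<^sub>F N in sequentially. dev_prob s0 N (\<alpha> * \<tau>1 + (1 - \<alpha>) * \<tau>2 + \<epsilon>) > 0 \<and>
        dev_rate s0 N (\<alpha> * \<tau>1 + (1 - \<alpha>) * \<tau>2 + \<epsilon>) \<le>
          \<alpha> * dev_rate s0 L \<tau>1 + (1 - \<alpha>) * dev_rate s0 L \<tau>2 + \<epsilon>)"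
      using eventually_happens'[OF sequentially_bot eventually_conj[OF dev_rate_tiles[OF s0 s0 \<epsilon>(1)]
        pos[OF s0, of "t0 + \<epsilon>"]]] \<epsilon>(1) by auto
    have "\<forall>\<^sub>F N in sequentially. dev_prob s0 N (t0 + \<epsilon> + \<epsilon>) > 0 \<and>
        dev_rate s0 N (t0 + \<epsilon> + \<epsilon>) \<le> dev_rate s0 L (t0 + \<epsilon>) + \<epsilon>"
      using ev[rule_format, of 1 "t0 + \<epsilon>" "t0 + \<epsilon>"] t0 \<epsilon>(1) L by simp
    then have "(\<tau>, dev_rate s0 L (t0 + \<epsilon>) + \<epsilon>) \<in> A"
      unfolding \<epsilon>(2) by (intro A_freq[OF s0 \<tau>] eventually_frequently) auto
    then show ?thesis by blast
  qed
  have bdd: "bdd_below {r. (\<tau>, r) \<in> A}" for \<tau> using A_nonneg by (intro bdd_belowI[of _ 0]) auto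
  have I_le: "I \<tau> \<le> r" if "(\<tau>, r) \<in> A" for \<tau> r
    unfolding I_def using that by (intro cInf_lower bdd) simp
  have I_near: "\<exists>r < I \<tau> + \<eta>. (\<tau>, r) \<in> A" if "\<tau> > t0" "\<eta> > 0" for \<tau> \<eta>
    using cInf_lessD[of "{r. (\<tau>, r) \<in> A}" "I \<tau> + \<eta>"] A_ne[OF that(1)] that(2) unfolding I_def by auto
  have I_nonneg: "I \<tau> \<ge> 0" if "\<tau> > t0" for \<tau>
    unfolding I_def using A_ne[OF that] A_nonneg by (intro cInf_greatest) auto
  have convex: "convex_on {t0<..} I"
  proof (rule convex_on_linorderI)
    fix t x y :: real assume t: "t > 0" "t < 1" and xy: "x \<in> {t0<..}" "y \<in> {t0<..}" "x < y"
    show "I ((1 - t) *\<^sub>R x + t *\<^sub>R y) \<le> (1 - t) * I x + t * I y"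
    proof (rule field_le_epsilon)
      fix \<eta> :: real assume \<eta>: "\<eta> > 0"
      obtain r1 r2 where r: "r1 < I x + \<eta>" "(x, r1) \<in> A" "r2 < I y + \<eta>" "(y, r2) \<in> A"
        using I_near[of x \<eta>] I_near[of y \<eta>] xy \<eta> by auto
      have "((1 - t) * x + (1 - (1 - t)) * y, (1 - t) * r1 + (1 - (1 - t)) * r2) \<in> A"
        using t xy by (intro A_convex r) auto
      then have "I ((1 - t) *\<^sub>R x + t *\<^sub>R y) \<le> (1 - t) * r1 + t * r2" using I_le by simp
      also have "\<dots> \<le> (1 - t) * (I x + \<eta>) + t * (I y + \<eta>)"
        using r t by (intro add_mono mult_left_mono) auto
      also have "\<dots> = (1 - t) * I x + t * I y + \<eta>" by (simp add: algebra_simps)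
      finally show "I ((1 - t) *\<^sub>R x + t *\<^sub>R y) \<le> (1 - t) * I x + t * I y + \<eta>" .
    qed
  qed simp
  have cont: "continuous_on {t0<..} I" by (rule convex_on_continuous[OF open_greaterThan convex])
  have anti: "I y \<le> I x" if xy: "t0 < x" "x \<le> y" for x y
  proof (rule field_le_epsilon)
    fix \<eta> :: real assume \<eta>: "\<eta> > 0"
    obtain r where r: "r < I x + \<eta>" "(x, r) \<in> A" using I_near[OF xy(1) \<eta>] by blast
    have "(y, r) \<in> A"
      unfolding A_def
    proof (intro CollectI case_prodI conjI ballI allI impI)
      show "t0 < y" using xy by simp
      fix s and \<epsilon> :: real assume s: "s \<in> Sh" and \<epsilon>: "\<epsilon> > 0"
      show "\<forall>\<^sub>F N in sequentially. dev_prob s N (y + \<epsilon>) > 0 \<and> dev_rate s N (y + \<epsilon>) \<le> r + \<epsilon>"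
        using A_D[OF r(2) s \<epsilon>] eventually_gt_at_top[of 0]
      proof eventually_elim
        case (elim N)
        then show ?case
          using dev_prob_mono[OF s elim(2), of "x + \<epsilon>" "y + \<epsilon>"]
            dev_rate_antimono[OF s elim(2), of "x + \<epsilon>" "y + \<epsilon>"] xy(2) by auto
      qed
    qed
    then show "I y \<le> I x + \<eta>" using I_le r(1) by fastforce
  qed
  have lim: "(\<lambda>N. dev_rate s N \<tau>) \<longlonglongrightarrow> I \<tau>" if s: "s \<in> Sh" and \<tau>: "\<tau> > t0" for s \<tau>
  proof (rule tendstoI)
    fix \<eta> :: real assume \<eta>: "\<eta> > 0"
    have "isCont I \<tau>" using cont \<tau> by (simp add: continuous_on_eq_continuous_at[OF open_greaterThan])
    then have "(I \<longlongrightarrow> I \<tau>) (at_left \<tau>)" unfolding isCont_def by (rule tendsto_within_subset) auto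
    then have "\<forall>\<^sub>F x in at_left \<tau>. I x < I \<tau> + \<eta> / 2" using \<eta> by (intro order_tendstoD(2)) auto
    moreover have "\<forall>\<^sub>F x in at_left \<tau>. x > max t0 (\<tau> - \<eta> / 2)"
      using \<tau> \<eta> eventually_at_left_real[of "max t0 (\<tau> - \<eta> / 2)" \<tau>] by (auto elim: eventually_mono)
    moreover have "\<forall>\<^sub>F x in at_left \<tau>. x < \<tau>" by (simp add: eventually_at_filter)
    ultimately obtain x where x: "I x < I \<tau> + \<eta> / 2" "x > t0" "x > \<tau> - \<eta> / 2" "x < \<tau>"
      using eventually_happens'[of "at_left \<tau>" "\<lambda>x. I x < I \<tau> + \<eta> / 2 \<and> x > max t0 (\<tau> - \<eta> / 2) \<and> x < \<tau>"]
      by (auto simp: eventually_conj_iff)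
    obtain r where r: "r < I \<tau> + \<eta> / 2" "(x, r) \<in> A" using I_near[OF x(2), of "I \<tau> + \<eta> / 2 - I x"] x(1) by auto
    have "\<forall>\<^sub>F N in sequentially. dev_prob s N (x + (\<tau> - x)) > 0 \<and> dev_rate s N (x + (\<tau> - x)) \<le> r + (\<tau> - x)"
      using x(4) by (intro A_D[OF r(2) s]) simp
    then have "\<forall>\<^sub>F N in sequentially. dev_rate s N \<tau> < I \<tau> + \<eta>"
      by eventually_elim (use r(1) x(3) in auto)
    moreover have "\<forall>\<^sub>F N in sequentially. dev_rate s N \<tau> > I \<tau> - \<eta>"
    proof (rule ccontr)
      assume "\<not> ?thesis"
      then have "\<exists>\<^sub>F N in sequentially. dev_rate s N \<tau> \<le> I \<tau> - \<eta>" by (simp add: not_eventually not_less)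
      then have "\<exists>\<^sub>F N in sequentially. dev_prob s N \<tau> > 0 \<and> dev_rate s N \<tau> \<le> I \<tau> - \<eta>"
        by (rule frequently_elim1[OF frequently_eventually_frequently[OF _ pos[OF s \<tau>]]]) blast
      then have "(\<tau>, I \<tau> - \<eta>) \<in> A" by (rule A_freq[OF s \<tau>])
      then show False using I_le \<eta> by fastforce
    qed
    ultimately show "\<forall>\<^sub>F N in sequentially. dist (dev_rate s N \<tau>) (I \<tau>) < \<eta>"
      by eventually_elim (simp add: dist_real_def)
  qed
  show ?thesis
    using I_nonneg lim cont convex anti by (intro exI[of _ I]) (auto simp: monotone_on_def)
qed

end

section \<open>Translations of the random cluster model\<close>

lemma inj_image_set: "inj f \<Longrightarrow> inj ((`) f)"
  by (intro injI) (simp add: inj_image_eq_iff)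

lemma edge_image_iff: "inj f \<Longrightarrow> {f x, f y} \<in> (`) f ` F \<longleftrightarrow> {x, y} \<in> F"
proof -
  assume f: "inj f"
  have "{f x, f y} = f ` {x, y}" by simp
  then show ?thesis using inj_image_mem_iff[OF inj_image_set[OF f], of "{x, y}" F] by (simp only:)
qed

lemma connected_by_image_imp:
  assumes "inj f" "(x, y) \<in> connected_by F"
  shows "(f x, f y) \<in> connected_by ((`) f ` F)"
  using assms(2) unfolding connected_by_def
proof (induction rule: rtrancl_induct)
  case (step y z)
  then have "(f y, f z) \<in> {(x, y). {x, y} \<in> (`) f ` F}" using edge_image_iff[OF assms(1)] by simp
  then show ?case using step.IH by (rule rtrancl_into_rtrancl[rotated])
qed simp

lemma connected_by_image_iff:
  assumes f: "bij f"
  shows "(f x, f y) \<in> connected_by ((`) f ` F) \<longleftrightarrow> (x, y) \<in> connected_by F"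
proof
  assume "(f x, f y) \<in> connected_by ((`) f ` F)"
  then have "(inv f (f x), inv f (f y)) \<in> connected_by ((`) (inv f) ` (`) f ` F)"
    by (rule connected_by_image_imp[OF bij_is_inj[OF bij_imp_bij_inv[OF f]]])
  moreover have "(`) (inv f) ` (`) f ` F = F"
    using bij_is_inj[OF f] by (simp add: image_image inv_f_f image_inv_f_f)
  ultimately show "(x, y) \<in> connected_by F" using bij_is_inj[OF f] by simp
qed (intro connected_by_image_imp bij_is_inj f)

lemma num_clusters_image:
  assumes f: "bij f"
  shows "num_clusters ((`) f ` E) ((`) f ` \<pi>) ((`) f ` \<omega>) = num_clusters E \<pi> \<omega>"
proof -
  let ?r = "connected_by (\<omega> \<union> \<pi>)" and ?s = "connected_by ((`) f ` (\<omega> \<union> \<pi>))"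
  have cls: "?s `` {f x} = f ` (?r `` {x})" for x
  proof (rule set_eqI)
    fix y
    obtain y' where y: "y = f y'" using bij_is_surj[OF f] by (metis surjD)
    show "y \<in> ?s `` {f x} \<longleftrightarrow> y \<in> f ` (?r `` {x})"
      unfolding y using connected_by_image_iff[OF f, of x y' "\<omega> \<union> \<pi>"] bij_is_inj[OF f]
      by (simp add: inj_image_mem_iff)
  qed
  have "(\<Union>((`) f ` E)) // ?s = (`) f ` ((\<Union>E) // ?r)"
  proof -
    have "(\<Union>((`) f ` E)) // ?s = (\<lambda>x. ?s `` {f x}) ` (\<Union>E)" by (auto simp: quotient_def)
    also have "\<dots> = (`) f ` ((\<Union>E) // ?r)" unfolding cls by (auto simp: quotient_def)
    finally show ?thesis .
  qed
  then show ?thesis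
    unfolding num_clusters_def image_Un[symmetric]
    using card_image[OF inj_on_subset[OF inj_image_set[OF bij_is_inj[OF f]] subset_UNIV]] by simp
qed

lemma bij_translate: "bij ((+) (z :: int ^ 'd))"
  by (rule bij_betw_byWitness[where f' = "\<lambda>x. x - z"]) auto

lemma adj_translate: "adj (z + x) (z + y) \<longleftrightarrow> adj x y"
  by (simp add: adj_def lat_add)

lemma edges_translate: "edges ((+) z ` \<Lambda>) = (`) ((+) z) ` edges \<Lambda>"
proof (intro equalityI subsetI)
  fix e assume "e \<in> edges ((+) z ` \<Lambda>)"
  then obtain x y where xy: "e = {z + x, z + y}" "x \<in> \<Lambda>" "y \<in> \<Lambda>" "adj (z + x) (z + y)"
    by (auto simp: edges_def)
  then have "{x, y} \<in> edges \<Lambda>" by (simp add: edges_doubleton adj_translate)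
  moreover have "e = (+) z ` {x, y}" using xy(1) by simp
  ultimately show "e \<in> (`) ((+) z) ` edges \<Lambda>" by blast
next
  fix e assume "e \<in> (`) ((+) z) ` edges \<Lambda>"
  then obtain x y where xy: "e = (+) z ` {x, y}" "x \<in> \<Lambda>" "y \<in> \<Lambda>" "adj x y" by (auto simp: edges_def)
  then have "e = {z + x, z + y}" by simp
  then show "e \<in> edges ((+) z ` \<Lambda>)" using xy by (simp add: edges_doubleton adj_translate)
qed

lemma edges_UNIV_translate: "(`) ((+) z) ` edges UNIV = edges UNIV" for z :: "int ^ 'd"
  using edges_translate[of z UNIV] bij_is_surj[OF bij_translate[of z]] by simp

lemma wired_translate: "wired ((`) ((+) z) ` E) = (`) ((+) z) ` wired E"
proof -
  have "inj ((`) ((+) z))" by (intro inj_image_set bij_is_inj bij_translate)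
  then show ?thesis unfolding wired_def by (simp add: image_set_diff edges_UNIV_translate)
qed

lemma rc_weight_translate:
  fixes z :: "int ^ 'd"
  shows "rc_weight q \<beta> J ((`) ((+) z) ` E) (wired ((`) ((+) z) ` E)) ((`) ((+) z) ` \<omega>) =
    rc_weight q \<beta> (\<lambda>e. J ((+) z ` e)) E (wired E) \<omega>"
proof -
  have inj: "inj ((`) ((+) z))" by (intro inj_image_set bij_is_inj bij_translate)
  have "(\<Prod>e\<in>(`) ((+) z) ` E. if e \<in> (`) ((+) z) ` \<omega> then edge_prob \<beta> J e else 1 - edge_prob \<beta> J e) =
      (\<Prod>e\<in>E. if e \<in> \<omega> then edge_prob \<beta> (\<lambda>e. J ((+) z ` e)) e else 1 - edge_prob \<beta> (\<lambda>e. J ((+) z ` e)) e)"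
    by (subst prod.reindex[OF inj_on_subset[OF inj subset_UNIV]], intro prod.cong)
      (auto simp: inj_image_mem_iff[OF inj] edge_prob_def)
  then show ?thesis
    unfolding rc_weight_def wired_translate num_clusters_image[OF bij_translate] by simp
qed

lemma disconnection_translate:
  fixes z :: "int ^ 'd"
  shows "disconnection (lat z) n ((+) z ` \<Lambda>) = (`) ((`) ((+) z)) ` disconnection 0 n \<Lambda>"
proof -
  let ?f = "(+) z"
  have inj: "inj ((`) ?f)" by (intro inj_image_set bij_is_inj bij_translate)
  have nb: "(\<exists>w. w \<notin> ?f ` \<Lambda> \<and> adj w (z + y)) \<longleftrightarrow> (\<exists>w. w \<notin> \<Lambda> \<and> adj w y)" for y
  proof
    assume "\<exists>w. w \<notin> ?f ` \<Lambda> \<and> adj w (z + y)"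
    then obtain w where "w \<notin> ?f ` \<Lambda>" "adj w (z + y)" by blast
    then have "w - z \<notin> \<Lambda>" "adj (z + (w - z)) (z + y)" by (auto simp: image_iff)
    then show "\<exists>w. w \<notin> \<Lambda> \<and> adj w y" unfolding adj_translate by blast
  next
    assume "\<exists>w. w \<notin> \<Lambda> \<and> adj w y"
    then obtain w where "w \<notin> \<Lambda>" "adj w y" by blast
    then show "\<exists>w. w \<notin> ?f ` \<Lambda> \<and> adj w (z + y)" by (intro exI[of _ "z + w"]) (auto simp: adj_translate)
  qed
  have inner: "inner_boundary (?f ` \<Lambda>) = ?f ` inner_boundary \<Lambda>"
  proof -
    have "inner_boundary (?f ` \<Lambda>) = ?f ` {y \<in> \<Lambda>. \<exists>w. w \<notin> ?f ` \<Lambda> \<and> adj w (z + y)}"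
      unfolding inner_boundary_def by blast
    then show ?thesis unfolding nb by (simp add: inner_boundary_def)
  qed
  have upper: "upper_boundary (lat z) n (?f ` \<Lambda>) = ?f ` upper_boundary 0 n \<Lambda>"
    unfolding upper_boundary_def inner by (auto simp: lat_add)
  have lower: "lower_boundary (lat z) n (?f ` \<Lambda>) = ?f ` lower_boundary 0 n \<Lambda>"
    unfolding lower_boundary_def inner by (auto simp: lat_add)
  have mem: "(`) ?f ` \<omega> \<in> disconnection (lat z) n (?f ` \<Lambda>) \<longleftrightarrow> \<omega> \<in> disconnection 0 n \<Lambda>" for \<omega>
    unfolding disconnection_def upper lower edges_translate
    using inj_image_subset_iff[OF inj, of \<omega> "edges \<Lambda>"] connected_by_image_iff[OF bij_translate[of z], of _ _ \<omega>]
    by (auto simp: Bex_def)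
  show ?thesis
  proof (intro equalityI subsetI)
    fix \<omega>' assume \<omega>': "\<omega>' \<in> disconnection (lat z) n (?f ` \<Lambda>)"
    then have "\<omega>' \<subseteq> (`) ?f ` edges \<Lambda>" using disconnection_subset edges_translate by blast
    then obtain \<omega> where "\<omega>' = (`) ?f ` \<omega>" by (auto simp: subset_image_iff)
    then show "\<omega>' \<in> (`) ((`) ?f) ` disconnection 0 n \<Lambda>" using \<omega>' mem by blast
  qed (use mem in blast)
qed

lemma rc_prob_translate:
  fixes z :: "int ^ 'd"
  shows "rc_prob q \<beta> J (edges ((+) z ` \<Lambda>)) (disconnection (lat z) n ((+) z ` \<Lambda>)) =
    rc_prob q \<beta> (\<lambda>e. J ((+) z ` e)) (edges \<Lambda>) (disconnection 0 n \<Lambda>)"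
proof -
  let ?F = "(`) ((`) ((+) z))"
  have inj: "inj ?F" by (intro inj_image_set bij_is_inj bij_translate)
  have inj': "inj_on ?F A" for A using inj inj_on_subset by blast
  have Pow: "Pow ((`) ((+) z) ` edges \<Lambda>) = ?F ` Pow (edges \<Lambda>)" by (rule image_Pow_surj[symmetric]) simp
  show ?thesis
    unfolding rc_prob_def disconnection_translate edges_translate Pow
    by (simp add: sum.reindex[OF inj'] rc_weight_translate)
qed

section \<open>The surface tension as a random variable\<close>

lemma finite_discretize:
  assumes "S \<in> unit_cubes n" "L > 0"
  shows "finite (discretize (box_R x L H S n))"
proof -
  obtain u where "orthonormal_basis u" "n = u CARD('a)" "S = cube u"
    using assms(1) unfolding unit_cubes_iff by blast
  then show ?thesis using discretize_box_R finite_tile assms(2) by metis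
qed

text \<open>The reason for tile centres in the lattice: the discretized tile is an exact translate.\<close>

lemma discretize_translate:
  fixes n :: "real ^ 'd"
  assumes "S \<in> unit_cubes n" "L > 0"
  shows "discretize (box_R (lat z) L H S n) = (+) z ` discretize (box_R 0 L H S n)"
proof -
  obtain u where u: "orthonormal_basis u" "n = u CARD('d)" "S = cube u"
    using assms(1) unfolding unit_cubes_iff by blast
  show ?thesis unfolding u(2,3) discretize_box_R[OF u(1) assms(2)] by (rule tile_translate)
qed

lemma rc_weight_cong:
  "(\<And>e. e \<in> E \<Longrightarrow> J e = J' e) \<Longrightarrow> rc_weight q \<beta> J E \<pi> \<omega> = rc_weight q \<beta> J' E \<pi> \<omega>"
  unfolding rc_weight_def edge_prob_def by (intro arg_cong2[where f = "(*)"] prod.cong) auto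

lemma tau_J_cong:
  assumes "\<And>e. e \<in> edges (discretize (box_R x L H S n)) \<Longrightarrow> J e = J' e"
  shows "tau_J q \<beta> J x L H S n = tau_J q \<beta> J' x L H S n"
proof -
  have "rc_weight q \<beta> J (edges (discretize (box_R x L H S n))) \<pi> = rc_weight q \<beta> J' (edges (discretize (box_R x L H S n))) \<pi>" for \<pi>
    using rc_weight_cong[OF assms] by (intro ext)
  then show ?thesis unfolding tau_J_def rc_measure_def Let_def by simp
qed

lemma tau_J_eq_rc_prob:
  fixes n :: "real ^ 'd"
  assumes "\<beta> \<ge> 0" "q \<ge> 1" "S \<in> unit_cubes n" "L > 0"
    "\<And>e. e \<in> edges (discretize (box_R x L H S n)) \<Longrightarrow> J e \<ge> 0"
  shows "tau_J q \<beta> J x L H S n = - ln (rc_prob q \<beta> J (edges (discretize (box_R x L H S n)))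
    (disconnection x n (discretize (box_R x L H S n)))) / L ^ (CARD('d) - 1)"
  using tau_J_free_energy[OF assms(1,2,5) finite_discretize[OF assms(3,4)]] by (simp add: free_energy_def)

lemma tau_J_translate:
  fixes n :: "real ^ 'd"
  assumes "\<beta> \<ge> 0" "q \<ge> 1" "S \<in> unit_cubes n" "L > 0" "\<And>e. e \<in> edges UNIV \<Longrightarrow> J e \<ge> 0"
  shows "tau_J q \<beta> J (lat z) L H S n = tau_J q \<beta> (\<lambda>e. J ((+) z ` e)) 0 L H S n"
proof -
  have J: "J e \<ge> 0" if "e \<in> edges \<Lambda>" for e \<Lambda> using that assms(5) edges_mono[of \<Lambda> UNIV] by auto
  have Jz: "J ((+) z ` e) \<ge> 0" if "e \<in> edges \<Lambda>" for e \<Lambda>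
    using that edges_translate[of z \<Lambda>] by (intro J[of _ "(+) z ` \<Lambda>"]) simp
  show ?thesis
    using tau_J_eq_rc_prob[OF assms(1-4) J] tau_J_eq_rc_prob[OF assms(1-4), of 0 H "\<lambda>e. J ((+) z ` e)", OF Jz]
    by (simp add: discretize_translate[OF assms(3,4)] rc_prob_translate)
qed

lemma tau_J_nonneg:
  fixes n :: "real ^ 'd"
  assumes "\<beta> \<ge> 0" "q \<ge> 1" "S \<in> unit_cubes n" "L > 0" "\<And>e. e \<in> edges UNIV \<Longrightarrow> J e \<ge> 0"
  shows "tau_J q \<beta> J x L H S n \<ge> 0"
proof -
  have J: "J e \<ge> 0" if "e \<in> edges \<Lambda>" for e \<Lambda> using that assms(5) edges_mono[of \<Lambda> UNIV] by auto
  show ?thesis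
    using tau_J_free_energy[OF assms(1,2) J finite_discretize[OF assms(3,4)]]
      free_energy_nonneg[OF assms(1,2,5) finite_discretize[OF assms(3,4)]] assms(4) by simp
qed

text \<open>The tiling without tiles: all edges near the hyperplane are closed.\<close>

lemma tau_J_le:
  fixes n :: "real ^ 'd"
  assumes "\<beta> \<ge> 0" "q \<ge> 1" "S \<in> unit_cubes n" "L > 0" "\<And>e. e \<in> edges UNIV \<Longrightarrow> J e \<in> {0..1}" "norm n = 1"
  shows "tau_J q \<beta> J 0 L H S n \<le> \<beta> * card (edges (discretize (box_R 0 L H S n))) / L ^ (CARD('d) - 1)"
proof -
  let ?\<Lambda> = "discretize (box_R 0 L H S n)"
  have J: "J e \<ge> 0" if "e \<in> edges \<Lambda>" for e \<Lambda> using that assms(5) edges_mono[of \<Lambda> UNIV] by fastforce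
  have fin: "finite ?\<Lambda>" by (rule finite_discretize[OF assms(3,4)])
  have "free_energy q \<beta> J 0 n ?\<Lambda> \<le> \<beta> * card (interstitial (0 + 1) n ?\<Lambda> (\<lambda>_. {}) ({} :: nat set))"
    using free_energy_tiles[OF assms(1,2,5,6) fin, where I = "{} :: nat set" and \<Lambda>s = "\<lambda>_. {}" and z = "\<lambda>_. 0" and c = 0]
    by (simp add: disjoint_family_on_def)
  also have "\<dots> \<le> \<beta> * card (edges ?\<Lambda>)"
    using assms(1) finite_edges[OF fin] by (auto intro!: mult_left_mono card_mono simp: interstitial_def)
  finally show ?thesis
    using tau_J_free_energy[OF assms(1,2) J fin] assms(4) by (simp add: divide_right_mono)
qed

locale dilute_model =
  fixes \<mu> :: "real measure" and q \<beta> :: real and n :: "real ^ 'd"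
  assumes dim: "CARD('d) \<ge> 2" and q: "q \<ge> 1" and \<beta>: "\<beta> \<ge> 0"
    and prob_\<mu>: "prob_space \<mu>" and sets_\<mu>: "sets \<mu> = sets (restrict_space borel {0..1})"
    and norm_n: "norm n = 1"
begin

abbreviation P :: "((int ^ 'd) set \<Rightarrow> real) measure" where "P \<equiv> coupling_measure \<mu>"

lemma space_\<mu>: "space \<mu> = {0..1}"
  using sets_eq_imp_space_eq[OF sets_\<mu>] by (simp add: space_restrict_space)

lemma measurable_id_\<mu>: "(\<lambda>x. x) \<in> borel_measurable \<mu>"
  unfolding measurable_cong_sets[OF sets_\<mu> refl] by (rule measurable_restrict_space1) simp

sublocale PP: product_prob_space "\<lambda>_. \<mu>" "edges UNIV :: (int ^ 'd) set set"
  using prob_\<mu> by (simp add: product_prob_space_def product_prob_space_axioms_def product_sigma_finite_def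
      prob_space_imp_sigma_finite)

lemma prob_P: "prob_space P"
  unfolding coupling_measure_def by (rule prob_space_PiM) (rule prob_\<mu>)

lemma in_unit_interval: "J \<in> space P \<Longrightarrow> e \<in> edges UNIV \<Longrightarrow> J e \<in> {0..1}"
  unfolding coupling_measure_def space_PiM PiE_iff space_\<mu> by blast

lemma rc_prob_measurable:
  assumes "finite E" "E \<subseteq> K"
  shows "(\<lambda>J. rc_prob q \<beta> J E D) \<in> borel_measurable (PiM K (\<lambda>_. \<mu>))"
proof -
  have J: "(\<lambda>J. J e) \<in> borel_measurable (PiM K (\<lambda>_. \<mu>))" if "e \<in> E" for e
  proof -
    have "(\<lambda>J. J e) \<in> measurable (PiM K (\<lambda>_. \<mu>)) \<mu>"
      by (rule measurable_component_singleton) (use that assms(2) in blast)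
    from measurable_compose[OF this measurable_id_\<mu>] show ?thesis .
  qed
  have "(\<lambda>J. rc_weight q \<beta> J E (wired E) \<omega>) \<in> borel_measurable (PiM K (\<lambda>_. \<mu>))" for \<omega>
    unfolding rc_weight_def edge_prob_def using J
    by (intro borel_measurable_times borel_measurable_prod borel_measurable_const) auto
  then show ?thesis unfolding rc_prob_def by (intro borel_measurable_divide borel_measurable_sum)
qed

lemma tau_J_measurable:
  assumes S: "S \<in> unit_cubes n" and L: "L > 0" and K: "edges (discretize (box_R x L H S n)) \<subseteq> K"
  shows "(\<lambda>J. tau_J q \<beta> J x L H S n) \<in> borel_measurable (PiM K (\<lambda>_. \<mu>))"
proof -
  let ?\<Lambda> = "discretize (box_R x L H S n)"
  have "tau_J q \<beta> J x L H S n = - ln (rc_prob q \<beta> J (edges ?\<Lambda>) (disconnection x n ?\<Lambda>)) / L ^ (CARD('d) - 1)"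
    if J: "J \<in> space (PiM K (\<lambda>_. \<mu>))" for J
  proof (rule tau_J_eq_rc_prob[OF \<beta> q S L])
    fix e assume "e \<in> edges ?\<Lambda>"
    then have "e \<in> K" using K by blast
    then have "J e \<in> {0..1}" using J unfolding space_PiM PiE_iff space_\<mu> by blast
    then show "J e \<ge> 0" by simp
  qed
  then show ?thesis
    using rc_prob_measurable[OF finite_edges[OF finite_discretize[OF S L]] K]
    by (subst measurable_cong) (auto intro!: borel_measurable_divide borel_measurable_uminus borel_measurable_ln)
qed

lemma tau_J_measurable_P:
  assumes "S \<in> unit_cubes n" "L > 0"
  shows "(\<lambda>J. tau_J q \<beta> J x L H S n) \<in> borel_measurable P"
  unfolding coupling_measure_def using assms by (intro tau_J_measurable edges_mono) auto

lemma distr_tau_J_translate: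
  assumes S: "S \<in> unit_cubes n" and L: "L > 0"
  shows "distr P borel (\<lambda>J. tau_J q \<beta> J (lat z) L H S n) = distr P borel (\<lambda>J. tau_J q \<beta> J 0 L H S n)"
proof -
  let ?E = "edges UNIV :: (int ^ 'd) set set" and ?f = "(`) ((+) z)"
  let ?T = "\<lambda>J. \<lambda>e\<in>?E. J (?f e)"
  have f: "?f e \<in> ?E" if "e \<in> ?E" for e using that edges_UNIV_translate[of z] by blast
  have inj: "inj ?f" by (intro inj_image_set bij_is_inj bij_translate)
  have T: "distr P P ?T = P"
    unfolding coupling_measure_def
    by (rule distr_PiM_reindex) (use prob_\<mu> f inj in \<open>auto intro: inj_on_subset\<close>)
  have Tm: "?T \<in> measurable P P"
    unfolding coupling_measure_def using f by (intro measurable_restrict measurable_component_singleton) auto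
  have "tau_J q \<beta> J (lat z) L H S n = tau_J q \<beta> (?T J) 0 L H S n" if "J \<in> space P" for J
  proof -
    have "tau_J q \<beta> J (lat z) L H S n = tau_J q \<beta> (\<lambda>e. J (?f e)) 0 L H S n"
      using in_unit_interval[OF that] by (intro tau_J_translate \<beta> q S L) auto
    also have "\<dots> = tau_J q \<beta> (?T J) 0 L H S n"
    proof (rule tau_J_cong)
      fix e assume "e \<in> edges (discretize (box_R 0 L H S n))"
      then have "e \<in> ?E" using edges_mono[OF subset_UNIV] by blast
      then show "J (?f e) = ?T J e" by simp
    qed
    finally show ?thesis .
  qed
  then have "distr P borel (\<lambda>J. tau_J q \<beta> J (lat z) L H S n) = distr P borel ((\<lambda>J. tau_J q \<beta> J 0 L H S n) \<circ> ?T)"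
    by (intro distr_cong) auto
  also have "\<dots> = distr (distr P P ?T) borel (\<lambda>J. tau_J q \<beta> J 0 L H S n)"
    by (rule distr_distr[symmetric]) (use Tm tau_J_measurable_P[OF S L] in auto)
  finally show ?thesis unfolding T .
qed

lemma indep_couplings: "prob_space.indep_vars P (\<lambda>_. \<mu>) (\<lambda>e J. J e) (edges UNIV)"
proof (cases "edges UNIV = ({} :: (int ^ 'd) set set)")
  case True
  interpret PS: prob_space P by (rule prob_P)
  show ?thesis unfolding True PS.indep_vars_def2 PS.indep_sets_def by auto
next
  case False
  let ?E = "edges UNIV :: (int ^ 'd) set set"
  have comp: "(\<lambda>J. J e) \<in> measurable P \<mu>" if "e \<in> ?E" for e
    unfolding coupling_measure_def using that by (rule measurable_component_singleton)
  have "distr P (PiM ?E (\<lambda>_. \<mu>)) (\<lambda>J. \<lambda>e\<in>?E. J e) = distr P P (\<lambda>J. J)"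
  proof (rule distr_cong)
    fix J assume "J \<in> space P"
    then show "(\<lambda>e\<in>?E. J e) = J" unfolding coupling_measure_def space_PiM by (simp add: PiE_restrict)
  qed (simp_all add: coupling_measure_def)
  also have "\<dots> = P" by (rule distr_id)
  also have "\<dots> = PiM ?E (\<lambda>e. distr P \<mu> (\<lambda>J. J e))"
    unfolding coupling_measure_def by (intro PiM_cong refl PP.PiM_component[symmetric])
  finally show ?thesis
    using prob_space.indep_vars_iff_distr_eq_PiM'[OF prob_P False comp, of "\<lambda>e. e"] by simp
qed

text \<open>Disjoint boxes have disjoint edge sets, and the surface tension of a box only depends on the couplings
of its edges.\<close>

lemma indep_tau_J:
  assumes S: "S \<in> unit_cubes n" and L: "L > 0"
    and disj: "disjoint_family_on (\<lambda>z. discretize (box_R (lat z) L H S n)) Z"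
  shows "prob_space.indep_vars P (\<lambda>_. borel) (\<lambda>z J. tau_J q \<beta> J (lat z) L H S n) Z"
proof -
  interpret prob_space P by (rule prob_P)
  let ?E = "\<lambda>z. edges (discretize (box_R (lat z) L H S n))"
  have "indep_vars (\<lambda>z. PiM (?E z) (\<lambda>_. \<mu>)) (\<lambda>z J. restrict (\<lambda>e. J e) (?E z)) Z"
  proof (rule indep_vars_restrict[OF indep_couplings])
    show "disjoint_family_on ?E Z"
      using disj disjoint_edges unfolding disjoint_family_on_def by blast
  qed (intro edges_mono subset_UNIV)
  then have "indep_vars (\<lambda>_. borel) (\<lambda>z J. tau_J q \<beta> (restrict (\<lambda>e. J e) (?E z)) (lat z) L H S n) Z"
    by (rule indep_vars_compose2) (intro tau_J_measurable S L order_refl)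
  moreover have "tau_J q \<beta> (restrict (\<lambda>e. J e) (?E z)) (lat z) L H S n = tau_J q \<beta> J (lat z) L H S n" for z J
    by (rule tau_J_cong) simp
  ultimately show ?thesis by simp
qed

definition shapes :: "(real \<times> (real ^ 'd) set) set" where
  "shapes = {0<..} \<times> unit_cubes n"

definition tau_at :: "real \<times> (real ^ 'd) set \<Rightarrow> nat \<Rightarrow> int ^ 'd \<Rightarrow> ((int ^ 'd) set \<Rightarrow> real) \<Rightarrow> real" where
  "tau_at s N z J = tau_J q \<beta> J (lat z) (real N) (fst s * real N) (snd s) n"

lemma tau_at_0: "tau_at (\<delta>, S) N 0 J = tau_J q \<beta> J 0 (real N) (\<delta> * real N) S n"
  by (simp add: tau_at_def lat_zero)

text \<open>The surface tension is a process to which the abstract results apply; a shape is a pair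
of a relative height and a unit cube.\<close>

lemma tiled_process_tau:
  assumes ne: "unit_cubes n \<noteq> {}"
  shows "tiled_process P (\<lambda>s N. tau_at s N 0) tau_at shapes (CARD('d) - 1)"
proof -
  interpret prob_space P by (rule prob_P)
  show ?thesis
  proof
    show "shapes \<noteq> {}" using ne by (auto simp: shapes_def)
    show "0 < CARD('d) - 1" using dim by simp
  next
    fix s and N :: nat assume s: "s \<in> shapes" and N: "N > 0"
    obtain \<delta> S where sd: "s = (\<delta>, S)" "\<delta> > 0" "S \<in> unit_cubes n" using s by (auto simp: shapes_def)
    show "(\<lambda>J. tau_at s N 0 J) \<in> borel_measurable P"
      unfolding sd(1) tau_at_0 using N by (intro tau_J_measurable_P sd(3)) simp
    show "\<exists>B. \<forall>J\<in>space P. tau_at s N 0 J \<in> {0..B}"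
    proof (intro exI ballI)
      fix J assume J: "J \<in> space P"
      show "tau_at s N 0 J \<in> {0..\<beta> * card (edges (discretize (box_R 0 (real N) (\<delta> * real N) S n))) / real N ^ (CARD('d) - 1)}"
        unfolding sd(1) tau_at_0 atLeastAtMost_iff
        using in_unit_interval[OF J] N by (intro conjI tau_J_nonneg tau_J_le \<beta> q sd(3) norm_n) auto
    qed
  next
    fix s and L :: nat and z :: "int ^ 'd" assume s: "s \<in> shapes" and L: "L > 0"
    then show "distr P borel (tau_at s L z) = distr P borel (\<lambda>J. tau_at s L 0 J)"
      using distr_tau_J_translate[of "snd s" "real L" z "fst s * real L"]
      by (auto simp: tau_at_def[abs_def] shapes_def lat_zero)
  next
    fix s s' and \<epsilon> :: real assume s: "s \<in> shapes" "s' \<in> shapes" and \<epsilon>: "\<epsilon> > 0"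
    obtain \<delta> S where sd: "s = (\<delta>, S)" "\<delta> > 0" "S \<in> unit_cubes n" using s(1) by (auto simp: shapes_def)
    obtain \<delta>' S' where sd': "s' = (\<delta>', S')" "\<delta>' > 0" "S' \<in> unit_cubes n" using s(2) by (auto simp: shapes_def)
    show "\<forall>\<^sub>F L in sequentially. \<forall>\<^sub>F N in sequentially.
        \<exists>Z. tile_bound (CARD('d) - 1) \<epsilon> L N (tau_at s' L) (tau_at s N 0) Z"
      using tau_tiling[OF \<beta> q norm_n sd(3) sd'(3) sd(2) sd'(2) \<epsilon>] eventually_gt_at_top[of 0]
    proof eventually_elim
      case (elim L)
      show ?case
        using elim(1)
      proof eventually_elim
        case (elim N)
        then obtain Z :: "(int ^ 'd) set" where Z: "finite Z"
          "disjoint_family_on (\<lambda>z. discretize (box_R (lat z) (real L) (\<delta>' * real L) S' n)) Z"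
          "card Z * real L ^ (CARD('d) - 1) \<le> real N ^ (CARD('d) - 1)"
          "(1 - \<epsilon>) * real N ^ (CARD('d) - 1) \<le> card Z * real L ^ (CARD('d) - 1)"
          "\<And>J. \<forall>e\<in>edges UNIV. J e \<in> {0..1} \<Longrightarrow> tau_J q \<beta> J 0 (real N) (\<delta> * real N) S n \<le>
            (real L / real N) ^ (CARD('d) - 1) * (\<Sum>z\<in>Z. tau_J q \<beta> J (lat z) (real L) (\<delta>' * real L) S' n) + \<epsilon>"
          by blast
        have "indep_vars (\<lambda>_. borel) (tau_at s' L) Z"
          using indep_tau_J[OF sd'(3) _ Z(2)] \<open>0 < L\<close> by (simp add: tau_at_def[abs_def] sd'(1))
        moreover have "tau_at s N 0 J \<le> (real L / real N) ^ (CARD('d) - 1) * (\<Sum>z\<in>Z. tau_at s' L z J) + \<epsilon>"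
          if "J \<in> space P" for J
          using Z(5)[of J] in_unit_interval[OF that] by (simp add: tau_at_def sd(1) sd'(1) lat_zero)
        ultimately show ?case using Z(1,3,4) unfolding tile_bound_def by blast
      qed
    qed
  qed
qed

end

section \<open>Uniqueness of limits, and couplings near their minimum\<close>

lemma (in prob_space) tends_in_prob_unique:
  assumes meas: "\<And>N. N > 0 \<Longrightarrow> X N \<in> borel_measurable M"
    and t: "tends_in_prob M X t" "tends_in_prob M X t'"
  shows "t = t'"
proof (rule ccontr)
  assume ne: "t \<noteq> t'"
  define \<epsilon> where "\<epsilon> = \<bar>t - t'\<bar> / 3"
  have \<epsilon>: "\<epsilon> > 0" and three: "\<bar>t - t'\<bar> = 3 * \<epsilon>" using ne by (simp_all add: \<epsilon>_def)
  let ?A = "\<lambda>N t. {\<omega> \<in> space M. \<bar>X N \<omega> - t\<bar> > \<epsilon>}"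
  have half: "\<forall>\<^sub>F N in sequentially. prob (?A N t'') < 1 / 2" if "tends_in_prob M X t''" for t''
    using that[unfolded tends_in_prob_def, rule_format, OF \<epsilon>] by (rule order_tendstoD(2)) simp
  obtain N where N: "prob (?A N t) < 1 / 2" "prob (?A N t') < 1 / 2" "N > 0"
    using eventually_happens'[OF sequentially_bot
        eventually_conj[OF half[OF t(1)] eventually_conj[OF half[OF t(2)] eventually_gt_at_top[of 0]]]]
    by blast
  note [measurable] = meas[OF N(3)]
  \<comment> \<open>No number is within \<open>\<epsilon>\<close> of both limits.\<close>
  have "space M \<subseteq> ?A N t \<union> ?A N t'"
  proof
    fix \<omega> assume "\<omega> \<in> space M"
    moreover have "\<bar>X N \<omega> - t\<bar> > \<epsilon> \<or> \<bar>X N \<omega> - t'\<bar> > \<epsilon>" using \<epsilon> three by linarith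
    ultimately show "\<omega> \<in> ?A N t \<union> ?A N t'" by blast
  qed
  then have "1 \<le> prob (?A N t \<union> ?A N t')"
    unfolding prob_space[symmetric] by (intro finite_measure_mono) measurable
  also have "\<dots> \<le> prob (?A N t) + prob (?A N t')" by (intro measure_Un_le) measurable
  finally show False using N by simp
qed

context dilute_model
begin

text \<open>The set of couplings below \<open>J_min \<mu>\<close> is a null set, as a countable union of sets that are null by the
definition of the infimum.\<close>

lemma J_min_props:
  shows J_min_in: "J_min \<mu> \<in> {0..1}"
    and J_min_pos: "\<eta> > 0 \<Longrightarrow> measure \<mu> {x \<in> space \<mu>. J_min \<mu> \<le> x \<and> x < J_min \<mu> + \<eta>} > 0"
proof -
  note [measurable] = measurable_id_\<mu>
  have meas: "{x \<in> space \<mu>. x < l} \<in> sets \<mu>" for l by measurable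
  let ?A = "{l. 0 \<le> l \<and> measure \<mu> {x \<in> space \<mu>. x < l} > 0}"
  have two: "l \<in> ?A" if "l > 1" for l
  proof -
    have "{x \<in> space \<mu>. x < l} = space \<mu>" using that by (auto simp: space_\<mu>)
    then show ?thesis using that PP.M.prob_space by simp
  qed
  have bdd: "bdd_below ?A" by (rule bdd_belowI[of _ 0]) simp
  have "2 \<in> ?A" by (rule two) simp
  then have ne: "?A \<noteq> {}" by blast
  have "J_min \<mu> \<le> l" if "l > 1" for l unfolding J_min_def using two[OF that] bdd by (rule cInf_lower)
  then have "J_min \<mu> \<le> 1" by (rule dense_ge) 
  moreover have "0 \<le> J_min \<mu>" unfolding J_min_def using ne by (rule cInf_greatest) simp
  ultimately show "J_min \<mu> \<in> {0..1}" by simp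
  have null: "measure \<mu> {x \<in> space \<mu>. x < J_min \<mu>} = 0"
  proof -
    have zero: "measure \<mu> {x \<in> space \<mu>. x < l} = 0" if l: "l < J_min \<mu>" for l
    proof (cases "l \<ge> 0")
      case True
      have "l \<notin> ?A" using cInf_lower[OF _ bdd, of l] l unfolding J_min_def by auto
      then show ?thesis using True by (simp add: less_le)
    next
      case False
      then have "{x \<in> space \<mu>. x < l} = {}" by (auto simp: space_\<mu>)
      then show ?thesis by (simp only: measure_empty)
    qed
    have "{x \<in> space \<mu>. x < J_min \<mu>} = (\<Union>i. {x \<in> space \<mu>. x < J_min \<mu> - 1 / Suc i})"
    proof (intro equalityI subsetI)
      fix x assume x: "x \<in> {x \<in> space \<mu>. x < J_min \<mu>}"
      then obtain i where "inverse (real (Suc i)) < J_min \<mu> - x" using reals_Archimedean[of "J_min \<mu> - x"] by auto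
      then have "x < J_min \<mu> - 1 / Suc i" by (simp add: inverse_eq_divide)
      then show "x \<in> (\<Union>i. {x \<in> space \<mu>. x < J_min \<mu> - 1 / Suc i})" using x by auto
    next
      fix x assume "x \<in> (\<Union>i. {x \<in> space \<mu>. x < J_min \<mu> - 1 / Suc i})"
      then obtain i where i: "x \<in> space \<mu>" "x < J_min \<mu> - 1 / Suc i" by auto
      have "1 / real (Suc i) > 0" by simp
      then have "x < J_min \<mu>" using i(2) by linarith
      then show "x \<in> {x \<in> space \<mu>. x < J_min \<mu>}" using i(1) by simp
    qed
    moreover have "emeasure \<mu> (\<Union>i. {x \<in> space \<mu>. x < J_min \<mu> - 1 / Suc i}) = 0"
    proof (rule emeasure_UN_eq_0)
      show "emeasure \<mu> {x \<in> space \<mu>. x < J_min \<mu> - 1 / Suc i} = 0" for i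
        using zero[of "J_min \<mu> - 1 / Suc i"] by (simp add: PP.M.emeasure_eq_measure)
    qed (use meas in auto)
    ultimately show ?thesis by (simp add: PP.M.emeasure_eq_measure)
  qed
  show "measure \<mu> {x \<in> space \<mu>. J_min \<mu> \<le> x \<and> x < J_min \<mu> + \<eta>} > 0" if \<eta>: "\<eta> > 0"
  proof -
    obtain l where l: "l \<in> ?A" "l < J_min \<mu> + \<eta>"
      using cInf_lessD[OF ne, of "J_min \<mu> + \<eta>"] \<eta> unfolding J_min_def by auto
    have "0 < measure \<mu> {x \<in> space \<mu>. x < l}" using l by simp
    also have "\<dots> \<le> measure \<mu> ({x \<in> space \<mu>. x < J_min \<mu>} \<union> {x \<in> space \<mu>. J_min \<mu> \<le> x \<and> x < J_min \<mu> + \<eta>})"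
      using l(2) by (intro PP.M.finite_measure_mono) (auto, measurable)
    also have "\<dots> \<le> measure \<mu> {x \<in> space \<mu>. x < J_min \<mu>} + measure \<mu> {x \<in> space \<mu>. J_min \<mu> \<le> x \<and> x < J_min \<mu> + \<eta>}"
      by (intro measure_Un_le) measurable
    finally show ?thesis using null by simp
  qed
qed

text \<open>Continuity of the random cluster probability at constant couplings, one-sided and uniform in the
direction: when all couplings are in \<open>[m, m + \<eta>)\<close>, each weight is at least \<open>exp (- \<beta> * \<eta>) ^ card E\<close>
times the weight for \<open>m\<close> and at most \<open>w \<eta>\<close>. The quotient \<open>R \<eta>\<close> of the two bounds depends on
one real variable only.\<close>

lemma rc_prob_near_min:
  fixes E :: "(int ^ 'd) set set"
  assumes E: "finite E" and D: "D \<subseteq> Pow E" "{} \<in> D" and m: "m \<ge> 0" and c: "c < rc_prob q \<beta> (\<lambda>_. m) E D"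
  shows "\<exists>\<eta>>0. \<forall>J. (\<forall>e\<in>E. m \<le> J e \<and> J e < m + \<eta>) \<longrightarrow> c < rc_prob q \<beta> J E D"
proof -
  let ?k = "num_clusters E (wired E)"
  define w where "w = (\<lambda>\<eta> \<omega>. (\<Prod>e\<in>E. if e \<in> \<omega> then 1 - exp (- \<beta> * (m + \<eta>)) else exp (- \<beta> * m)) * q ^ ?k \<omega>)"
  have w0: "w 0 = rc_weight q \<beta> (\<lambda>_. m) E (wired E)"
    unfolding w_def rc_weight_def edge_prob_def by (intro ext arg_cong2[where f = "(*)"] prod.cong) auto
  define R where "R = (\<lambda>\<eta>. exp (- \<beta> * \<eta>) ^ card E * (\<Sum>\<omega>\<in>D. w 0 \<omega>) / (\<Sum>\<omega>\<in>Pow E. w \<eta> \<omega>))"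
  have posZ: "(\<Sum>\<omega>\<in>Pow E. w 0 \<omega>) > 0" unfolding w0 using E \<beta> q m by (intro sum_rc_weight_pos) auto
  have posN: "(\<Sum>\<omega>\<in>D. w 0 \<omega>) > 0" unfolding w0 using E \<beta> q m D by (intro sum_rc_weight_pos) auto
  have "R 0 = rc_prob q \<beta> (\<lambda>_. m) E D" unfolding R_def w0 rc_prob_def by simp
  have w_lim: "((\<lambda>\<eta>. w \<eta> \<omega>) \<longlongrightarrow> w 0 \<omega>) (at_right 0)" for \<omega>
  proof -
    have "((\<lambda>\<eta>. if e \<in> \<omega> then 1 - exp (- \<beta> * (m + \<eta>)) else exp (- \<beta> * m)) \<longlongrightarrow>
        (if e \<in> \<omega> then 1 - exp (- \<beta> * (m + 0)) else exp (- \<beta> * m))) (at_right 0)" for e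
      by (cases "e \<in> \<omega>") (auto intro!: tendsto_eq_intros)
    then show ?thesis unfolding w_def by (intro tendsto_mult tendsto_prod tendsto_const)
  qed
  have "(R \<longlongrightarrow> exp (- \<beta> * 0) ^ card E * (\<Sum>\<omega>\<in>D. w 0 \<omega>) / (\<Sum>\<omega>\<in>Pow E. w 0 \<omega>)) (at_right 0)"
    unfolding R_def using posZ by (intro tendsto_intros tendsto_sum w_lim) auto
  then have "(R \<longlongrightarrow> R 0) (at_right 0)" by (simp add: R_def)
  then have "\<forall>\<^sub>F \<eta> in at_right 0. c < R \<eta>" using c \<open>R 0 = _\<close> by (intro order_tendstoD(1)) auto
  moreover have "\<forall>\<^sub>F \<eta> in at_right (0::real). \<eta> > 0" by (simp add: eventually_at_filter)
  ultimately obtain \<eta> :: real where \<eta>: "c < R \<eta>" "\<eta> > 0"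
    using eventually_happens'[OF _ eventually_conj] by (metis (mono_tags, lifting) trivial_limit_at_right_real)
  have "c < rc_prob q \<beta> J E D" if J: "\<forall>e\<in>E. m \<le> J e \<and> J e < m + \<eta>" for J
  proof -
    let ?W = "rc_weight q \<beta> J E (wired E)"
    let ?g = "\<lambda>\<omega> e. if e \<in> \<omega> then edge_prob \<beta> J e else 1 - edge_prob \<beta> J e"
    have b: "exp (- \<beta> * (m + \<eta>)) \<le> exp (- \<beta> * J e)" "exp (- \<beta> * J e) \<le> exp (- \<beta> * m)"
      "exp (- \<beta> * m) \<le> 1" if "e \<in> E" for e
    proof -
      have "\<beta> * J e \<le> \<beta> * (m + \<eta>)" "\<beta> * m \<le> \<beta> * J e"
        using J that \<beta> by (auto intro!: mult_left_mono less_imp_le[of "J e"])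
      then show "exp (- \<beta> * (m + \<eta>)) \<le> exp (- \<beta> * J e)" "exp (- \<beta> * J e) \<le> exp (- \<beta> * m)"
        by (simp_all only: exp_le_cancel_iff mult_minus_left neg_le_iff_le)
      show "exp (- \<beta> * m) \<le> 1" using \<beta> m by simp
    qed
    have up: "?W \<omega> \<le> w \<eta> \<omega>" for \<omega>
      unfolding rc_weight_def w_def
    proof (intro mult_right_mono prod_mono conjI)
      fix e assume e: "e \<in> E"
      show "0 \<le> ?g \<omega> e" using b[OF e] by (auto simp: edge_prob_def)
      show "?g \<omega> e \<le> (if e \<in> \<omega> then 1 - exp (- \<beta> * (m + \<eta>)) else exp (- \<beta> * m))"
        using b[OF e] by (auto simp: edge_prob_def)
    qed (use q in simp)
    have low: "exp (- \<beta> * \<eta>) ^ card E * w 0 \<omega> \<le> ?W \<omega>" for \<omega>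
    proof -
      have "exp (- \<beta> * \<eta>) ^ card E * w 0 \<omega> =
        (\<Prod>e\<in>E. exp (- \<beta> * \<eta>) * (if e \<in> \<omega> then 1 - exp (- \<beta> * m) else exp (- \<beta> * m))) * q ^ ?k \<omega>"
        by (simp add: w_def prod.distrib cong: if_cong)
      also have "\<dots> \<le> ?W \<omega>"
        unfolding rc_weight_def
      proof (intro mult_right_mono prod_mono conjI)
        fix e assume e: "e \<in> E"
        show "0 \<le> exp (- \<beta> * \<eta>) * (if e \<in> \<omega> then 1 - exp (- \<beta> * m) else exp (- \<beta> * m))"
          using b[OF e] by auto
        have "exp (- \<beta> * \<eta>) * exp (- \<beta> * m) = exp (- \<beta> * (m + \<eta>))"
          by (simp add: exp_add[symmetric] algebra_simps)
        then have closed: "exp (- \<beta> * \<eta>) * exp (- \<beta> * m) \<le> exp (- \<beta> * J e)"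
          using b(1)[OF e] by (simp only:)
        have "exp (- \<beta> * \<eta>) * (1 - exp (- \<beta> * m)) \<le> 1 * (1 - exp (- \<beta> * m))"
          using b(3)[OF e] \<beta> \<eta>(2) by (intro mult_right_mono) auto
        also have "\<dots> \<le> 1 - exp (- \<beta> * J e)"
          unfolding mult_1_left using b(2)[OF e] by (rule diff_left_mono)
        finally have "exp (- \<beta> * \<eta>) * (1 - exp (- \<beta> * m)) \<le> 1 - exp (- \<beta> * J e)" .
        then show "exp (- \<beta> * \<eta>) * (if e \<in> \<omega> then 1 - exp (- \<beta> * m) else exp (- \<beta> * m)) \<le> ?g \<omega> e"
          using closed by (simp add: edge_prob_def)
      qed (use q in simp)
      finally show ?thesis .
    qed
    have J0: "J e \<ge> 0" if "e \<in> E" for e using J m that by force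
    have posW: "sum ?W (Pow E) > 0" using E \<beta> q J0 by (intro sum_rc_weight_pos) auto
    have "R \<eta> = (\<Sum>\<omega>\<in>D. exp (- \<beta> * \<eta>) ^ card E * w 0 \<omega>) / (\<Sum>\<omega>\<in>Pow E. w \<eta> \<omega>)"
      by (simp add: R_def sum_distrib_left)
    also have "\<dots> \<le> sum ?W D / sum ?W (Pow E)"
    proof (rule frac_le)
      show "0 \<le> sum ?W D" using E D \<beta> q J0 by (intro sum_nonneg rc_weight_nonneg) auto
    qed (intro sum_mono low up posW)+
    finally show ?thesis using \<eta>(1) by (simp add: rc_prob_def)
  qed
  then show ?thesis using \<eta>(2) by blast
qed

lemma prob_low_tension_pos:
  assumes S: "S \<in> unit_cubes n" and L: "L > 0" and \<tau>: "tau_J q \<beta> (\<lambda>_. J_min \<mu>) 0 L H S n < \<tau>"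
  shows "measure P {J \<in> space P. tau_J q \<beta> J 0 L H S n \<le> \<tau>} > 0"
proof -
  interpret prob_space P by (rule prob_P)
  let ?\<Lambda> = "discretize (box_R 0 L H S n)"
  let ?E = "edges ?\<Lambda>" and ?D = "disconnection 0 n ?\<Lambda>" and ?m = "J_min \<mu>"
  have fin: "finite ?E" by (intro finite_edges finite_discretize[OF S L])
  have m: "?m \<ge> 0" using J_min_in by simp
  have LD: "L ^ (CARD('d) - 1) > 0" using L by simp
  have pos: "rc_prob q \<beta> J ?E ?D > 0" if "\<And>e. e \<in> ?E \<Longrightarrow> J e \<ge> 0" for J
    by (intro rc_prob_pos fin \<beta> q that disconnection_subset disconnection_empty)
  have "- ln (rc_prob q \<beta> (\<lambda>_. ?m) ?E ?D) < \<tau> * L ^ (CARD('d) - 1)"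
    using \<tau> LD m by (simp add: tau_J_eq_rc_prob[OF \<beta> q S L] field_simps)
  then have "exp (- (\<tau> * L ^ (CARD('d) - 1))) < exp (ln (rc_prob q \<beta> (\<lambda>_. ?m) ?E ?D))" by simp
  then have "exp (- (\<tau> * L ^ (CARD('d) - 1))) < rc_prob q \<beta> (\<lambda>_. ?m) ?E ?D" using pos[of "\<lambda>_. ?m"] m by simp
  from rc_prob_near_min[OF fin disconnection_subset disconnection_empty m this]
  obtain \<eta> where \<eta>: "\<eta> > 0"
    "\<And>J. \<forall>e\<in>?E. ?m \<le> J e \<and> J e < ?m + \<eta> \<Longrightarrow> exp (- (\<tau> * L ^ (CARD('d) - 1))) < rc_prob q \<beta> J ?E ?D" by blast
  let ?B = "{x \<in> space \<mu>. ?m \<le> x \<and> x < ?m + \<eta>}"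
  have B: "?B \<in> sets \<mu>" using measurable_id_\<mu> by measurable
  have "0 < (\<Prod>e\<in>?E. measure \<mu> ?B)" using J_min_pos[OF \<eta>(1)] by (intro prod_pos) auto
  also have "\<dots> = measure P (prod_emb (edges UNIV) (\<lambda>_. \<mu>) ?E (PiE ?E (\<lambda>_. ?B)))"
    unfolding coupling_measure_def
    by (rule PP.measure_PiM_emb[symmetric, OF edges_mono[OF subset_UNIV] fin B])
  also have "\<dots> \<le> measure P {J \<in> space P. tau_J q \<beta> J 0 L H S n \<le> \<tau>}"
  proof (intro finite_measure_mono subsetI)
    note [measurable] = tau_J_measurable_P[OF S L, of 0 H]
    show "{J \<in> space P. tau_J q \<beta> J 0 L H S n \<le> \<tau>} \<in> sets P" by measurable
    fix J assume J: "J \<in> prod_emb (edges UNIV) (\<lambda>_. \<mu>) ?E (PiE ?E (\<lambda>_. ?B))"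
    then have sp: "J \<in> space P" and near: "\<forall>e\<in>?E. ?m \<le> J e \<and> J e < ?m + \<eta>"
      by (auto simp: prod_emb_def coupling_measure_def space_PiM PiE_iff)
    have J0: "J e \<ge> 0" if "e \<in> ?E" for e using near m that by force
    have eq: "tau_J q \<beta> J 0 L H S n = - ln (rc_prob q \<beta> J ?E ?D) / L ^ (CARD('d) - 1)"
      by (rule tau_J_eq_rc_prob[OF \<beta> q S L J0])
    have "ln (exp (- (\<tau> * L ^ (CARD('d) - 1)))) < ln (rc_prob q \<beta> J ?E ?D)"
      using \<eta>(2)[OF near] pos[OF J0] by (subst ln_less_cancel_iff) auto
    then have "- ln (rc_prob q \<beta> J ?E ?D) \<le> \<tau> * L ^ (CARD('d) - 1)" by simp
    then have "tau_J q \<beta> J 0 L H S n \<le> \<tau>"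
      unfolding eq pos_divide_le_eq[OF LD] .
    then show "J \<in> {J \<in> space P. tau_J q \<beta> J 0 L H S n \<le> \<tau>}" using sp by simp
  qed
  finally show ?thesis .
qed

text \<open>For constant couplings all tiles have the same surface tension, so subadditivity becomes an
inequality between numbers.\<close>

lemma tau_min_limit:
  assumes ne: "unit_cubes n \<noteq> {}"
  shows "tau_min \<mu> q \<beta> n \<ge> 0"
    and "\<And>\<delta> S. \<delta> > 0 \<Longrightarrow> S \<in> unit_cubes n \<Longrightarrow>
      (\<lambda>N. tau_J q \<beta> (\<lambda>_. J_min \<mu>) 0 (real N) (\<delta> * real N) S n) \<longlonglongrightarrow> tau_min \<mu> q \<beta> n"
proof -
  let ?J = "\<lambda>_ :: (int ^ 'd) set. J_min \<mu>"
  define e where "e = (\<lambda>s N. tau_J q \<beta> ?J 0 (real N) (fst s * real N) (snd s) n)"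
  have J: "\<And>e. e \<in> edges UNIV \<Longrightarrow> ?J e \<ge> 0" using J_min_in by simp
  have "\<exists>t\<ge>0. \<forall>s\<in>shapes. e s \<longlonglongrightarrow> t"
  proof (rule eventually_sandwich_limit)
    show "shapes \<noteq> {}" using ne by (auto simp: shapes_def)
    show "\<forall>\<^sub>F N in sequentially. e s N \<ge> 0" if s: "s \<in> shapes" for s
      using eventually_gt_at_top[of 0]
    proof eventually_elim
      case (elim N)
      then show ?case unfolding e_def using s by (intro tau_J_nonneg \<beta> q J) (auto simp: shapes_def)
    qed
    fix s s' and \<epsilon> :: real assume s: "s \<in> shapes" "s' \<in> shapes" and \<epsilon>: "\<epsilon> > 0"
    have s': "snd s \<in> unit_cubes n" "snd s' \<in> unit_cubes n" "fst s > 0" "fst s' > 0"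
      using s by (auto simp: shapes_def)
    show "\<forall>\<^sub>F L in sequentially. \<forall>\<^sub>F N in sequentially. e s N \<le> e s' L + \<epsilon>"
      using tau_tiling[OF \<beta> q norm_n s' \<epsilon>] eventually_gt_at_top[of 0]
    proof eventually_elim
      case (elim L)
      then have L: "L > 0" by simp
      show ?case
        using elim(1) eventually_gt_at_top[of 0]
      proof eventually_elim
        case (elim N)
        then obtain Z :: "(int ^ 'd) set" where Z1: "card Z * real L ^ (CARD('d) - 1) \<le> real N ^ (CARD('d) - 1)"
          and all: "\<forall>J. (\<forall>e\<in>edges UNIV. J e \<in> {0..1}) \<longrightarrow> tau_J q \<beta> J 0 (real N) (fst s * real N) (snd s) n \<le>
            (real L / real N) ^ (CARD('d) - 1) *
            (\<Sum>z\<in>Z. tau_J q \<beta> J (lat z) (real L) (fst s' * real L) (snd s') n) + \<epsilon>"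
          by blast
        have Z2: "e s N \<le> (real L / real N) ^ (CARD('d) - 1) *
            (\<Sum>z\<in>Z. tau_J q \<beta> ?J (lat z) (real L) (fst s' * real L) (snd s') n) + \<epsilon>"
          unfolding e_def using all[rule_format, of ?J] J_min_in by blast
        have "tau_J q \<beta> ?J (lat z) (real L) (fst s' * real L) (snd s') n = e s' L" for z
          unfolding e_def using L s'(2) by (intro tau_J_translate \<beta> q J) auto
        then have "e s N \<le> (card Z * real L ^ (CARD('d) - 1)) / real N ^ (CARD('d) - 1) * e s' L + \<epsilon>"
          using Z2 by (simp add: power_divide mult_ac)
        also have "\<dots> \<le> 1 * e s' L + \<epsilon>"
        proof (intro add_right_mono mult_right_mono)
          show "0 \<le> e s' L" unfolding e_def using L s'(2) by (intro tau_J_nonneg \<beta> q J) auto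
        qed (use Z1 elim(2) in simp)
        finally show ?case by simp
      qed
    qed
  qed
  then obtain t where t: "t \<ge> 0" "\<forall>s\<in>shapes. e s \<longlonglongrightarrow> t" by blast
  have lim: "(\<lambda>N. tau_J q \<beta> ?J 0 (real N) (\<delta> * real N) S n) \<longlonglongrightarrow> t" if "\<delta> > 0" "S \<in> unit_cubes n" for \<delta> S
    using t(2)[rule_format, of "(\<delta>, S)"] that by (simp add: e_def shapes_def)
  obtain S0 where S0: "S0 \<in> unit_cubes n" using ne by blast
  have eq: "tau_min \<mu> q \<beta> n = t"
    unfolding tau_min_def
  proof (rule the_equality)
    fix t' assume "\<forall>\<delta>>0. \<forall>S\<in>unit_cubes n. (\<lambda>N. tau_J q \<beta> ?J 0 (real N) (\<delta> * real N) S n) \<longlonglongrightarrow> t'"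
    then have "(\<lambda>N. tau_J q \<beta> ?J 0 (real N) (1 * real N) S0 n) \<longlonglongrightarrow> t'" using S0 zero_less_one by blast
    then show "t' = t" using lim[of 1 S0] S0 by (intro LIMSEQ_unique) auto
  qed (use lim in blast)
  show "tau_min \<mu> q \<beta> n \<ge> 0" using t(1) eq by simp
  show "(\<lambda>N. tau_J q \<beta> ?J 0 (real N) (\<delta> * real N) S n) \<longlonglongrightarrow> tau_min \<mu> q \<beta> n"
    if "\<delta> > 0" "S \<in> unit_cubes n" for \<delta> S using lim[OF that] eq by simp
qed

section \<open>Lower deviations of the surface tension\<close>

text \<open>The limit in probability is unique, so the definite description denotes the limit of the means.\<close>

lemma tau_quenched_limit:
  assumes \<delta>: "\<delta> > 0" and S: "S \<in> unit_cubes n"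
  shows "tends_in_prob P (\<lambda>N J. tau_J q \<beta> J 0 (real N) (\<delta> * real N) S n) (tau_quenched \<mu> q \<beta> n)"
proof -
  have ne: "unit_cubes n \<noteq> {}" using S by blast
  interpret T: tiled_process P "\<lambda>s N. tau_at s N 0" tau_at shapes "CARD('d) - 1"
    by (rule tiled_process_tau[OF ne])
  obtain t where t: "t \<ge> 0" "\<And>s. s \<in> shapes \<Longrightarrow> (\<lambda>N. T.expectation (tau_at s N 0)) \<longlonglongrightarrow> t"
    using T.mean_limit by blast
  have lim: "tends_in_prob P (\<lambda>N J. tau_J q \<beta> J 0 (real N) (\<delta> * real N) S n) t"
    if "\<delta> > 0" "S \<in> unit_cubes n" for \<delta> S
    using T.tends_in_prob_mean_limit[OF _ t(2) t(1), of "(\<delta>, S)"] that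
    by (simp add: shapes_def tau_at_def[abs_def] lat_zero)
  have "tau_quenched \<mu> q \<beta> n = t"
    unfolding tau_quenched_def
  proof (rule the_equality)
    fix t' assume "\<forall>\<delta>>0. \<forall>S\<in>unit_cubes n.
      tends_in_prob P (\<lambda>N J. tau_J q \<beta> J 0 (real N) (\<delta> * real N) S n) t'"
    then have "tends_in_prob P (\<lambda>N J. tau_J q \<beta> J 0 (real N) (\<delta> * real N) S n) t'" using \<delta> S by blast
    then show "t' = t"
      using lim[OF \<delta> S] S by (intro T.tends_in_prob_unique[OF tau_J_measurable_P]) auto
  qed (use lim in blast)
  then show ?thesis using lim[OF \<delta> S] by simp
qed

text \<open>The set of shapes is nonempty here, which makes the definite descriptions of \<open>tau_min\<close> and
\<open>tau_quenched\<close> meaningful. Above \<open>tau_quenched\<close> the probabilities tend to \<open>1\<close>, so the rate vanishes; at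
\<open>tau_quenched\<close> itself it vanishes by continuity.\<close>

theorem lower_deviations:
  assumes ne: "unit_cubes n \<noteq> {}"
  shows "\<exists>I :: real \<Rightarrow> real.
    (\<forall>\<tau> > tau_min \<mu> q \<beta> n.
       I \<tau> \<ge> 0 \<and>
       (\<forall>\<delta> > 0. \<forall>S \<in> unit_cubes n.
          lower_dev_rate \<mu> q \<beta> n \<delta> S \<tau> \<longlonglongrightarrow> ereal (I \<tau>))) \<and>
    continuous_on {tau_min \<mu> q \<beta> n <..} I \<and>
    convex_on {tau_min \<mu> q \<beta> n <..} I \<and>
    antimono_on {tau_min \<mu> q \<beta> n <..} I \<and>
    (\<forall>\<tau> > tau_min \<mu> q \<beta> n. \<tau> \<ge> tau_quenched \<mu> q \<beta> n \<longrightarrow> I \<tau> = 0)"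
proof -
  let ?t0 = "tau_min \<mu> q \<beta> n" and ?tq = "tau_quenched \<mu> q \<beta> n" and ?D = "CARD('d) - 1"
  interpret T: tiled_process P "\<lambda>s N. tau_at s N 0" tau_at shapes ?D
    by (rule tiled_process_tau[OF ne])
  have dev: "T.dev_prob (\<delta>, S) N \<tau> = measure P {J \<in> space P. tau_J q \<beta> J 0 (real N) (\<delta> * real N) S n \<le> \<tau>}"
    for \<delta> S N \<tau> by (simp add: T.dev_prob_def tau_at_0)
  have pos: "\<forall>\<^sub>F N in sequentially. T.dev_prob s N \<tau> > 0" if s: "s \<in> shapes" and \<tau>: "\<tau> > ?t0" for s \<tau>
  proof -
    obtain \<delta> S where sd: "s = (\<delta>, S)" "\<delta> > 0" "S \<in> unit_cubes n" using s by (auto simp: shapes_def)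
    show ?thesis
      using order_tendstoD(2)[OF tau_min_limit(2)[OF ne sd(2,3)] \<tau>] eventually_gt_at_top[of 0]
    proof eventually_elim
      case (elim N)
      then show ?case unfolding sd(1) dev by (intro prob_low_tension_pos sd(3)) auto
    qed
  qed
  obtain I :: "real \<Rightarrow> real" where I: "\<And>\<tau>. \<tau> > ?t0 \<Longrightarrow> I \<tau> \<ge> 0"
    "\<And>\<tau> s. \<tau> > ?t0 \<Longrightarrow> s \<in> shapes \<Longrightarrow> (\<lambda>N. T.dev_rate s N \<tau>) \<longlonglongrightarrow> I \<tau>"
    "continuous_on {?t0<..} I" "convex_on {?t0<..} I" "antimono_on {?t0<..} I"
    using T.rate_function[OF tau_min_limit(1)[OF ne] pos] by blast
  have lim: "lower_dev_rate \<mu> q \<beta> n \<delta> S \<tau> \<longlonglongrightarrow> ereal (I \<tau>)"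
    if \<tau>: "\<tau> > ?t0" and \<delta>: "\<delta> > 0" and S: "S \<in> unit_cubes n" for \<tau> \<delta> S
  proof -
    have s: "(\<delta>, S) \<in> shapes" using \<delta> S by (simp add: shapes_def)
    have "\<forall>\<^sub>F N in sequentially. ereal (T.dev_rate (\<delta>, S) N \<tau>) = lower_dev_rate \<mu> q \<beta> n \<delta> S \<tau> N"
      using pos[OF s \<tau>]
    proof eventually_elim
      case (elim N)
      then have "measure P {J \<in> space P. tau_J q \<beta> J 0 (real N) (\<delta> * real N) S n \<le> \<tau>} \<noteq> 0"
        unfolding dev by simp
      then show ?case
        unfolding lower_dev_rate_def neg_log_def T.dev_rate_def dev by simp
    qed
    moreover have "(\<lambda>N. ereal (T.dev_rate (\<delta>, S) N \<tau>)) \<longlonglongrightarrow> ereal (I \<tau>)"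
      using I(2)[OF \<tau> s] by simp
    ultimately show ?thesis by (rule Lim_transform_eventually[rotated])
  qed
  obtain S0 where S0: "S0 \<in> unit_cubes n" using ne by blast
  have zero: "I \<tau> = 0" if \<tau>: "\<tau> > ?t0" "\<tau> > ?tq" for \<tau>
  proof -
    let ?X = "\<lambda>N J. tau_J q \<beta> J 0 (real N) (1 * real N) S0 n"
    have s: "(1, S0) \<in> shapes" using S0 by (simp add: shapes_def)
    have "(\<lambda>N. measure P {J \<in> space P. \<bar>?X N J - ?tq\<bar> > \<tau> - ?tq}) \<longlonglongrightarrow> 0"
      using tau_quenched_limit[OF zero_less_one S0] \<tau>(2) unfolding tends_in_prob_def by simp
    from tendsto_diff[OF tendsto_const[of 1] this]
    have up: "(\<lambda>N. 1 - measure P {J \<in> space P. \<bar>?X N J - ?tq\<bar> > \<tau> - ?tq}) \<longlonglongrightarrow> 1" by simp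
    have ev: "\<forall>\<^sub>F N in sequentially. 1 - measure P {J \<in> space P. \<bar>?X N J - ?tq\<bar> > \<tau> - ?tq} \<le> T.dev_prob (1, S0) N \<tau>"
      using eventually_gt_at_top[of 0]
    proof eventually_elim
      case (elim N)
      have [measurable]: "?X N \<in> borel_measurable P" "(\<lambda>J. tau_J q \<beta> J 0 (real N) (real N) S0 n) \<in> borel_measurable P"
        using elim tau_J_measurable_P[OF S0, of "real N" 0 "real N"] by simp_all
      have "1 - measure P {J \<in> space P. \<bar>?X N J - ?tq\<bar> > \<tau> - ?tq} =
          measure P (space P - {J \<in> space P. \<bar>?X N J - ?tq\<bar> > \<tau> - ?tq})"
        by (rule T.prob_compl[symmetric]) measurable
      also have "\<dots> \<le> T.dev_prob (1, S0) N \<tau>"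
        unfolding dev by (intro T.finite_measure_mono) (auto, measurable)
      finally show ?case .
    qed
    have le1: "T.dev_prob (1, S0) N \<tau> \<le> 1" for N by (simp add: T.dev_prob_def)
    have p: "(\<lambda>N. T.dev_prob (1, S0) N \<tau>) \<longlonglongrightarrow> 1"
      by (rule tendsto_sandwich[OF ev always_eventually[OF allI[OF le1]] up tendsto_const])
    have "(\<lambda>N. - ln (T.dev_prob (1, S0) N \<tau>)) \<longlonglongrightarrow> - ln 1"
      by (intro tendsto_minus tendsto_ln p) simp
    then have ln0: "(\<lambda>N. - ln (T.dev_prob (1, S0) N \<tau>)) \<longlonglongrightarrow> 0" by simp
    have lo: "\<forall>\<^sub>F N in sequentially. 0 \<le> T.dev_rate (1, S0) N \<tau>"
      using pos[OF s \<tau>(1)] by eventually_elim (rule T.dev_rate_nonneg)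
    have hi: "\<forall>\<^sub>F N in sequentially. T.dev_rate (1, S0) N \<tau> \<le> - ln (T.dev_prob (1, S0) N \<tau>)"
      using pos[OF s \<tau>(1)] eventually_gt_at_top[of 0]
    proof eventually_elim
      case (elim N)
      have "1 \<le> real N ^ ?D" using elim(2) by (intro one_le_power) simp
      moreover have "- ln (T.dev_prob (1, S0) N \<tau>) \<ge> 0" using le1[of N] elim(1) by simp
      ultimately have "- ln (T.dev_prob (1, S0) N \<tau>) / real N ^ ?D \<le> - ln (T.dev_prob (1, S0) N \<tau>) / 1"
        using elim(2) by (intro divide_left_mono) auto
      then show ?case unfolding T.dev_rate_def by simp
    qed
    have "(\<lambda>N. T.dev_rate (1, S0) N \<tau>) \<longlonglongrightarrow> 0"
      by (rule tendsto_sandwich[OF lo hi tendsto_const ln0])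
    then show ?thesis using I(2)[OF \<tau>(1) s] by (rule LIMSEQ_unique[rotated])
  qed
  have zero': "I \<tau> = 0" if \<tau>: "\<tau> > ?t0" "\<tau> \<ge> ?tq" for \<tau>
  proof -
    have "isCont I \<tau>" using I(3) \<tau>(1) by (simp add: continuous_on_eq_continuous_at[OF open_greaterThan])
    then have "(I \<longlongrightarrow> I \<tau>) (at_right \<tau>)" unfolding isCont_def by (rule tendsto_within_subset) auto
    moreover have "\<forall>\<^sub>F x in at_right \<tau>. I x = 0"
      using \<tau> zero by (intro eventually_at_rightI[of \<tau> "\<tau> + 1"]) auto
    then have "(I \<longlongrightarrow> 0) (at_right \<tau>)" by (rule tendsto_eventually)
    ultimately show ?thesis by (intro tendsto_unique[OF trivial_limit_at_right_real])
  qed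
  show ?thesis using I lim zero' by (intro exI[of _ I]) blast
qed

end

text \<open>When there is no unit cube orthogonal to \<open>n\<close>, the limits concern no shape at all and the zero function
has all the required properties; otherwise the preceding theorem applies.\<close>

theorem theorem1p6:
  fixes \<mu> :: "real measure" and q \<beta> :: real and n :: "real ^ 'd"
  assumes "CARD('d) \<ge> 2"
    and "q \<ge> 1"
    and "\<beta> \<ge> 0"
    and "prob_space \<mu>"
    and "sets \<mu> = sets (restrict_space borel {0..1})"
    and "n \<in> sphere 0 1"
  shows "\<exists>I :: real \<Rightarrow> real.
    (\<forall>\<tau> > tau_min \<mu> q \<beta> n.
       I \<tau> \<ge> 0 \<and>
       (\<forall>\<delta> > 0. \<forall>S \<in> unit_cubes n.
          lower_dev_rate \<mu> q \<beta> n \<delta> S \<tau> \<longlonglongrightarrow> ereal (I \<tau>))) \<and>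
    continuous_on {tau_min \<mu> q \<beta> n <..} I \<and>
    convex_on {tau_min \<mu> q \<beta> n <..} I \<and>
    antimono_on {tau_min \<mu> q \<beta> n <..} I \<and>
    (\<forall>\<tau> > tau_min \<mu> q \<beta> n. \<tau> \<ge> tau_quenched \<mu> q \<beta> n \<longrightarrow> I \<tau> = 0)"
proof (cases "unit_cubes n = {}")
  case True
  show ?thesis
  proof (rule exI[of _ "\<lambda>_. 0"], intro conjI allI impI)
    show "convex_on {tau_min \<mu> q \<beta> n <..} (\<lambda>_. 0 :: real)" by (simp add: convex_on_const)
    show "antimono_on {tau_min \<mu> q \<beta> n <..} (\<lambda>_. 0 :: real)" by (rule monotone_onI) simp
    show "continuous_on {tau_min \<mu> q \<beta> n <..} (\<lambda>_. 0 :: real)" by (rule continuous_on_const)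
    show "\<forall>S\<in>unit_cubes n. lower_dev_rate \<mu> q \<beta> n \<delta> S \<tau> \<longlonglongrightarrow> ereal 0" for \<delta> \<tau> unfolding True by blast
  qed simp_all
next
  case False
  have "dilute_model \<mu> q \<beta> n"
    by (rule dilute_model.intro[OF assms(1-5)]) (use assms(6) in simp)
  then show ?thesis using False by (rule dilute_model.lower_deviations)
qed

end
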